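(* Suppose $\mu_h>0$ and the regularizer is $M_h$-Lipschitz: $h^{\pi(\cdot\mid s)}(s)-h^{\pi'(\cdot\mid s)}(s)\le M_h\|\pi(\cdot\mid s)-\pi'(\cdot\mid s)\|$ for all $s,\pi,\pi'$. Run SPMD with $\eta_t=\frac{1}{\mu_h(t+1)}$, and let $\bar D_0>0$ satisfy $\max_{s,\pi}D^\pi_{\pi_0}(s)\le\bar D_0$. Let $k\ge1$. (i) If Assumption B holds, then for all $s\in\mathcal S$, $$\frac1k\sum_{t=0}^{k-1}\mathbb E[V^{\pi_t}(s)-V^{\pi^*}(s)]+\frac{\mu_h}{1-\gamma}\mathbb E_{q\sim\kappa^{\pi^*}_s}\mathbb E[D^{\pi^*}_{\pi_k}(q)]\le\frac{\mu_h\bar D_0+\mu_h^{-1}(\bar Q^2+M_h^2)\log(2k)+2\varsigma k}{(1-\gamma)k}.$$ (ii) If Assumption B holds and $\varsigma\le\sigma/k$, then for any $\delta\in(0,1]$, $$\Pr\Big\{\exists s:\ \frac1k\sum_{t=0}^{k-1}[V^{\pi_t}(s)-V^{\pi^*}(s)]+\frac{\mu_h}{1-\gamma}\mathbb E_{q\sim\kappa^{\pi^*}_s}[D^{\pi^*}_{\pi_k}(q)]>\frac{\mu_h\bar D_0+[25\mu_h^{-1}(\bar Q^2+M_h^2)+2\sigma\sqrt{3C(k)}](\log(4k|\mathcal S|/\delta))^{3/2}}{(1-\gamma)k}\Big\}\le(k+1)\delta,$$ where $C(k):=\frac{6\bar D_0}{1-\gamma}+\frac{75(\bar Q^2+M_h^2)(\log(4k|\mathcal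 S|/\delta))^{3/2}}{(1-\gamma)\mu_h^2}+\frac{108\sigma^2(\log(4k|\mathcal S|/\delta))^3}{(1-\gamma)^2\mu_h^2}$.
   Context: MDP: finite $\mathcal S$, $\mathcal A$, transition probabilities $\mathcal P(s'\mid s,a)$, cost $c$, discount $\gamma\in[0,1)$; policies assign $\pi(\cdot\mid s)\in\Delta_{|\mathcal A|}$. $\|\cdot\|$ is a norm on $\mathbb R^{|\mathcal A|}$ with $\max_{p\in\Delta_{|\mathcal A|}}\|p\|\le1$ and dual norm $\|\cdot\|_*$; for $F:\mathcal S\times\mathcal A\to\mathbb R$, $\|F\|_*:=\max_s\|F(s,\cdot)\|_*$. $\omega$ is a differentiable distance-generating function on $\Delta_{|\mathcal A|}$, 1-strongly convex w.r.t. $\|\cdot\|$; $D^{\pi'}_\pi(s):=\omega(\pi'(\cdot\mid s))-\omega(\pi(\cdot\mid s))-\langle\nabla\omega(\pi(\cdot\mid s)),\pi'(\cdot\mid s)-\pi(\cdot\mid s)\rangle$. For each $s$, $p\mapsto h^p(s)$ is closed convex with $h^{p}(s)-h^{p'}(s)-\langle (h')^{p'}(s,\cdot),p-p'\rangle\ge\mu_h[\omega(p)-\omega(p')-\langle\nabla\omega(p'),p-p'\rangle]$. $V^\pi(s)=\mathbb E[\sum_{t\ge0}\gamma^t(c(s_t,a_t)+h^{\pi(\cdot\mid s_t)}(s_t))\mid s_0=s,\ a_t\sim\pi(\cdot\mid s_t),\ s_{t+1}\sim\mathcal P(\cdot\mid s_t,a_t)]$, $Q^\pi(s,a)$ the same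 with $a_0=a$; $\pi^*$ is an optimal policy; $\kappa^\pi_s(q):=(1-\gamma)\sum_{t\ge0}\gamma^t\Pr^\pi\{s_t=q\mid s_0=s\}$. SPMD: a random vector $\xi_t$ produces an estimate $\tilde Q^{\pi_t}$ of $Q^{\pi_t}$ and $\pi_{t+1}(\cdot\mid s)=\operatorname{argmin}_{p\in\Delta_{|\mathcal A|}}\{\eta_t[\langle\tilde Q^{\pi_t}(s,\cdot),p\rangle+h^p(s)]+\omega(p)-\omega(\pi_t(\cdot\mid s))-\langle\nabla\omega(\pi_t(\cdot\mid s)),p-\pi_t(\cdot\mid s)\rangle\}$; $\pi_t$ is determined by $\xi_{[t-1]}$. Assumption B: there are $\varsigma,\sigma,\bar Q\ge0$ with $\|\mathbb E_{\xi_t\mid\xi_{[t-1]}}[\tilde Q^{\pi_t}]-Q^{\pi_t}\|_*\le\varsigma$, $\mathbb E_{\xi_t\mid\xi_{[t-1]}}\exp\{\|\tilde Q^{\pi_t}-Q^{\pi_t}\|_*^2/\sigma^2\}\le2$, $\mathbb E_{\xi_t\mid\xi_{[t-1]}}\exp\{\|\tilde Q^{\pi_t}\|_*^2/\bar Q^2\}\le2$ for all $t$. *)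

theory Defs
  imports "HOL-Probability.Probability"
begin

definition prob_simplex :: "(real^'a::finite) set" where
  "prob_simplex = {p. (\<forall>a. 0 \<le> p$a) \<and> (\<Sum>a\<in>UNIV. p$a) = 1}"

definition is_norm :: "(real^'a::finite \<Rightarrow> real) \<Rightarrow> bool" where
  "is_norm nrm \<longleftrightarrow> (\<forall>x. 0 \<le> nrm x) \<and> (\<forall>x. nrm x = 0 \<longleftrightarrow> x = 0)
     \<and> (\<forall>c x. nrm (c *\<^sub>R x) = \<bar>c\<bar> * nrm x) \<and> (\<forall>x y. nrm (x + y) \<le> nrm x + nrm y)"

definition dual_norm :: "(real^'a::finite \<Rightarrow> real) \<Rightarrow> real^'a \<Rightarrow> real" where
  "dual_norm nrm g = Sup {g \<bullet> x | x. nrm x \<le> 1}"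

definition dual_normF :: "(real^'a::finite \<Rightarrow> real) \<Rightarrow> ('s::finite \<Rightarrow> real^'a) \<Rightarrow> real" where
  "dual_normF nrm F = Max (range (\<lambda>s. dual_norm nrm (F s)))"

definition strongly_convex_wrt ::
  "(real^'a::finite \<Rightarrow> real) \<Rightarrow> real \<Rightarrow> (real^'a \<Rightarrow> real) \<Rightarrow> (real^'a) set \<Rightarrow> bool" where
  "strongly_convex_wrt nrm mu f S \<longleftrightarrow>
     (\<forall>x\<in>S. \<forall>y\<in>S. \<forall>l\<in>{0..1}.
        f (l *\<^sub>R x + (1 - l) *\<^sub>R y) \<le> l * f x + (1 - l) * f y - mu / 2 * l * (1 - l) * (nrm (x - y))\<^sup>2)"

definition bregman :: "(real^'a::finite \<Rightarrow> real) \<Rightarrow> (real^'a \<Rightarrow> real^'a) \<Rightarrow> real^'a \<Rightarrow> real^'a \<Rightarrow> real" where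
  "bregman omega gomega p' p = omega p' - omega p - gomega p \<bullet> (p' - p)"

definition is_policy :: "('s \<Rightarrow> real^'a::finite) \<Rightarrow> bool" where
  "is_policy pol \<longleftrightarrow> (\<forall>s. pol s \<in> prob_simplex)"

text \<open>state_dist P pol t s q = Pr^pol { s_t = q | s_0 = s }\<close>
fun state_dist :: "('s::finite \<Rightarrow> 'a::finite \<Rightarrow> 's \<Rightarrow> real) \<Rightarrow> ('s \<Rightarrow> real^'a) \<Rightarrow> nat \<Rightarrow> 's \<Rightarrow> 's \<Rightarrow> real" where
  "state_dist P pol 0 s q = (if q = s then 1 else 0)"
| "state_dist P pol (Suc t) s q = (\<Sum>r\<in>UNIV. state_dist P pol t s r * (\<Sum>a\<in>UNIV. pol r $ a * P r a q))"

text \<open>V^pol(s) = E[ sum_t gamma^t (c(s_t,a_t) + h^{pol(s_t)}(s_t)) | s_0 = s ]\<close>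
definition value_fn :: "('s::finite \<Rightarrow> 'a::finite \<Rightarrow> 's \<Rightarrow> real) \<Rightarrow> ('s \<Rightarrow> 'a \<Rightarrow> real) \<Rightarrow>
    ('s \<Rightarrow> real^'a \<Rightarrow> real) \<Rightarrow> real \<Rightarrow> ('s \<Rightarrow> real^'a) \<Rightarrow> 's \<Rightarrow> real" where
  "value_fn P c h gamma pol s =
     (\<Sum>t. gamma ^ t * (\<Sum>q\<in>UNIV. state_dist P pol t s q * ((\<Sum>a\<in>UNIV. pol q $ a * c q a) + h q (pol q))))"

text \<open>Q^pol(s,a): same expectation with a_0 = a (first step written out)\<close>
definition q_fn :: "('s::finite \<Rightarrow> 'a::finite \<Rightarrow> 's \<Rightarrow> real) \<Rightarrow> ('s \<Rightarrow> 'a \<Rightarrow> real) \<Rightarrow>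
    ('s \<Rightarrow> real^'a \<Rightarrow> real) \<Rightarrow> real \<Rightarrow> ('s \<Rightarrow> real^'a) \<Rightarrow> 's \<Rightarrow> real^'a" where
  "q_fn P c h gamma pol s =
     (\<chi> a. c s a + h s (pol s) + gamma * (\<Sum>s'\<in>UNIV. P s a s' * value_fn P c h gamma pol s'))"

definition visitation :: "('s::finite \<Rightarrow> 'a::finite \<Rightarrow> 's \<Rightarrow> real) \<Rightarrow> real \<Rightarrow> ('s \<Rightarrow> real^'a) \<Rightarrow> 's \<Rightarrow> 's \<Rightarrow> real" where
  "visitation P gamma pol s q = (1 - gamma) * (\<Sum>t. gamma ^ t * state_dist P pol t s q)"

definition hist_alg :: "'m measure \<Rightarrow> 'x measure \<Rightarrow> (nat \<Rightarrow> 'm \<Rightarrow> 'x) \<Rightarrow> nat \<Rightarrow> 'm measure" where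
  "hist_alg M X xi t = sigma (space M) {xi i -` A \<inter> space M | i A. i < t \<and> A \<in> sets X}"

definition spmd_step :: "(real^'a::finite \<Rightarrow> real) \<Rightarrow> (real^'a \<Rightarrow> real^'a) \<Rightarrow> ('s \<Rightarrow> real^'a \<Rightarrow> real) \<Rightarrow>
    real \<Rightarrow> ('s \<Rightarrow> real^'a) \<Rightarrow> ('s \<Rightarrow> real^'a) \<Rightarrow> ('s \<Rightarrow> real^'a) \<Rightarrow> bool" where
  "spmd_step omega gomega h eta Qtil pol_old pol_new \<longleftrightarrow>
     (\<forall>s. pol_new s \<in> prob_simplex \<and>
        (\<forall>p\<in>prob_simplex. eta * (Qtil s \<bullet> pol_new s + h s (pol_new s)) + bregman omega gomega (pol_new s) (pol_old s)
                     \<le> eta * (Qtil s \<bullet> p + h s p) + bregman omega gomega p (pol_old s)))"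

text \<open>exp(x^2/sigma^2), with the convention (for sigma = 0) that it is 1 if x = 0 and +infinity otherwise\<close>
definition psi2 :: "real \<Rightarrow> real \<Rightarrow> ennreal" where
  "psi2 sg x = (if sg = 0 then (if x = 0 then 1 else \<infinity>) else ennreal (exp (x\<^sup>2 / sg\<^sup>2)))"

definition assumption_B :: "'m measure \<Rightarrow> 'x measure \<Rightarrow> (nat \<Rightarrow> 'm \<Rightarrow> 'x) \<Rightarrow> (real^'a::finite \<Rightarrow> real) \<Rightarrow>
    (('s::finite \<Rightarrow> real^'a) \<Rightarrow> 's \<Rightarrow> real^'a) \<Rightarrow> (nat \<Rightarrow> 'm \<Rightarrow> 's \<Rightarrow> real^'a) \<Rightarrow> (nat \<Rightarrow> 'm \<Rightarrow> 's \<Rightarrow> real^'a) \<Rightarrow>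
    real \<Rightarrow> real \<Rightarrow> real \<Rightarrow> bool" where
  "assumption_B M X xi nrm Q pis Qtil vsig sig Qbar \<longleftrightarrow>
     0 \<le> vsig \<and> 0 \<le> sig \<and> 0 \<le> Qbar \<and>
     (\<forall>t.
       (AE w in M. dual_normF nrm (\<lambda>s. (\<chi> a. real_cond_exp M (hist_alg M X xi t) (\<lambda>w'. Qtil t w' s $ a) w)
                                         - Q (pis t w) s) \<le> vsig)
     \<and> (AE w in M. nn_cond_exp M (hist_alg M X xi t)
             (\<lambda>w'. psi2 sig (dual_normF nrm (\<lambda>s. Qtil t w' s - Q (pis t w') s))) w \<le> 2)
     \<and> (AE w in M. nn_cond_exp M (hist_alg M X xi t)
             (\<lambda>w'. psi2 Qbar (dual_normF nrm (\<lambda>s. Qtil t w' s))) w \<le> 2))"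

end

theory Submission
  imports Defs
begin

text \<open>
  Summing the mirror descent inequality at each state, with the weights $1/\eta_t = \mu(t+1)$, and averaging
  over the visitation measure of $\pi^*$ turns, by the performance difference lemma, into a bound for
  $(1-\gamma)\sum_t (V^{\pi_t}-V^{\pi^*}) + \mu(k+1)\,\mathbb{E}_\kappa D^{\pi^*}_{\pi_k}$ in terms of
  $\|\tilde Q\|_*^2$ and of a noise sum $\sum_t \nu_t$.  The strong convexity of $h$ is used twice in each
  step, which produces error weights $1/(\mu(t+2))$, whose sum is at most $\log(k+1)/\mu \le \log(2k)/\mu$.
  Taking expectations gives (i).

  For (ii), $|\nu_t|$ is at most $\|\tilde Q-Q\|_*\sqrt{2\,\mathbb{E}_\kappa D^{\pi^*}_{\pi_t}}$, and optimality
  of $\pi^*$ makes the regret sum nonnegative, so the same inequality bounds $\mathbb{E}_\kappa D^{\pi^*}_{\pi_t}$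
  by the noise up to time $t$.  Truncating the noise to the event $\mathbb{E}_\kappa D^{\pi^*}_{\pi_t}\le C/(t+1)$
  makes its sum subgaussian with variance proxy of order $\sigma^2 C\log k$; on the event where all these tail
  bounds hold, induction on $t$ shows that the truncation is never active.
\<close>

subsection \<open>The simplex, norms and dual norms\<close>

text \<open>Two obstacles shape the details. The first is weak first-order information:
  differentiability constrains \<open>gomega\<close> only along directions inside the simplex,
  \<open>hd\<close> is known only through an inequality, and the iterates only through an optimality
  property. So first-order arguments use difference quotients along segments, and adaptedness of the
  iterates has to be derived from uniqueness and continuity of the minimiser.

  The second is circularity: the noise bound presupposes a divergence bound
  \<open>C / (t + 1)\<close>, which is itself deduced from the noise bound. The circle closes if
  \<open>mu * Dbar0 + (Qbar^2 + Mh^2) * L / mu + 2 * L * sig * sqrt (2 * C) \<le> mu * C\<close>.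
  Since the noise grows only like \<open>sqrt C\<close>, it is enough that \<open>C\<close>
  dominates the two fixed terms divided by \<open>mu\<close> and a multiple of
  \<open>(sig * L / mu)^2\<close>; these are its three summands. Truncation is decided before the
  sample of step \<open>t\<close> is drawn, so it preserves the conditional mean bound.\<close>

lemma prob_simplex_nonneg: "p \<in> prob_simplex \<Longrightarrow> 0 \<le> p $ a"
  and prob_simplex_sum: "p \<in> prob_simplex \<Longrightarrow> (\<Sum>a\<in>UNIV. p $ a) = 1"
  by (auto simp: prob_simplex_def)

lemma axis_in_prob_simplex: "axis a 1 \<in> prob_simplex"
  by (auto simp: prob_simplex_def axis_def)

lemma convex_prob_simplex: "convex prob_simplex"
  by (auto simp: convex_def prob_simplex_def sum.distrib simp flip: sum_distrib_left)

lemma segment_in_prob_simplex: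
  assumes "p \<in> prob_simplex" "q \<in> prob_simplex" "0 \<le> l" "l \<le> 1"
  shows "p + l *\<^sub>R (q - p) \<in> prob_simplex"
proof -
  have "(1 - l) *\<^sub>R p + l *\<^sub>R q \<in> prob_simplex"
    using convexD[OF convex_prob_simplex assms(1,2), of "1 - l" l] assms by simp
  then show ?thesis by (simp add: algebra_simps)
qed

lemma closed_prob_simplex: "closed (prob_simplex :: (real^'a::finite) set)"
  unfolding prob_simplex_def
  by (intro closed_Collect_conj closed_Collect_all closed_Collect_le closed_Collect_eq continuous_intros)

lemma compact_prob_simplex: "compact (prob_simplex :: (real^'a::finite) set)"
proof -
  have "norm p \<le> 1" if "p \<in> prob_simplex" for p :: "real^'a"
    using norm_le_l1_cart[of p] that by (simp add: prob_simplex_def)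
  then show ?thesis
    using closed_prob_simplex by (auto simp: compact_eq_bounded_closed bounded_iff)
qed

text \<open>An affine function is the average of its vertex values. This reduces a linear functional
  on differences \<open>q - p\<close> to finitely many numbers, by which the vector
  \<open>gomega p\<close> can later be replaced.\<close>

lemma simplex_comb:
  fixes g :: "real^'a::finite"
  assumes "q \<in> prob_simplex"
  shows "g \<bullet> (q - p) = (\<Sum>a\<in>UNIV. q $ a * (g \<bullet> (axis a 1 - p)))"
proof -
  have "(\<Sum>a\<in>UNIV. q $ a * (g \<bullet> (axis a 1 - p))) = (\<Sum>a\<in>UNIV. q $ a * (g $ a)) - (\<Sum>a\<in>UNIV. q $ a) * (g \<bullet> p)"
    by (simp add: inner_diff_right inner_axis algebra_simps sum_subtractf sum_distrib_left)
  also have "\<dots> = g \<bullet> q - g \<bullet> p"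
    using assms by (simp add: prob_simplex_sum inner_vec_def mult.commute)
  finally show ?thesis by (simp add: inner_diff_right)
qed

lemma is_normD:
  assumes "is_norm nrm"
  shows "0 \<le> nrm x" "nrm x = 0 \<longleftrightarrow> x = 0" "nrm (c *\<^sub>R x) = \<bar>c\<bar> * nrm x" "nrm (x + y) \<le> nrm x + nrm y"
    "nrm (- x) = nrm x" "nrm (x - y) = nrm (y - x)"
proof -
  show n: "0 \<le> nrm x" "nrm x = 0 \<longleftrightarrow> x = 0" "nrm (c *\<^sub>R x) = \<bar>c\<bar> * nrm x" "nrm (x + y) \<le> nrm x + nrm y"
    for x y c using assms by (auto simp: is_norm_def)
  show neg: "nrm (- x) = nrm x" for x using n(3)[of "-1" x] by simp
  show "nrm (x - y) = nrm (y - x)" using neg[of "x - y"] by simp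
qed

lemma is_norm_continuous:
  fixes nrm :: "real^'a::finite \<Rightarrow> real"
  assumes "is_norm nrm"
  shows "continuous_on UNIV nrm"
proof (rule convex_on_continuous)
  show "convex_on UNIV nrm"
  proof (rule convex_onI)
    fix t :: real and x y assume "0 < t" "t < 1"
    then show "nrm ((1 - t) *\<^sub>R x + t *\<^sub>R y) \<le> (1 - t) * nrm x + t * nrm y"
      using is_normD(4)[OF assms, of "(1 - t) *\<^sub>R x" "t *\<^sub>R y"] is_normD(3)[OF assms] by simp
  qed simp
qed simp

text \<open>\<open>c\<close> is the minimum of \<open>nrm\<close> over the Euclidean unit sphere.
  The comparison makes the supremum in \<open>dual_norm\<close> finite and later gives the Lipschitz
  constant of the mirror step.\<close>

lemma is_norm_lower:
  fixes nrm :: "real^'a::finite \<Rightarrow> real"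
  assumes "is_norm nrm"
  obtains c where "c > 0" "\<And>x. c * norm x \<le> nrm x"
proof -
  have "compact (sphere (0 :: real^'a) 1)" by simp
  moreover have "sphere (0 :: real^'a) 1 \<noteq> {}" by simp
  ultimately obtain m where m: "m \<in> sphere 0 1" "\<And>x. x \<in> sphere 0 1 \<Longrightarrow> nrm m \<le> nrm x"
    using continuous_attains_inf[of "sphere (0 :: real^'a) 1" nrm]
      continuous_on_subset[OF is_norm_continuous[OF assms]] by blast
  have "nrm m > 0"
    using m(1) is_normD(1,2)[OF assms, of m] by (cases "m = 0") (auto simp: less_le)
  moreover have "nrm m * norm x \<le> nrm x" for x
  proof (cases "x = 0")
    case True
    then show ?thesis using is_normD(1)[OF assms] by simp
  next
    case False
    then have "nrm m \<le> nrm ((1 / norm x) *\<^sub>R x)" by (intro m(2)) simp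
    also have "\<dots> = nrm x / norm x" using is_normD(3)[OF assms] by simp
    finally show ?thesis using False by (simp add: field_simps)
  qed
  ultimately show thesis using that by blast
qed

lemma dual_norm_bdd:
  fixes nrm :: "real^'a::finite \<Rightarrow> real"
  assumes "is_norm nrm"
  shows "bdd_above {g \<bullet> x | x. nrm x \<le> 1}"
proof -
  obtain c where c: "c > 0" "\<And>x. c * norm x \<le> nrm x" by (rule is_norm_lower[OF assms]) blast
  have "g \<bullet> x \<le> norm g * (1 / c)" if "nrm x \<le> 1" for x
  proof -
    have "norm x \<le> 1 / c" using c(1) order_trans[OF c(2) that] by (simp add: field_simps)
    then show ?thesis using norm_cauchy_schwarz[of g x] mult_left_mono[of "norm x" "1 / c" "norm g"] by simp
  qed
  then show ?thesis by (intro bdd_aboveI[of _ "norm g * (1 / c)"]) auto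
qed

lemma dual_norm_upper:
  fixes nrm :: "real^'a::finite \<Rightarrow> real"
  assumes "is_norm nrm" "nrm x \<le> 1"
  shows "g \<bullet> x \<le> dual_norm nrm g"
  unfolding dual_norm_def using assms by (intro cSup_upper dual_norm_bdd) auto

lemma dual_norm_nonneg:
  fixes nrm :: "real^'a::finite \<Rightarrow> real"
  assumes "is_norm nrm"
  shows "0 \<le> dual_norm nrm g"
  using dual_norm_upper[OF assms, of 0 g] is_normD(2)[OF assms, of 0] by simp

lemma dual_norm_holder:
  fixes nrm :: "real^'a::finite \<Rightarrow> real"
  assumes "is_norm nrm"
  shows "g \<bullet> x \<le> dual_norm nrm g * nrm x"
proof (cases "x = 0")
  case False
  then have pos: "nrm x > 0" using is_normD(1,2)[OF assms, of x] by (simp add: less_le)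
  then have "g \<bullet> ((1 / nrm x) *\<^sub>R x) \<le> dual_norm nrm g"
    by (intro dual_norm_upper assms) (simp add: is_normD(3)[OF assms])
  then show ?thesis using pos by (simp add: field_simps)
next
  case True
  then show ?thesis using dual_norm_nonneg[OF assms] is_normD(1)[OF assms, of x] by simp
qed

lemma dual_norm_abs_holder:
  fixes nrm :: "real^'a::finite \<Rightarrow> real"
  assumes "is_norm nrm"
  shows "\<bar>g \<bullet> x\<bar> \<le> dual_norm nrm g * nrm x"
  using dual_norm_holder[OF assms, of g x] dual_norm_holder[OF assms, of g "- x"]
  by (simp add: is_normD(5)[OF assms] abs_if)

text \<open>A finite-valued supremum of linear functionals is convex, and a convex function on the
  whole space is continuous. Measurability of the random dual norms rests on this.\<close>

lemma dual_norm_continuous: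
  fixes nrm :: "real^'a::finite \<Rightarrow> real"
  assumes "is_norm nrm"
  shows "continuous_on UNIV (dual_norm nrm)"
proof (rule convex_on_continuous)
  show "convex_on UNIV (dual_norm nrm)"
  proof (rule convex_onI)
    fix t :: real and x y :: "real^'a" assume t: "0 < t" "t < 1"
    have "nrm 0 \<le> 1" using is_normD(2)[OF assms, of 0] by simp
    then show "dual_norm nrm ((1 - t) *\<^sub>R x + t *\<^sub>R y) \<le> (1 - t) * dual_norm nrm x + t * dual_norm nrm y"
      using t dual_norm_upper[OF assms]
      by (subst (1) dual_norm_def, intro cSup_least)
        (auto simp: inner_add_left intro!: add_mono mult_left_mono)
  qed simp
qed simp

text \<open>Vertices of the simplex have norm at most 1, so testing \<open>g\<close> against them
  controls its coordinates. Conditional expectations of the estimates are taken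
  coordinatewise.\<close>

lemma dual_norm_component:
  fixes nrm :: "real^'a::finite \<Rightarrow> real"
  assumes "is_norm nrm" "\<forall>p\<in>prob_simplex. nrm p \<le> 1"
  shows "\<bar>g $ a\<bar> \<le> dual_norm nrm g"
proof -
  have "\<bar>g $ a\<bar> \<le> dual_norm nrm g * nrm (axis a 1)"
    using dual_norm_abs_holder[OF assms(1), of g "axis a 1"] by (simp add: inner_axis)
  also have "\<dots> \<le> dual_norm nrm g * 1"
    using assms axis_in_prob_simplex dual_norm_nonneg[OF assms(1)] by (intro mult_left_mono) auto
  finally show ?thesis by simp
qed

lemma dual_norm_le_dual_normF: "dual_norm nrm (F s) \<le> dual_normF nrm F"
  unfolding dual_normF_def by (intro Max_ge) auto

lemma dual_normF_nonneg: "is_norm nrm \<Longrightarrow> 0 \<le> dual_normF nrm F"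
  using dual_norm_le_dual_normF[of nrm F undefined] dual_norm_nonneg[of nrm "F undefined"] by linarith

lemma dual_normF_measurable:
  fixes f :: "'m \<Rightarrow> 's::finite \<Rightarrow> real^'a::finite"
  assumes "is_norm nrm" "\<And>s. (\<lambda>w. f w s) \<in> borel_measurable N"
  shows "(\<lambda>w. dual_normF nrm (f w)) \<in> borel_measurable N"
proof -
  have [measurable]: "dual_norm nrm \<in> borel_measurable borel"
    by (intro borel_measurable_continuous_onI dual_norm_continuous assms)
  note [measurable] = assms(2)
  show ?thesis unfolding dual_normF_def by (intro borel_measurable_Max) auto
qed

subsection \<open>Mirror steps\<close>

locale dgf =
  fixes nrm :: "real^'a::finite \<Rightarrow> real" and omega :: "real^'a \<Rightarrow> real" and gomega :: "real^'a \<Rightarrow> real^'a"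
  assumes nrm: "is_norm nrm"
    and omega_diff: "\<forall>p\<in>prob_simplex. (omega has_derivative (\<lambda>v. gomega p \<bullet> v)) (at p within prob_simplex)"
    and omega_sc: "strongly_convex_wrt nrm 1 omega prob_simplex"
begin

abbreviation D where "D \<equiv> bregman omega gomega"

lemma omega_continuous: "continuous_on prob_simplex omega"
  using omega_diff by (meson continuous_on_eq_continuous_within has_derivative_continuous)

text \<open>At boundary points the simplex offers only one-sided segments, so the derivative is used
  as a right limit. Every later analytic fact about \<open>gomega\<close> passes through this
  limit.\<close>

lemma directional_derivative:
  assumes pq: "p \<in> prob_simplex" "q \<in> prob_simplex"
  shows "((\<lambda>l. (omega (p + l *\<^sub>R (q - p)) - omega p) / l) \<longlongrightarrow> gomega p \<bullet> (q - p)) (at_right 0)"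
proof -
  let ?f = "\<lambda>l::real. p + l *\<^sub>R (q - p)"
  have "?f ` {0..1} \<subseteq> prob_simplex" using segment_in_prob_simplex[OF pq] by auto
  then have "(omega has_derivative (\<lambda>v. gomega p \<bullet> v)) (at (?f 0) within ?f ` {0..1})"
    using omega_diff pq by (auto intro: has_derivative_subset)
  moreover have "(?f has_derivative (\<lambda>l. l *\<^sub>R (q - p))) (at 0 within {0..1})"
    by (auto intro!: derivative_eq_intros)
  ultimately have "((\<lambda>l. omega (?f l)) has_derivative (\<lambda>l. gomega p \<bullet> (l *\<^sub>R (q - p)))) (at 0 within {0..1})"
    by (rule has_derivative_in_compose[rotated])
  then have "((\<lambda>l. omega (?f l)) has_field_derivative (gomega p \<bullet> (q - p))) (at 0 within {0..1})"
    unfolding has_field_derivative_def by (rule has_derivative_eq_rhs) (simp add: fun_eq_iff mult.commute)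
  then have "((\<lambda>y. (omega (?f y) - omega (?f 0)) / (y - 0)) \<longlongrightarrow> gomega p \<bullet> (q - p)) (at 0 within {0..1})"
    unfolding has_field_derivative_iff .
  then show ?thesis by (simp add: at_within_Icc_at_right)
qed

lemma eventually_at_right_0_small: "0 < b \<Longrightarrow> eventually (\<lambda>l::real. 0 < l \<and> l < b) (at_right 0)"
  by (auto simp: eventually_at_right_field)

text \<open>Dividing the strong convexity inequality by \<open>l\<close> and letting
  \<open>l\<close> tend to 0 gives its first-order form; the factor \<open>1 - l\<close> disappears
  in the limit.\<close>

lemma bregman_lower:
  assumes pq: "p \<in> prob_simplex" "q \<in> prob_simplex"
  shows "(nrm (p - q))\<^sup>2 / 2 \<le> D p q"
proof -
  have "gomega q \<bullet> (p - q) \<le> omega p - omega q - (1 - 0) / 2 * (nrm (p - q))\<^sup>2"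
  proof (rule tendsto_le[OF _ _ directional_derivative[OF pq(2,1)]])
    show "((\<lambda>l::real. omega p - omega q - (1 - l) / 2 * (nrm (p - q))\<^sup>2)
        \<longlongrightarrow> omega p - omega q - (1 - 0) / 2 * (nrm (p - q))\<^sup>2) (at_right 0)"
      by (intro tendsto_intros) auto
    show "eventually (\<lambda>l. (omega (q + l *\<^sub>R (p - q)) - omega q) / l
         \<le> omega p - omega q - (1 - l) / 2 * (nrm (p - q))\<^sup>2) (at_right 0)"
      using eventually_at_right_0_small[OF zero_less_one]
    proof eventually_elim
      case (elim l)
      then have "omega (l *\<^sub>R p + (1 - l) *\<^sub>R q)
          \<le> l * omega p + (1 - l) * omega q - 1 / 2 * l * (1 - l) * (nrm (p - q))\<^sup>2"
        using omega_sc pq unfolding strongly_convex_wrt_def by simp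
      moreover have "l *\<^sub>R p + (1 - l) *\<^sub>R q = q + l *\<^sub>R (p - q)" by (simp add: algebra_simps)
      ultimately show ?case using elim by (simp add: field_simps)
    qed
  qed simp
  then show ?thesis by (simp add: bregman_def)
qed

lemma bregman_nonneg:
  "p \<in> prob_simplex \<Longrightarrow> q \<in> prob_simplex \<Longrightarrow> 0 \<le> D p q"
  using bregman_lower[of p q] zero_le_power2[of "nrm (p - q)"] by linarith

text \<open>The gradient need not be continuous up to the boundary of the simplex, so the limit
  \<open>D x (y + l (x - y)) \<rightarrow> D x y\<close> is replaced by a lower bound obtained from convexity along the
  segment.\<close>

lemma relative_convexity_limit:
  assumes xy: "x \<in> prob_simplex" "y \<in> prob_simplex" and mu: "0 \<le> mu"
    and sc: "\<And>p p'. p \<in> prob_simplex \<Longrightarrow> p' \<in> prob_simplex \<Longrightarrow> f p - f p' - g p' \<bullet> (p - p') \<ge> mu * D p p'"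
    and le: "\<And>l. 0 < l \<Longrightarrow> l < 1 \<Longrightarrow> a l \<le> (f (y + l *\<^sub>R (x - y)) - f y) / l"
    and lim: "(a \<longlongrightarrow> b) (at_right 0)"
  shows "b \<le> f x - f y - mu * D x y"
proof -
  define z where "z l = y + l *\<^sub>R (x - y)" for l
  \<comment> \<open>By convexity the slope of \<open>omega\<close> from \<open>z l\<close> to
    \<open>z (2 * l)\<close> is an upper bound for \<open>gomega (z l) \<bullet> (x - y)\<close>, so
    \<open>B l\<close> bounds \<open>D x (z l)\<close> from below without mentioning a
    gradient.\<close>
  define B where "B l = omega x - omega (z l) - (1 - l) * ((omega (z (2 * l)) - omega (z l)) / l)" for l
  have q: "((\<lambda>l. (omega (z l) - omega y) / l) \<longlongrightarrow> gomega y \<bullet> (x - y)) (at_right 0)"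
    unfolding z_def by (rule directional_derivative[OF xy(2,1)])
  have dbl: "filterlim (\<lambda>l::real. 2 * l) (at_right 0) (at_right 0)"
    unfolding filterlim_at
  proof
    show "((\<lambda>l::real. 2 * l) \<longlongrightarrow> 0) (at_right 0)"
      by (rule tendsto_eq_intros | simp)+
    show "eventually (\<lambda>l::real. 2 * l \<in> {0<..} \<and> 2 * l \<noteq> 0) (at_right 0)"
      using eventually_at_right_0_small[OF zero_less_one] by eventually_elim auto
  qed
  have q2: "((\<lambda>l. (omega (z (2 * l)) - omega y) / (2 * l)) \<longlongrightarrow> gomega y \<bullet> (x - y)) (at_right 0)"
    by (rule filterlim_compose[OF q dbl])
  have "((\<lambda>l. omega y + l * ((omega (z l) - omega y) / l)) \<longlongrightarrow> omega y + 0 * (gomega y \<bullet> (x - y))) (at_right 0)"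
    by (intro tendsto_intros q)
  moreover have "eventually (\<lambda>l. omega y + l * ((omega (z l) - omega y) / l) = omega (z l)) (at_right 0)"
    using eventually_at_right_0_small[OF zero_less_one] by eventually_elim simp
  ultimately have oz: "((\<lambda>l. omega (z l)) \<longlongrightarrow> omega y) (at_right 0)"
    using Lim_transform_eventually by force
  \<comment> \<open>The slope from \<open>z l\<close> to \<open>z (2 * l)\<close> is twice the slope
    over \<open>2 * l\<close> minus the slope over \<open>l\<close>, so it has the same limit as
    these.\<close>
  have "((\<lambda>l. 2 * ((omega (z (2 * l)) - omega y) / (2 * l)) - (omega (z l) - omega y) / l)
      \<longlongrightarrow> 2 * (gomega y \<bullet> (x - y)) - gomega y \<bullet> (x - y)) (at_right 0)"
    by (intro tendsto_intros q q2)
  moreover have "eventually (\<lambda>l. 2 * ((omega (z (2 * l)) - omega y) / (2 * l)) - (omega (z l) - omega y) / l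
      = (omega (z (2 * l)) - omega (z l)) / l) (at_right 0)"
    using eventually_at_right_0_small[OF zero_less_one] by eventually_elim (simp add: field_simps)
  ultimately have dd: "((\<lambda>l. (omega (z (2 * l)) - omega (z l)) / l) \<longlongrightarrow> gomega y \<bullet> (x - y)) (at_right 0)"
    using Lim_transform_eventually by force
  have "(B \<longlongrightarrow> omega x - omega y - (1 - 0) * (gomega y \<bullet> (x - y))) (at_right 0)"
    unfolding B_def by (intro tendsto_intros oz dd)
  then have B: "(B \<longlongrightarrow> D x y) (at_right 0)" by (simp add: bregman_def)
  have "((\<lambda>l. f x - f y - mu * B l) \<longlongrightarrow> f x - f y - mu * D x y) (at_right 0)"
    by (intro tendsto_intros B)
  moreover have "eventually (\<lambda>l. a l \<le> f x - f y - mu * B l) (at_right 0)"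
  proof (rule eventually_mono)
    show "eventually (\<lambda>l::real. 0 < l \<and> l < 1 / 2) (at_right 0)" by (rule eventually_at_right_0_small) simp
    fix l :: real assume l: "0 < l \<and> l < 1 / 2"
    have zs: "z l \<in> prob_simplex" "z (2 * l) \<in> prob_simplex"
      unfolding z_def using l xy by (auto intro!: segment_in_prob_simplex)
    have e1: "x - z l = (1 - l) *\<^sub>R (x - y)" "y - z l = (- l) *\<^sub>R (x - y)" "z (2 * l) - z l = (2 * l - l) *\<^sub>R (x - y)"
      unfolding scaleR_diff_left by (simp_all add: z_def algebra_simps)
    have "l * (gomega (z l) \<bullet> (x - y)) \<le> omega (z (2 * l)) - omega (z l)"
      using bregman_nonneg[OF zs(2,1)] by (simp add: bregman_def e1)
    then have "gomega (z l) \<bullet> (x - y) \<le> (omega (z (2 * l)) - omega (z l)) / l"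
      using l by (simp add: field_simps)
    then have "(1 - l) * (gomega (z l) \<bullet> (x - y)) \<le> (1 - l) * ((omega (z (2 * l)) - omega (z l)) / l)"
      using l by (intro mult_left_mono) auto
    then have BD: "B l \<le> D x (z l)" by (simp add: B_def bregman_def e1)
    \<comment> \<open>The convexity inequalities at \<open>z l\<close> towards \<open>x\<close> and
      towards \<open>y\<close> are added with weights \<open>l\<close> and \<open>1 - l\<close>. The
      terms with \<open>g (z l)\<close> cancel because \<open>z l\<close> is exactly this convex
      combination.\<close>
    have "l * (mu * B l) \<le> l * (mu * D x (z l))"
      using l mu BD by (intro mult_left_mono) auto
    also have "\<dots> \<le> l * (f x - f (z l) - g (z l) \<bullet> (x - z l))"
      using sc[OF xy(1) zs(1)] l by (intro mult_left_mono) auto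
    also have "\<dots> = l * (f x - f (z l)) - l * (1 - l) * (g (z l) \<bullet> (x - y))"
      by (simp add: e1 algebra_simps)
    finally have 1: "l * (mu * B l) \<le> l * (f x - f (z l)) - l * (1 - l) * (g (z l) \<bullet> (x - y))" .
    have "0 \<le> (1 - l) * (mu * D y (z l))"
      using l mu bregman_nonneg[OF xy(2) zs(1)] by simp
    also have "\<dots> \<le> (1 - l) * (f y - f (z l) - g (z l) \<bullet> (y - z l))"
      using sc[OF xy(2) zs(1)] l by (intro mult_left_mono) auto
    also have "\<dots> = (1 - l) * (f y - f (z l)) + l * (1 - l) * (g (z l) \<bullet> (x - y))"
      by (simp add: e1 algebra_simps)
    finally have "l * (mu * B l) \<le> l * (f x - f (z l)) + (1 - l) * (f y - f (z l))" using 1 by linarith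
    then have "f (z l) - f y \<le> l * (f x - f y - mu * B l)" by (simp add: algebra_simps)
    then have "(f (z l) - f y) / l \<le> f x - f y - mu * B l" using l by (simp add: field_simps)
    moreover have "a l \<le> (f (z l) - f y) / l" unfolding z_def using l by (intro le) auto
    ultimately show "a l \<le> f x - f y - mu * B l" by linarith
  qed
  ultimately show ?thesis by (intro tendsto_le[OF _ _ lim]) auto
qed

text \<open>First-order optimality of \<open>y\<close> without differentiating \<open>f\<close>:
  comparing \<open>y\<close> with nearby points on the segment to \<open>p\<close> bounds the
  difference quotients of \<open>f\<close> from below, and \<open>relative_convexity_limit\<close>
  turns this into an inequality at \<open>p\<close>.\<close>

lemma three_point:
  assumes p: "p \<in> prob_simplex" and pi: "pold \<in> prob_simplex" and y: "y \<in> prob_simplex"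
    and mu: "0 \<le> mu" and eta: "0 < eta"
    and sc: "\<And>p p'. p \<in> prob_simplex \<Longrightarrow> p' \<in> prob_simplex \<Longrightarrow> f p - f p' - g p' \<bullet> (p - p') \<ge> mu * D p p'"
    and opt: "\<And>p. p \<in> prob_simplex \<Longrightarrow> eta * (Q \<bullet> y + f y) + D y pold \<le> eta * (Q \<bullet> p + f p) + D p pold"
  shows "Q \<bullet> (y - p) + f y - f p + (mu + 1 / eta) * D p y + 1 / eta * D y pold \<le> 1 / eta * D p pold"
proof -
  define z where "z l = y + l *\<^sub>R (p - y)" for l
  define a where "a l = - (Q \<bullet> (p - y)) - 1 / eta * ((omega (z l) - omega y) / l - gomega pold \<bullet> (p - y))" for l
  have "- (Q \<bullet> (p - y)) - 1 / eta * (gomega y \<bullet> (p - y) - gomega pold \<bullet> (p - y)) \<le> f p - f y - mu * D p y"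
  proof (rule relative_convexity_limit[OF p y mu sc])
    show "(a \<longlongrightarrow> - (Q \<bullet> (p - y)) - 1 / eta * (gomega y \<bullet> (p - y) - gomega pold \<bullet> (p - y))) (at_right 0)"
      unfolding a_def z_def by (intro tendsto_intros directional_derivative y p)
    fix l :: real assume l: "0 < l" "l < 1"
    have "z l \<in> prob_simplex" unfolding z_def using l y p by (intro segment_in_prob_simplex) auto
    then have "eta * (Q \<bullet> y + f y) + D y pold \<le> eta * (Q \<bullet> z l + f (z l)) + D (z l) pold" by (rule opt)
    note le = this
    define u v where "u = (omega (z l) - omega y) / l" and "v = (f (z l) - f y) / l"
    have uv: "omega (z l) = omega y + l * u" "f (z l) = f y + l * v"
      unfolding u_def v_def using l by auto
    have "r \<bullet> z l = r \<bullet> y + l * (r \<bullet> (p - y))" for r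
      unfolding z_def by (simp add: inner_add_right)
    with le have "l * (eta * - (Q \<bullet> (p - y)) - (u - gomega pold \<bullet> (p - y))) \<le> l * (eta * v)"
      by (simp add: bregman_def inner_diff_right uv algebra_simps)
    then have "eta * - (Q \<bullet> (p - y)) - ((omega (z l) - omega y) / l - gomega pold \<bullet> (p - y)) \<le> eta * ((f (z l) - f y) / l)"
      using l unfolding u_def[symmetric] v_def[symmetric] by (simp only: mult_le_cancel_left_pos)
    then have "(eta * - (Q \<bullet> (p - y)) - ((omega (z l) - omega y) / l - gomega pold \<bullet> (p - y))) / eta \<le> (f (z l) - f y) / l"
      using eta by (simp add: field_simps)
    then show "a l \<le> (f (y + l *\<^sub>R (p - y)) - f y) / l"
      unfolding z_def[symmetric] a_def using eta by (simp add: diff_divide_distrib)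
  qed
  moreover have "gomega y \<bullet> (p - y) - gomega pold \<bullet> (p - y) = D p pold - D p y - D y pold"
    by (simp add: bregman_def inner_diff_right)
  ultimately have "- (Q \<bullet> (p - y)) - 1 / eta * (D p pold - D p y - D y pold) \<le> f p - f y - mu * D p y"
    by simp
  then show ?thesis by (simp add: inner_diff_right algebra_simps diff_divide_distrib)
qed

text \<open>The Lipschitz condition bounds the slopes of \<open>f\<close> leaving \<open>y\<close>
  towards \<open>x\<close> from below by \<open>- (Mh * nrm (x - y))\<close>; relative convexity
  then gains \<open>mu * D x y\<close> over the plain Lipschitz bound. \<open>mirror_step\<close>
  uses it with \<open>x\<close> the new and \<open>y\<close> the old policy.\<close>

lemma lipschitz_relative:
  assumes xy: "x \<in> prob_simplex" "y \<in> prob_simplex" and mu: "0 \<le> mu"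
    and sc: "\<And>p p'. p \<in> prob_simplex \<Longrightarrow> p' \<in> prob_simplex \<Longrightarrow> f p - f p' - g p' \<bullet> (p - p') \<ge> mu * D p p'"
    and lip: "\<And>p p'. p \<in> prob_simplex \<Longrightarrow> p' \<in> prob_simplex \<Longrightarrow> f p - f p' \<le> Mh * nrm (p - p')"
  shows "f y - f x \<le> Mh * nrm (x - y) - mu * D x y"
proof -
  have "- (Mh * nrm (x - y)) \<le> f x - f y - mu * D x y"
  proof (rule relative_convexity_limit[OF xy mu sc, where a = "\<lambda>l. - (Mh * nrm (x - y))"])
    fix l :: real assume l: "0 < l" "l < 1"
    have "y + l *\<^sub>R (x - y) \<in> prob_simplex" using l xy by (intro segment_in_prob_simplex) auto
    then have "f y - f (y + l *\<^sub>R (x - y)) \<le> Mh * nrm (y - (y + l *\<^sub>R (x - y)))" by (intro lip xy)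
    also have "y - (y + l *\<^sub>R (x - y)) = (- l) *\<^sub>R (x - y)" by simp
    also have "Mh * nrm ((- l) *\<^sub>R (x - y)) = l * (Mh * nrm (x - y))"
      using l by (subst is_normD(3)[OF nrm]) auto
    finally show "- (Mh * nrm (x - y)) \<le> (f (y + l *\<^sub>R (x - y)) - f y) / l"
      using l by (simp add: field_simps)
  qed auto
  then show ?thesis by simp
qed

text \<open>Spending the strong convexity of \<open>f\<close> also on the displacement from \<open>pold\<close> to \<open>y\<close> yields the
  factor \<open>mu + 1 / eta\<close>, rather than \<open>1 / eta\<close>, in the denominator of the error.\<close>

lemma mirror_step:
  assumes p: "p \<in> prob_simplex" and pi: "pold \<in> prob_simplex" and y: "y \<in> prob_simplex"
    and mu: "0 < mu" and eta: "0 < eta"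
    and sc: "\<And>p p'. p \<in> prob_simplex \<Longrightarrow> p' \<in> prob_simplex \<Longrightarrow> f p - f p' - g p' \<bullet> (p - p') \<ge> mu * D p p'"
    and lip: "\<And>p p'. p \<in> prob_simplex \<Longrightarrow> p' \<in> prob_simplex \<Longrightarrow> f p - f p' \<le> Mh * nrm (p - p')"
    and opt: "\<And>p. p \<in> prob_simplex \<Longrightarrow> eta * (Q \<bullet> y + f y) + D y pold \<le> eta * (Q \<bullet> p + f p) + D p pold"
    and Qx: "dual_norm nrm Q \<le> x"
  shows "Q \<bullet> (pold - p) + f pold - f p + (mu + 1 / eta) * D p y
     \<le> 1 / eta * D p pold + (x\<^sup>2 + Mh\<^sup>2) / (mu + 1 / eta)"
proof -
  define m where "m = mu + 1 / eta"
  define d where "d = nrm (y - pold)"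
  have m: "m > 0" using mu eta by (simp add: m_def add_pos_pos)
  have d: "0 \<le> d" unfolding d_def by (rule is_normD(1)[OF nrm])
  have "Q \<bullet> (pold - y) \<le> dual_norm nrm Q * nrm (pold - y)" by (rule dual_norm_holder[OF nrm])
  also have "\<dots> \<le> x * d" unfolding d_def using Qx d is_normD(6)[OF nrm, of pold y]
    by (simp add: mult_right_mono is_normD(1)[OF nrm])
  finally have 1: "Q \<bullet> (pold - y) \<le> x * d" .
  have 2: "f pold - f y \<le> Mh * d - mu * D y pold"
    unfolding d_def using mu by (intro lipschitz_relative[OF y pi _ sc lip]) auto
  have "m * (d\<^sup>2 / 2) \<le> m * D y pold"
    unfolding d_def using m bregman_lower[OF y pi] by (intro mult_left_mono) auto
  moreover have "(x + Mh) * d \<le> m * (d\<^sup>2 / 2) + (x\<^sup>2 + Mh\<^sup>2) / m"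
  proof -
    \<comment> \<open>Young's inequality and \<open>(x + Mh)^2 \<le> 2 * (x^2 + Mh^2)\<close> at
      once: the sum of the two squares below expands to twice the difference of the sides.\<close>
    have "m * ((x + Mh) * d) \<le> (m * d)\<^sup>2 / 2 + (x\<^sup>2 + Mh\<^sup>2)"
      using sum_squares_ge_zero[of "m * d - (x + Mh)" "x - Mh"]
      by (simp add: field_simps power2_eq_square)
    also have "\<dots> = m * (m * (d\<^sup>2 / 2) + (x\<^sup>2 + Mh\<^sup>2) / m)"
      using m by (simp add: field_simps power2_eq_square)
    finally show ?thesis using m by simp
  qed
  moreover have "(mu + 1 / eta) * D y pold = mu * D y pold + 1 / eta * D y pold" by (simp add: algebra_simps)
  ultimately show ?thesis
    using three_point[OF p pi y less_imp_le[OF mu] eta sc opt] 1 2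
    unfolding m_def[symmetric] by (simp add: inner_diff_right algebra_simps)
qed

section \<open>The mirror step as a continuous function of its linear term\<close>

definition mirror_objective :: "(real^'a \<Rightarrow> real) \<Rightarrow> real^'a \<Rightarrow> real^'a \<Rightarrow> real" where
  "mirror_objective f z p = f p + omega p + z \<bullet> p"

text \<open>Strong convexity makes the minimiser unique, so for convex continuous \<open>f\<close>
  the choice made here must agree with any iterate satisfying the optimality property; measurability
  of the iterate is then inherited from that of \<open>z\<close>.\<close>

definition mirror_argmin :: "(real^'a \<Rightarrow> real) \<Rightarrow> real^'a \<Rightarrow> real^'a" where
  "mirror_argmin f z = (SOME y. y \<in> prob_simplex \<and> (\<forall>p\<in>prob_simplex. mirror_objective f z y \<le> mirror_objective f z p))"

text \<open>Compare with the midpoint: strong convexity saves one eighth of the squared distance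
  there, and minimality of \<open>y\<close> doubles the saving.\<close>

lemma mirror_objective_growth:
  assumes f: "convex_on prob_simplex f" and y: "y \<in> prob_simplex"
    and min: "\<forall>p\<in>prob_simplex. mirror_objective f z y \<le> mirror_objective f z p" and p: "p \<in> prob_simplex"
  shows "mirror_objective f z y + (nrm (y - p))\<^sup>2 / 4 \<le> mirror_objective f z p"
proof -
  let ?m = "(1/2) *\<^sub>R y + (1 - 1/2) *\<^sub>R p"
  have "?m \<in> prob_simplex" using convexD[OF convex_prob_simplex y p, of "1/2" "1/2"] by simp
  then have "mirror_objective f z y \<le> mirror_objective f z ?m" using min by blast
  moreover have "omega ?m \<le> 1/2 * omega y + (1 - 1/2) * omega p - 1/2 * (1/2) * (1 - 1/2) * (nrm (y - p))\<^sup>2"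
    using omega_sc[unfolded strongly_convex_wrt_def, rule_format, OF y p, of "1/2"] by simp
  moreover have "f ?m \<le> 1/2 * f y + 1/2 * f p"
    using f convex_onD[OF f, of "1/2" p y] y p by (simp add: algebra_simps)
  moreover have "z \<bullet> ?m = 1/2 * (z \<bullet> y) + 1/2 * (z \<bullet> p)" by (simp add: inner_add_right)
  ultimately show ?thesis unfolding mirror_objective_def by simp
qed

lemma mirror_argmin_min:
  assumes f: "convex_on prob_simplex f" "continuous_on prob_simplex f"
  shows "mirror_argmin f z \<in> prob_simplex"
    "\<forall>p\<in>prob_simplex. mirror_objective f z (mirror_argmin f z) \<le> mirror_objective f z p"
proof -
  have "continuous_on prob_simplex (mirror_objective f z)"
    unfolding mirror_objective_def by (intro continuous_intros f omega_continuous)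
  then have "\<exists>y\<in>prob_simplex. \<forall>p\<in>prob_simplex. mirror_objective f z y \<le> mirror_objective f z p"
    using axis_in_prob_simplex by (intro continuous_attains_inf compact_prob_simplex) auto
  then have "\<exists>y. y \<in> prob_simplex \<and> (\<forall>p\<in>prob_simplex. mirror_objective f z y \<le> mirror_objective f z p)" by blast
  from someI_ex[OF this] show "mirror_argmin f z \<in> prob_simplex"
    "\<forall>p\<in>prob_simplex. mirror_objective f z (mirror_argmin f z) \<le> mirror_objective f z p"
    unfolding mirror_argmin_def by auto
qed

lemma mirror_argmin_unique:
  assumes f: "convex_on prob_simplex f" "continuous_on prob_simplex f"
    and y: "y \<in> prob_simplex" "\<forall>p\<in>prob_simplex. mirror_objective f z y \<le> mirror_objective f z p"
  shows "y = mirror_argmin f z"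
proof -
  have "mirror_objective f z (mirror_argmin f z) \<le> mirror_objective f z y"
    using mirror_argmin_min[OF f] y by blast
  moreover have "mirror_objective f z y + (nrm (y - mirror_argmin f z))\<^sup>2 / 4 \<le> mirror_objective f z (mirror_argmin f z)"
    by (intro mirror_objective_growth f y mirror_argmin_min)
  ultimately have "(nrm (y - mirror_argmin f z))\<^sup>2 \<le> 0" by linarith
  then show ?thesis using is_normD(2)[OF nrm, of "y - mirror_argmin f z"] by simp
qed

text \<open>Adding the growth inequalities of the two minimisers cancels \<open>f\<close> and
  \<open>omega\<close> and leaves only linear terms. Hence the minimiser is Lipschitz in
  \<open>z\<close>, with Euclidean constant \<open>2 / c^2\<close>.\<close>

lemma mirror_argmin_continuous:
  assumes f: "convex_on prob_simplex f" "continuous_on prob_simplex f"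
  shows "continuous_on UNIV (mirror_argmin f)"
proof -
  obtain c where c: "c > 0" "\<And>x. c * norm x \<le> nrm x" by (rule is_norm_lower[OF nrm]) blast
  have "norm (mirror_argmin f z - mirror_argmin f z') \<le> 2 / c\<^sup>2 * norm (z - z')" for z z'
  proof -
    let ?y = "mirror_argmin f z" and ?y' = "mirror_argmin f z'"
    have "mirror_objective f z ?y + (nrm (?y - ?y'))\<^sup>2 / 4 \<le> mirror_objective f z ?y'"
      by (intro mirror_objective_growth f mirror_argmin_min)
    moreover have "mirror_objective f z' ?y' + (nrm (?y' - ?y))\<^sup>2 / 4 \<le> mirror_objective f z' ?y"
      by (intro mirror_objective_growth f mirror_argmin_min)
    ultimately have "(nrm (?y - ?y'))\<^sup>2 / 2 \<le> (z - z') \<bullet> (?y' - ?y)"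
      using is_normD(6)[OF nrm, of ?y ?y'] by (simp add: mirror_objective_def algebra_simps)
    also have "\<dots> \<le> norm (z - z') * norm (?y - ?y')"
      using norm_cauchy_schwarz[of "z - z'" "?y' - ?y"] by (simp add: norm_minus_commute)
    finally have "(nrm (?y - ?y'))\<^sup>2 / 2 \<le> norm (z - z') * norm (?y - ?y')" .
    moreover have "(c * norm (?y - ?y'))\<^sup>2 \<le> (nrm (?y - ?y'))\<^sup>2"
      using c by (intro power_mono) auto
    ultimately have "c\<^sup>2 * norm (?y - ?y') * norm (?y - ?y') \<le> 2 * norm (z - z') * norm (?y - ?y')"
      by (simp add: power2_eq_square mult_ac)
    then have "c\<^sup>2 * norm (?y - ?y') \<le> 2 * norm (z - z')"
      by (cases "?y = ?y'") (auto simp: mult_le_cancel_right)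
    then show ?thesis using c by (simp add: field_simps)
  qed
  then have "(2 / c\<^sup>2)-lipschitz_on UNIV (mirror_argmin f)"
    by (intro lipschitz_onI) (auto simp: dist_norm)
  then show ?thesis by (rule lipschitz_on_continuous_on)
qed

text \<open>The Bregman term differs from \<open>omega\<close> by an affine function of
  \<open>p\<close>. Its slope is coded by the values towards the vertices instead of
  \<open>gomega pold\<close>: both agree on the simplex up to a constant, and only the former is
  known to be measurable.\<close>

lemma mirror_step_argmin:
  assumes f: "convex_on prob_simplex f" "continuous_on prob_simplex f" and eta: "0 < eta"
    and y: "y \<in> prob_simplex"
    and opt: "\<And>p. p \<in> prob_simplex \<Longrightarrow> eta * (Q \<bullet> y + f y) + D y pold \<le> eta * (Q \<bullet> p + f p) + D p pold"
  shows "y = mirror_argmin (\<lambda>p. eta * f p) (eta *\<^sub>R Q - (\<chi> a. gomega pold \<bullet> (axis a 1 - pold)))"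
proof (rule mirror_argmin_unique)
  show "convex_on prob_simplex (\<lambda>p. eta * f p)" using convex_on_cmul[OF _ f(1), of eta] eta by simp
  show "continuous_on prob_simplex (\<lambda>p. eta * f p)" by (intro continuous_intros f)
  have "gomega pold \<bullet> (q - pold) = (\<chi> a. gomega pold \<bullet> (axis a 1 - pold)) \<bullet> q" if "q \<in> prob_simplex" for q
    unfolding simplex_comb[OF that] by (subst (3) inner_vec_def) (simp add: mult.commute)
  then show "\<forall>p\<in>prob_simplex. mirror_objective (\<lambda>p. eta * f p) (eta *\<^sub>R Q - (\<chi> a. gomega pold \<bullet> (axis a 1 - pold))) y
     \<le> mirror_objective (\<lambda>p. eta * f p) (eta *\<^sub>R Q - (\<chi> a. gomega pold \<bullet> (axis a 1 - pold))) p"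
    using opt y by (simp add: mirror_objective_def bregman_def inner_diff_left algebra_simps)
qed (rule y)

lemma measurable_on_simplex:
  fixes u :: "real^'a \<Rightarrow> real"
  assumes "continuous_on prob_simplex u" "p \<in> borel_measurable N" "\<And>w. p w \<in> prob_simplex"
  shows "(\<lambda>w. u (p w)) \<in> borel_measurable N"
proof -
  have "u \<in> borel_measurable (restrict_space borel prob_simplex)"
    by (rule borel_measurable_continuous_on_restrict[OF assms(1)])
  moreover have "p \<in> measurable N (restrict_space borel prob_simplex)"
    using assms by (intro measurable_restrict_space2) auto
  ultimately show ?thesis by (rule measurable_compose[rotated])
qed

text \<open>\<open>gomega\<close> is not assumed measurable, but its pairing with
  \<open>q - p w\<close> is a pointwise limit of difference quotients of the continuous function
  \<open>omega\<close>.\<close>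

lemma gradient_measurable:
  assumes p: "p \<in> borel_measurable N" "\<And>w. p w \<in> prob_simplex" and q: "q \<in> prob_simplex"
  shows "(\<lambda>w. gomega (p w) \<bullet> (q - p w)) \<in> borel_measurable N"
proof (rule borel_measurable_LIMSEQ_real)
  let ?l = "\<lambda>n. 1 / real (Suc n)"
  have "filterlim ?l (at_right 0) sequentially"
    unfolding filterlim_at using LIMSEQ_Suc[OF lim_1_over_n] by auto
  then show "(\<lambda>n. (omega (p w + ?l n *\<^sub>R (q - p w)) - omega (p w)) / ?l n) \<longlonglongrightarrow> gomega (p w) \<bullet> (q - p w)" for w
    using filterlim_compose[OF directional_derivative[OF p(2)[of w] q]] by blast
  note [measurable] = p(1)
  show "(\<lambda>w. (omega (p w + ?l n *\<^sub>R (q - p w)) - omega (p w)) / ?l n) \<in> borel_measurable N" for n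
    by (intro borel_measurable_divide borel_measurable_diff measurable_on_simplex[OF omega_continuous]
        p segment_in_prob_simplex q) auto
qed

lemma bregman_measurable:
  assumes p: "p \<in> borel_measurable N" "\<And>w. p w \<in> prob_simplex" and q: "q \<in> prob_simplex"
  shows "(\<lambda>w. D q (p w)) \<in> borel_measurable N"
  unfolding bregman_def
  by (intro borel_measurable_diff measurable_on_simplex[OF omega_continuous] gradient_measurable p q) auto

lemma mirror_step_measurable:
  assumes f: "convex_on prob_simplex f" "continuous_on prob_simplex f" and eta: "0 < eta"
    and p: "p \<in> borel_measurable N" "\<And>w. p w \<in> prob_simplex" and Q: "Q \<in> borel_measurable N"
    and y: "\<And>w. y w \<in> prob_simplex"
    and opt: "\<And>w q. q \<in> prob_simplex \<Longrightarrow>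
      eta * (Q w \<bullet> y w + f (y w)) + D (y w) (p w) \<le> eta * (Q w \<bullet> q + f q) + D q (p w)"
  shows "y \<in> borel_measurable N"
proof -
  have [measurable]: "mirror_argmin (\<lambda>p. eta * f p) \<in> borel_measurable borel"
    using convex_on_cmul[OF _ f(1), of eta] eta
    by (intro borel_measurable_continuous_onI mirror_argmin_continuous continuous_intros f) auto
  have [measurable]: "(\<lambda>w. \<chi> a. gomega (p w) \<bullet> (axis a 1 - p w)) \<in> borel_measurable N"
    by (subst borel_measurable_euclidean_space)
      (auto simp: Basis_vec_def inner_axis intro!: gradient_measurable p axis_in_prob_simplex)
  note [measurable] = Q
  have "y = (\<lambda>w. mirror_argmin (\<lambda>p. eta * f p) (eta *\<^sub>R Q w - (\<chi> a. gomega (p w) \<bullet> (axis a 1 - p w))))"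
    by (intro ext mirror_step_argmin f eta y opt)
  also have "\<dots> \<in> borel_measurable N" by measurable
  finally show ?thesis .
qed

end

subsection \<open>Value functions\<close>

lemma sums_telescope_0:
  fixes f :: "nat \<Rightarrow> real"
  assumes "f \<longlonglongrightarrow> 0"
  shows "(\<lambda>n. f n - f (Suc n)) sums f 0"
  using telescope_sums'[OF assms] by simp

locale mdp =
  fixes P :: "'s::finite \<Rightarrow> 'a::finite \<Rightarrow> 's \<Rightarrow> real" and c :: "'s \<Rightarrow> 'a \<Rightarrow> real" and gamma :: real
    and h :: "'s \<Rightarrow> real^'a \<Rightarrow> real"
  assumes P_nonneg: "\<forall>s a s'. 0 \<le> P s a s'"
    and P_sum: "\<forall>s a. (\<Sum>s'\<in>UNIV. P s a s') = 1"
    and gamma: "0 \<le> gamma" "gamma < 1"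
begin

abbreviation V where "V \<equiv> value_fn P c h gamma"
abbreviation Qf where "Qf \<equiv> q_fn P c h gamma"
abbreviation \<kappa> where "\<kappa> \<equiv> visitation P gamma"

definition stage_cost :: "('s \<Rightarrow> real^'a) \<Rightarrow> 's \<Rightarrow> real" where
  "stage_cost pol q = (\<Sum>a\<in>UNIV. pol q $ a * c q a) + h q (pol q)"

definition kernel :: "('s \<Rightarrow> real^'a) \<Rightarrow> 's \<Rightarrow> 's \<Rightarrow> real" where
  "kernel pol r q = (\<Sum>a\<in>UNIV. pol r $ a * P r a q)"

lemma state_dist_Suc:
  "state_dist P pol (Suc t) s q = (\<Sum>r\<in>UNIV. state_dist P pol t s r * kernel pol r q)"
  by (simp add: kernel_def)

text \<open>The definition unfolds the last transition, whereas the Bellman equation conditions on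
  the first.\<close>

lemma state_dist_Suc_left:
  "state_dist P pol (Suc t) s q = (\<Sum>r\<in>UNIV. kernel pol s r * state_dist P pol t r q)"
proof (induction t arbitrary: q)
  case 0
  then show ?case by (simp add: kernel_def if_distrib if_distribR cong: if_cong)
next
  case (Suc t)
  have "state_dist P pol (Suc (Suc t)) s q
      = (\<Sum>r\<in>UNIV. (\<Sum>u\<in>UNIV. kernel pol s u * state_dist P pol t u r) * kernel pol r q)"
    by (subst state_dist_Suc) (simp only: Suc)
  also have "\<dots> = (\<Sum>u\<in>UNIV. \<Sum>r\<in>UNIV. kernel pol s u * (state_dist P pol t u r * kernel pol r q))"
    by (subst sum.swap) (simp add: sum_distrib_right mult.assoc)
  also have "\<dots> = (\<Sum>u\<in>UNIV. kernel pol s u * state_dist P pol (Suc t) u q)"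
    by (simp only: state_dist_Suc sum_distrib_left)
  finally show ?case .
qed

lemma state_dist_nonneg:
  assumes "is_policy pol"
  shows "0 \<le> state_dist P pol t s q"
  using assms P_nonneg
  by (induction t arbitrary: q)
    (auto simp: is_policy_def prob_simplex_nonneg intro!: sum_nonneg mult_nonneg_nonneg)

lemma kernel_sum:
  assumes "is_policy pol"
  shows "(\<Sum>q\<in>UNIV. kernel pol r q) = 1"
  unfolding kernel_def using assms P_sum
  by (subst sum.swap) (simp add: is_policy_def prob_simplex_sum flip: sum_distrib_left)

lemma state_dist_sum:
  assumes "is_policy pol"
  shows "(\<Sum>q\<in>UNIV. state_dist P pol t s q) = 1"
proof (induction t)
  case (Suc t)
  have "(\<Sum>q\<in>UNIV. state_dist P pol (Suc t) s q) = (\<Sum>r\<in>UNIV. state_dist P pol t s r * (\<Sum>q\<in>UNIV. kernel pol r q))"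
    unfolding state_dist_Suc sum_distrib_left by (rule sum.swap)
  then show ?case using Suc assms by (simp add: kernel_sum)
qed (simp add: if_distrib cong: if_cong)

lemma state_dist_average_bound:
  assumes "is_policy pol" "\<And>q. \<bar>f q\<bar> \<le> B"
  shows "\<bar>\<Sum>q\<in>UNIV. state_dist P pol t s q * f q\<bar> \<le> B"
proof -
  have "\<bar>\<Sum>q\<in>UNIV. state_dist P pol t s q * f q\<bar> \<le> (\<Sum>q\<in>UNIV. state_dist P pol t s q * B)"
    by (rule order_trans[OF sum_abs])
      (auto simp: abs_mult state_dist_nonneg assms intro!: sum_mono mult_left_mono)
  then show ?thesis using state_dist_sum[OF assms(1)] by (simp flip: sum_distrib_right)
qed

lemma summable_average:
  assumes "is_policy pol"
  shows "summable (\<lambda>t. gamma ^ t * (\<Sum>q\<in>UNIV. state_dist P pol t s q * f q))"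
proof (rule summable_comparison_test')
  define B where "B = (\<Sum>q\<in>UNIV. \<bar>f q\<bar>)"
  have B: "\<bar>f q\<bar> \<le> B" for q unfolding B_def by (rule member_le_sum) auto
  show "summable (\<lambda>t. gamma ^ t * B)" using gamma by (intro summable_mult2 summable_geometric) auto
  show "norm (gamma ^ t * (\<Sum>q\<in>UNIV. state_dist P pol t s q * f q)) \<le> gamma ^ t * B" for t
    using gamma state_dist_average_bound[OF assms B, of t s]
    by (simp add: abs_mult mult_left_mono)
qed

lemma summable_state_dist:
  assumes "is_policy pol"
  shows "summable (\<lambda>t. gamma ^ t * state_dist P pol t s q)"
  using summable_average[OF assms, of s "\<lambda>r. if r = q then 1 else 0"]
  by (simp add: if_distrib cong: if_cong)

lemma value_fn_sums:
  assumes "is_policy pol"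
  shows "(\<lambda>t. gamma ^ t * (\<Sum>q\<in>UNIV. state_dist P pol t s q * stage_cost pol q)) sums V pol s"
  unfolding value_fn_def using summable_sums[OF summable_average[OF assms, of s "stage_cost pol"]]
  by (simp add: stage_cost_def)

lemma visitation_average:
  assumes "is_policy pol"
  shows "(\<Sum>q\<in>UNIV. \<kappa> pol s q * f q) = (1 - gamma) * (\<Sum>t. gamma ^ t * (\<Sum>q\<in>UNIV. state_dist P pol t s q * f q))"
proof -
  have "(\<Sum>t. gamma ^ t * (\<Sum>q\<in>UNIV. state_dist P pol t s q * f q))
      = (\<Sum>t. \<Sum>q\<in>UNIV. gamma ^ t * state_dist P pol t s q * f q)"
    by (simp add: sum_distrib_left mult.assoc)
  also have "\<dots> = (\<Sum>q\<in>UNIV. \<Sum>t. gamma ^ t * state_dist P pol t s q * f q)"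
    by (intro suminf_sum summable_mult2 summable_state_dist assms)
  also have "\<dots> = (\<Sum>q\<in>UNIV. (\<Sum>t. gamma ^ t * state_dist P pol t s q) * f q)"
    by (intro sum.cong refl suminf_mult2[symmetric] summable_state_dist assms)
  finally show ?thesis by (simp add: visitation_def sum_distrib_left mult.assoc)
qed

lemma visitation_nonneg:
  assumes "is_policy pol"
  shows "0 \<le> \<kappa> pol s q"
  unfolding visitation_def using gamma state_dist_nonneg[OF assms] summable_state_dist[OF assms]
  by (intro mult_nonneg_nonneg suminf_nonneg) auto

lemma visitation_sum:
  assumes "is_policy pol"
  shows "(\<Sum>q\<in>UNIV. \<kappa> pol s q) = 1"
  using visitation_average[OF assms, of s "\<lambda>_. 1"] state_dist_sum[OF assms] gamma suminf_geometric[of gamma]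
  by simp

lemma value_fn_bellman:
  assumes "is_policy pol"
  shows "V pol s = stage_cost pol s + gamma * (\<Sum>r\<in>UNIV. kernel pol s r * V pol r)"
proof -
  let ?g = "\<lambda>t s. gamma ^ t * (\<Sum>q\<in>UNIV. state_dist P pol t s q * stage_cost pol q)"
  have "(\<lambda>t. gamma * (\<Sum>r\<in>UNIV. kernel pol s r * ?g t r)) sums (gamma * (\<Sum>r\<in>UNIV. kernel pol s r * V pol r))"
    by (intro sums_mult sums_sum value_fn_sums assms)
  moreover have "gamma * (\<Sum>r\<in>UNIV. kernel pol s r * ?g t r) = ?g (Suc t) s" for t
  proof -
    have "(\<Sum>q\<in>UNIV. state_dist P pol (Suc t) s q * stage_cost pol q)
        = (\<Sum>r\<in>UNIV. \<Sum>q\<in>UNIV. kernel pol s r * (state_dist P pol t r q * stage_cost pol q))"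
      unfolding state_dist_Suc_left sum_distrib_right mult.assoc by (rule sum.swap)
    then show ?thesis by (simp add: sum_distrib_left mult_ac)
  qed
  ultimately have "(\<lambda>t. ?g (Suc t) s) sums (gamma * (\<Sum>r\<in>UNIV. kernel pol s r * V pol r))" by simp
  then have "(\<lambda>t. ?g t s) sums (gamma * (\<Sum>r\<in>UNIV. kernel pol s r * V pol r) + ?g 0 s)"
    by (subst (asm) sums_Suc_iff) simp
  then have "V pol s = gamma * (\<Sum>r\<in>UNIV. kernel pol s r * V pol r) + ?g 0 s"
    using value_fn_sums[OF assms] sums_unique2 by blast
  then show ?thesis by (simp add: if_distrib if_distribR cong: if_cong)
qed

lemma q_fn_inner:
  assumes "p \<in> prob_simplex"
  shows "Qf pol s \<bullet> p = (\<Sum>a\<in>UNIV. p $ a * c s a) + h s (pol s) + gamma * (\<Sum>r\<in>UNIV. (\<Sum>a\<in>UNIV. p $ a * P s a r) * V pol r)"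
proof -
  have "Qf pol s \<bullet> p = (\<Sum>a\<in>UNIV. p $ a * c s a) + (\<Sum>a\<in>UNIV. p $ a) * h s (pol s)
     + (\<Sum>a\<in>UNIV. p $ a * (gamma * (\<Sum>r\<in>UNIV. P s a r * V pol r)))"
    unfolding q_fn_def inner_vec_def by (simp add: sum.distrib algebra_simps sum_distrib_left sum_distrib_right)
  also have "(\<Sum>a\<in>UNIV. p $ a * (gamma * (\<Sum>r\<in>UNIV. P s a r * V pol r)))
     = gamma * (\<Sum>a\<in>UNIV. \<Sum>r\<in>UNIV. p $ a * P s a r * V pol r)"
    by (simp add: sum_distrib_left mult_ac)
  also have "(\<Sum>a\<in>UNIV. \<Sum>r\<in>UNIV. p $ a * P s a r * V pol r) = (\<Sum>r\<in>UNIV. (\<Sum>a\<in>UNIV. p $ a * P s a r) * V pol r)"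
    unfolding sum_distrib_right by (rule sum.swap)
  finally show ?thesis using assms by (simp add: prob_simplex_sum)
qed

text \<open>The summand is the loss of \<open>V pol\<close> over one step of \<open>pol'\<close>.
  Along the trajectory of \<open>pol'\<close> the discounted values of \<open>pol\<close> telescope
  to \<open>V pol s\<close>, while the stage costs add up to \<open>V pol' s\<close>.\<close>

lemma performance_difference:
  assumes pol: "is_policy pol" and pol': "is_policy pol'"
  shows "(1 - gamma) * (V pol s - V pol' s)
    = (\<Sum>q\<in>UNIV. \<kappa> pol' s q * (Qf pol q \<bullet> (pol q - pol' q) + h q (pol q) - h q (pol' q)))"
proof -
  let ?E = "\<lambda>t f. \<Sum>q\<in>UNIV. state_dist P pol' t s q * f q"
  let ?f = "\<lambda>t. gamma ^ t * ?E t (V pol)"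
  \<comment> \<open>The \<open>h q (pol q)\<close> inside \<open>Qf pol q \<bullet> pol' q\<close>
    cancels against the explicit one, and \<open>h q (pol' q)\<close> completes the stage cost of
    \<open>pol'\<close>.\<close>
  have adv: "Qf pol q \<bullet> (pol q - pol' q) + h q (pol q) - h q (pol' q)
      = V pol q - stage_cost pol' q - gamma * (\<Sum>r\<in>UNIV. kernel pol' q r * V pol r)" for q
    using value_fn_bellman[OF pol, of q] pol pol' q_fn_inner[of "pol q" pol q] q_fn_inner[of "pol' q" pol q]
    by (simp add: is_policy_def inner_diff_right stage_cost_def kernel_def)
  have "?f \<longlonglongrightarrow> 0" by (rule summable_LIMSEQ_zero[OF summable_average[OF pol']])
  then have "(\<lambda>t. ?f t - ?f (Suc t)) sums ?f 0" by (rule sums_telescope_0)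
  from sums_diff[OF this value_fn_sums[OF pol']]
  have "(\<lambda>t. ?f t - ?f (Suc t) - gamma ^ t * ?E t (stage_cost pol')) sums (?f 0 - V pol' s)" .
  moreover have "?f t - ?f (Suc t) - gamma ^ t * ?E t (stage_cost pol')
     = gamma ^ t * ?E t (\<lambda>q. V pol q - stage_cost pol' q - gamma * (\<Sum>r\<in>UNIV. kernel pol' q r * V pol r))" for t
  proof -
    have "?E (Suc t) (V pol) = ?E t (\<lambda>q. \<Sum>r\<in>UNIV. kernel pol' q r * V pol r)"
      unfolding state_dist_Suc sum_distrib_right sum_distrib_left mult.assoc by (rule sum.swap)
    moreover have "?E t (\<lambda>q. V pol q - stage_cost pol' q - gamma * (\<Sum>r\<in>UNIV. kernel pol' q r * V pol r))
      = ?E t (V pol) - ?E t (stage_cost pol') - gamma * ?E t (\<lambda>q. \<Sum>r\<in>UNIV. kernel pol' q r * V pol r)"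
      by (simp add: right_diff_distrib sum_subtractf sum_distrib_left mult_ac)
    ultimately show ?thesis by (simp only: power_Suc) (simp only: right_diff_distrib mult.assoc mult.left_commute[of gamma])
  qed
  ultimately have "(\<Sum>t. gamma ^ t * ?E t (\<lambda>q. V pol q - stage_cost pol' q - gamma * (\<Sum>r\<in>UNIV. kernel pol' q r * V pol r)))
      = ?f 0 - V pol' s"
    by (simp add: sums_iff)
  moreover have "?f 0 = V pol s" by (simp add: if_distrib if_distribR cong: if_cong)
  ultimately show ?thesis unfolding adv visitation_average[OF pol'] by simp
qed

lemma value_fn_measurable:
  assumes [measurable]: "\<And>s. (\<lambda>w. pol w s) \<in> borel_measurable N" "\<And>s. (\<lambda>w. h s (pol w s)) \<in> borel_measurable N"
  shows "(\<lambda>w. V (pol w) s) \<in> borel_measurable N"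
proof -
  have [measurable]: "(\<lambda>w. pol w s $ a) \<in> borel_measurable N" for s a
    using borel_measurable_inner[OF assms(1)[of s] borel_measurable_const[of "axis a 1"]] by (simp add: inner_axis)
  have [measurable]: "(\<lambda>w. state_dist P (pol w) t s q) \<in> borel_measurable N" for t q
    by (induction t arbitrary: q) auto
  show ?thesis unfolding value_fn_def by measurable
qed

text \<open>The constant must not depend on the policy, since it has to dominate the value of random
  iterates.\<close>

lemma value_fn_bound:
  assumes hB: "\<And>s p. p \<in> prob_simplex \<Longrightarrow> \<bar>h s p\<bar> \<le> B"
  obtains K where "\<And>pol s. is_policy pol \<Longrightarrow> \<bar>V pol s\<bar> \<le> K"
proof -
  define R where "R = (\<Sum>s\<in>UNIV. \<Sum>a\<in>UNIV. \<bar>c s a\<bar>) + B"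
  have "\<bar>V pol s\<bar> \<le> R / (1 - gamma)" if pol: "is_policy pol" for pol s
  proof -
    have p1: "pol q $ a \<le> 1" for q a
      using member_le_sum[of a UNIV "\<lambda>a. pol q $ a"] pol prob_simplex_sum[of "pol q"]
      by (auto simp: is_policy_def prob_simplex_nonneg)
    have R: "\<bar>stage_cost pol q\<bar> \<le> R" for q
    proof -
      have "\<bar>\<Sum>a\<in>UNIV. pol q $ a * c q a\<bar> \<le> (\<Sum>a\<in>UNIV. \<bar>c q a\<bar>)"
      proof (rule order_trans[OF sum_abs], rule sum_mono)
        fix a show "\<bar>pol q $ a * c q a\<bar> \<le> \<bar>c q a\<bar>"
          using mult_right_mono[of "pol q $ a" 1 "\<bar>c q a\<bar>"] p1 pol
          by (simp add: abs_mult is_policy_def prob_simplex_nonneg)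
      qed
      also have "\<dots> \<le> (\<Sum>s\<in>UNIV. \<Sum>a\<in>UNIV. \<bar>c s a\<bar>)"
        by (rule member_le_sum[of q UNIV "\<lambda>s. \<Sum>a\<in>UNIV. \<bar>c s a\<bar>"]) (auto intro: sum_nonneg)
      finally show ?thesis
        using hB[of "pol q" q] pol unfolding R_def stage_cost_def is_policy_def
        by (meson abs_triangle_ineq add_mono order_trans)
    qed
    let ?g = "\<lambda>t. gamma ^ t * (\<Sum>q\<in>UNIV. state_dist P pol t s q * stage_cost pol q)"
    have "norm (\<Sum>t. ?g t) \<le> (\<Sum>t. gamma ^ t * R)"
    proof (rule norm_suminf_le)
      show "summable (\<lambda>t. gamma ^ t * R)" using gamma by (intro summable_mult2 summable_geometric) auto
      show "norm (?g t) \<le> gamma ^ t * R" for t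
        using gamma state_dist_average_bound[OF pol R, of t s] by (simp add: abs_mult mult_left_mono)
    qed
    also have "\<dots> = R / (1 - gamma)"
      using gamma by (subst suminf_mult2[symmetric]) (auto simp: summable_geometric suminf_geometric)
    finally show ?thesis using value_fn_sums[OF pol, of s] by (simp add: sums_iff)
  qed
  then show thesis by (rule that)
qed

end

subsection \<open>Conditional exponential moments\<close>

text \<open>Equivalent to \<open>nn_cond_exp M F (\<lambda>w. psi2 sg (e w)) \<le> 2\<close> almost everywhere, but stated through
  test functions so that conditional expectations are eliminated once and for all.\<close>

definition psi2_bounded :: "'m measure \<Rightarrow> 'm measure \<Rightarrow> real \<Rightarrow> ('m \<Rightarrow> real) \<Rightarrow> bool" where
  "psi2_bounded M F sg e \<longleftrightarrow> e \<in> borel_measurable M \<and>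
     (\<forall>Z\<in>borel_measurable F. (\<integral>\<^sup>+w. Z w * psi2 sg (e w) \<partial>M) \<le> 2 * (\<integral>\<^sup>+w. Z w \<partial>M))"

lemma psi2_measurable [measurable]:
  assumes [measurable]: "e \<in> borel_measurable M"
  shows "(\<lambda>w. psi2 sg (e w)) \<in> borel_measurable M"
  unfolding psi2_def by measurable

lemma psi2_boundedI:
  assumes "prob_space M" "subalgebra M F" and e [measurable]: "e \<in> borel_measurable M"
    and le: "AE w in M. nn_cond_exp M F (\<lambda>w. psi2 sg (e w)) w \<le> 2"
  shows "psi2_bounded M F sg e"
proof -
  interpret prob_space M by fact
  interpret finite_measure_subalgebra M F by standard (rule assms(2))
  have "(\<integral>\<^sup>+w. Z w * psi2 sg (e w) \<partial>M) \<le> 2 * (\<integral>\<^sup>+w. Z w \<partial>M)" if Z [measurable]: "Z \<in> borel_measurable F" for Z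
  proof -
    have [measurable]: "Z \<in> borel_measurable M" by (rule measurable_from_subalg[OF assms(2) Z])
    have "(\<integral>\<^sup>+w. Z w * psi2 sg (e w) \<partial>M) = (\<integral>\<^sup>+w. Z w * nn_cond_exp M F (\<lambda>w. psi2 sg (e w)) w \<partial>M)"
      by (rule nn_cond_exp_intg[symmetric]) auto
    also have "\<dots> \<le> (\<integral>\<^sup>+w. 2 * Z w \<partial>M)"
      using le by (intro nn_integral_mono_AE) (auto elim!: eventually_mono simp: mult.commute intro!: mult_left_mono)
    finally show ?thesis by (simp add: nn_integral_cmult)
  qed
  then show ?thesis using e unfolding psi2_bounded_def by blast
qed

text \<open>For \<open>sg = 0\<close> the function \<open>psi2\<close> is infinite off 0, so a
  finite expectation forces \<open>e\<close> to vanish almost surely. This case is split off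
  wherever a later proof divides by \<open>sg\<close>.\<close>

lemma psi2_bounded_zero:
  assumes "prob_space M" "psi2_bounded M F 0 e"
  shows "AE w in M. e w = 0"
proof -
  interpret prob_space M by fact
  have [measurable]: "e \<in> borel_measurable M" using assms(2) by (simp add: psi2_bounded_def)
  have "(\<integral>\<^sup>+w. 1 * psi2 0 (e w) \<partial>M) \<le> 2 * (\<integral>\<^sup>+w. 1 \<partial>M)"
    using assms(2) unfolding psi2_bounded_def by (elim conjE ballE[of _ _ "\<lambda>_. 1"]) auto
  then have "(\<integral>\<^sup>+w. psi2 0 (e w) \<partial>M) \<noteq> \<infinity>"
    by (auto simp: emeasure_space_1 top_unique)
  then have "AE w in M. psi2 0 (e w) \<noteq> \<infinity>" by (intro nn_integral_PInf_AE) auto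
  then show ?thesis by eventually_elim (auto simp: psi2_def split: if_splits)
qed

text \<open>Convexity of \<open>exp\<close> between 0 and \<open>u\<close>. It takes the place of a
  conditional Jensen inequality: a conditional bound 2 for \<open>exp u\<close> yields
  \<open>1 + th\<close> for \<open>exp (th * u)\<close> by linearity alone.\<close>

lemma exp_scaled_le:
  fixes u :: real
  assumes "0 \<le> th" "th \<le> 1"
  shows "exp (th * u) \<le> (1 - th) + th * exp u"
  using convex_onD[OF exp_convex, of th 0 u] assms by simp

text \<open>The linear term keeps the mean of the noise visible, and the rest is a square
  exponential of the kind that \<open>psi2_bounded\<close> controls.\<close>

lemma exp_le_add_exp_square:
  fixes u :: real
  shows "exp u \<le> u + exp (u\<^sup>2)"
proof -
  consider "u > 1" | "0 \<le> u" "u \<le> 1" | "u < 0" by linarith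
  then show ?thesis
  proof cases
    case 1
    then have "u \<le> u\<^sup>2" by (simp add: power2_eq_square)
    then show ?thesis using 1 by (smt (verit) exp_le_cancel_iff)
  next
    case 2
    then show ?thesis using exp_bound[of u] exp_ge_add_one_self[of "u\<^sup>2"] by linarith
  next
    case 3
    define y where "y = - u"
    have y: "y > 0" using 3 by (simp add: y_def)
    \<comment> \<open>Since \<open>1 + y + y^2/2\<close> is a lower bound for \<open>exp y\<close>,
      this yields \<open>exp (- y) \<le> 1 - y + y^2\<close>.\<close>
    have "1 \<le> (1 + y + y\<^sup>2 / 2) * (1 - y + y\<^sup>2)"
    proof -
      have "(1 + y + y\<^sup>2 / 2) * (1 - y + y\<^sup>2) = 1 + y^2/2 + y^3/2 + y^4/2"
        by (simp add: field_simps power2_eq_square power3_eq_cube power4_eq_xxxx)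
      then show ?thesis using y by simp
    qed
    also have "\<dots> \<le> exp y * (1 - y + y\<^sup>2)"
      using exp_lower_Taylor_quadratic[of y] y sum_squares_ge_zero[of "1 - y" y]
        sum_power2_ge_zero[of "1 - y / 2" y]
      by (intro mult_right_mono) (auto simp: power2_eq_square algebra_simps)
    finally have "exp u \<le> 1 - y + y\<^sup>2" by (simp add: y_def exp_minus field_simps)
    then have "exp u \<le> 1 + u + u\<^sup>2" by (simp add: y_def)
    then show ?thesis using exp_ge_add_one_self[of "u\<^sup>2"] by linarith
  qed
qed

lemma integrable_dominated_nonneg:
  fixes f g :: "'m \<Rightarrow> real"
  assumes "integrable M g" "f \<in> borel_measurable M" "\<And>w. 0 \<le> f w" "\<And>w. f w \<le> g w"
  shows "integrable M f"
proof (rule Bochner_Integration.integrable_bound[OF assms(1,2)], rule AE_I2)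
  fix w show "norm (f w) \<le> norm (g w)" using assms(3,4)[of w] by simp
qed

lemma psi2_bounded_exp:
  assumes e: "psi2_bounded M F sg e" and F: "subalgebra M F" and sg: "0 < sg"
    and th: "0 \<le> th" "th \<le> 1"
    and Z: "Z \<in> borel_measurable F" "\<And>w. 0 \<le> Z w" "integrable M Z"
    and y [measurable]: "y \<in> borel_measurable M" and le: "\<And>w. y w \<le> th * ((e w)\<^sup>2 / sg\<^sup>2)"
  shows "integrable M (\<lambda>w. Z w * exp (y w))" "(\<integral>w. Z w * exp (y w) \<partial>M) \<le> (1 + th) * (\<integral>w. Z w \<partial>M)"
proof -
  have [measurable]: "e \<in> borel_measurable M" using e by (simp add: psi2_bounded_def)
  have [measurable]: "Z \<in> borel_measurable M" by (rule measurable_from_subalg[OF F Z(1)])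
  define G where "G w = exp ((e w)\<^sup>2 / sg\<^sup>2)" for w
  have [measurable]: "G \<in> borel_measurable M" unfolding G_def by measurable
  have "(\<lambda>w. ennreal (Z w)) \<in> borel_measurable F" using Z(1) by measurable
  then have "(\<integral>\<^sup>+w. ennreal (Z w) * psi2 sg (e w) \<partial>M) \<le> 2 * (\<integral>\<^sup>+w. ennreal (Z w) \<partial>M)"
    using e by (simp add: psi2_bounded_def)
  also have "(\<integral>\<^sup>+w. ennreal (Z w) * psi2 sg (e w) \<partial>M) = (\<integral>\<^sup>+w. ennreal (Z w * G w) \<partial>M)"
    using sg Z(2) by (intro nn_integral_cong) (simp add: psi2_def G_def ennreal_mult)
  also have "2 * (\<integral>\<^sup>+w. ennreal (Z w) \<partial>M) = ennreal (2 * (\<integral>w. Z w \<partial>M))"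
    using Z by (simp add: nn_integral_eq_integral ennreal_mult)
  finally have le2: "(\<integral>\<^sup>+w. ennreal (Z w * G w) \<partial>M) \<le> ennreal (2 * (\<integral>w. Z w \<partial>M))" .
  have ZG: "integrable M (\<lambda>w. Z w * G w)"
  proof (rule integrableI_nonneg)
    show "(\<integral>\<^sup>+w. ennreal (Z w * G w) \<partial>M) < \<infinity>" using le_less_trans[OF le2] by simp
  qed (use Z(2) in \<open>auto simp: G_def\<close>)
  have "ennreal (\<integral>w. Z w * G w \<partial>M) \<le> ennreal (2 * (\<integral>w. Z w \<partial>M))"
    using le2 ZG Z(2) by (subst (asm) nn_integral_eq_integral) (auto simp: G_def)
  then have ZG2: "(\<integral>w. Z w * G w \<partial>M) \<le> 2 * (\<integral>w. Z w \<partial>M)"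
    using Z(2) by (subst (asm) ennreal_le_iff) auto
  have pw: "Z w * exp (y w) \<le> (1 - th) * Z w + th * (Z w * G w)" for w
  proof -
    have "exp (y w) \<le> (1 - th) + th * G w"
      unfolding G_def using exp_scaled_le[OF th, of "(e w)\<^sup>2 / sg\<^sup>2"] le[of w]
      by (meson exp_le_cancel_iff order_trans)
    then have "Z w * exp (y w) \<le> Z w * ((1 - th) + th * G w)" by (intro mult_left_mono Z)
    then show ?thesis by (simp add: algebra_simps)
  qed
  have I: "integrable M (\<lambda>w. (1 - th) * Z w + th * (Z w * G w))" using Z ZG by auto
  show J: "integrable M (\<lambda>w. Z w * exp (y w))"
    by (rule integrable_dominated_nonneg[OF I _ _ pw]) (use Z(2) in simp_all)
  have "(\<integral>w. Z w * exp (y w) \<partial>M) \<le> (\<integral>w. (1 - th) * Z w + th * (Z w * G w) \<partial>M)"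
    by (intro integral_mono I J pw)
  also have "\<dots> = (1 - th) * (\<integral>w. Z w \<partial>M) + th * (\<integral>w. Z w * G w \<partial>M)" using Z ZG by simp
  also have "\<dots> \<le> (1 - th) * (\<integral>w. Z w \<partial>M) + th * (2 * (\<integral>w. Z w \<partial>M))"
    using th ZG2 by (intro add_left_mono mult_left_mono) auto
  finally show "(\<integral>w. Z w * exp (y w) \<partial>M) \<le> (1 + th) * (\<integral>w. Z w \<partial>M)" by (simp add: algebra_simps)
qed

text \<open>By \<open>u \<le> exp u - 1\<close> the conditional second moment is at most
  \<open>sg\<^sup>2 * (2 - 1)\<close>, which is why \<open>Qbar\<^sup>2\<close> enters the bound in
  expectation with factor 1.\<close>

lemma psi2_bounded_square:
  assumes M: "prob_space M" and e: "psi2_bounded M F sg e" and F: "subalgebra M F"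
    and Z: "Z \<in> borel_measurable F" "\<And>w. 0 \<le> Z w" "integrable M Z"
  shows "integrable M (\<lambda>w. Z w * (e w)\<^sup>2)" "(\<integral>w. Z w * (e w)\<^sup>2 \<partial>M) \<le> sg\<^sup>2 * (\<integral>w. Z w \<partial>M)"
proof -
  have [measurable]: "e \<in> borel_measurable M" using e by (simp add: psi2_bounded_def)
  have [measurable]: "Z \<in> borel_measurable M" by (rule measurable_from_subalg[OF F Z(1)])
  have "integrable M (\<lambda>w. Z w * (e w)\<^sup>2) \<and> (\<integral>w. Z w * (e w)\<^sup>2 \<partial>M) \<le> sg\<^sup>2 * (\<integral>w. Z w \<partial>M)"
  proof (cases "sg = 0")
    case True
    then have "AE w in M. e w = 0" using psi2_bounded_zero[OF M] e by blast
    then have "AE w in M. Z w * (e w)\<^sup>2 = 0" by eventually_elim simp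
    then have "integrable M (\<lambda>w. Z w * (e w)\<^sup>2)" "(\<integral>w. Z w * (e w)\<^sup>2 \<partial>M) = 0"
      using integrable_cong_AE[of "\<lambda>w. Z w * (e w)\<^sup>2" M "\<lambda>_. 0"]
        integral_eq_zero_AE[of "\<lambda>w. Z w * (e w)\<^sup>2" M] by simp_all
    then show ?thesis using True by simp
  next
    case False
    \<comment> \<open>\<open>psi2\<close> depends on its scale only through the square, so a
      positive scale may be substituted.\<close>
    define s where "s = \<bar>sg\<bar>"
    have s: "s > 0" "s\<^sup>2 = sg\<^sup>2" using False by (auto simp: s_def)
    have es: "psi2_bounded M F s e" using e s unfolding psi2_bounded_def psi2_def by (auto simp: False)
    let ?y = "\<lambda>w. (e w)\<^sup>2 / s\<^sup>2"
    have 1: "integrable M (\<lambda>w. Z w * exp (?y w))" "(\<integral>w. Z w * exp (?y w) \<partial>M) \<le> (1 + 1) * (\<integral>w. Z w \<partial>M)"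
      using psi2_bounded_exp[OF es F s(1) _ _ Z, of 1 ?y] by simp_all
    have pw: "Z w * (e w)\<^sup>2 \<le> s\<^sup>2 * (Z w * exp (?y w) - Z w)" for w
    proof -
      have "(e w)\<^sup>2 \<le> s\<^sup>2 * (exp (?y w) - 1)"
        using mult_left_mono[OF exp_ge_add_one_self[of "?y w"], of "s\<^sup>2"] s(1) by (simp add: algebra_simps)
      from mult_left_mono[OF this Z(2)[of w]] show ?thesis by (simp add: algebra_simps)
    qed
    have I: "integrable M (\<lambda>w. s\<^sup>2 * (Z w * exp (?y w) - Z w))" using 1 Z by auto
    have J: "integrable M (\<lambda>w. Z w * (e w)\<^sup>2)"
      by (rule integrable_dominated_nonneg[OF I _ _ pw]) (use Z(2) in simp_all)
    have "(\<integral>w. Z w * (e w)\<^sup>2 \<partial>M) \<le> (\<integral>w. s\<^sup>2 * (Z w * exp (?y w) - Z w) \<partial>M)"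
      by (intro integral_mono I J pw)
    also have "\<dots> = s\<^sup>2 * ((\<integral>w. Z w * exp (?y w) \<partial>M) - (\<integral>w. Z w \<partial>M))" using 1 Z by simp
    also have "\<dots> \<le> s\<^sup>2 * (\<integral>w. Z w \<partial>M)" using 1 by (intro mult_left_mono) auto
    finally show ?thesis using J s by simp
  qed
  then show "integrable M (\<lambda>w. Z w * (e w)\<^sup>2)" "(\<integral>w. Z w * (e w)\<^sup>2 \<partial>M) \<le> sg\<^sup>2 * (\<integral>w. Z w \<partial>M)" by auto
qed

text \<open>In \<open>exp_le_add_exp_square\<close> the linear term contributes the mean
  \<open>l * b\<close> and the square exponential contributes
  \<open>1 + (l * al * sg)\<^sup>2\<close>. The condition \<open>l * al * sg \<le> 1\<close> keeps
  that exponent within the range of \<open>psi2_bounded_exp\<close>.\<close>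

lemma subgaussian_step:
  assumes e: "psi2_bounded M F sg e" and F: "subalgebra M F" and sg: "0 < sg"
    and l: "0 \<le> l" "0 \<le> al" "l * al * sg \<le> 1"
    and Z: "Z \<in> borel_measurable F" "\<And>w. 0 \<le> Z w" "integrable M Z"
    and nu [measurable]: "nu \<in> borel_measurable M" and le: "\<And>w. \<bar>nu w\<bar> \<le> al * e w"
    and mean: "integrable M (\<lambda>w. Z w * nu w)" "(\<integral>w. Z w * nu w \<partial>M) \<le> b * (\<integral>w. Z w \<partial>M)"
  shows "integrable M (\<lambda>w. Z w * exp (l * nu w))
    \<and> (\<integral>w. Z w * exp (l * nu w) \<partial>M) \<le> exp (l * b + (l * al * sg)\<^sup>2) * (\<integral>w. Z w \<partial>M)"
proof -
  have [measurable]: "Z \<in> borel_measurable M" by (rule measurable_from_subalg[OF F Z(1)])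
  let ?th = "(l * al * sg)\<^sup>2"
  have th: "0 \<le> ?th" "?th \<le> 1" using l sg by (auto simp: power_le_one)
  have le': "(l * nu w)\<^sup>2 \<le> ?th * ((e w)\<^sup>2 / sg\<^sup>2)" for w
  proof -
    have "(nu w)\<^sup>2 \<le> (al * e w)\<^sup>2" using power_mono[OF le[of w] abs_ge_zero, of 2] by simp
    then have "l\<^sup>2 * (nu w)\<^sup>2 \<le> l\<^sup>2 * (al * e w)\<^sup>2" by (intro mult_left_mono) auto
    then show ?thesis using sg by (simp add: power_mult_distrib field_simps)
  qed
  have 1: "integrable M (\<lambda>w. Z w * exp ((l * nu w)\<^sup>2))"
     "(\<integral>w. Z w * exp ((l * nu w)\<^sup>2) \<partial>M) \<le> (1 + ?th) * (\<integral>w. Z w \<partial>M)"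
    by (rule psi2_bounded_exp[OF e F sg th Z _ le']; simp)+
  have pw: "Z w * exp (l * nu w) \<le> l * (Z w * nu w) + Z w * exp ((l * nu w)\<^sup>2)" for w
    using mult_left_mono[OF exp_le_add_exp_square[of "l * nu w"] Z(2)[of w]] by (simp add: algebra_simps)
  have I: "integrable M (\<lambda>w. l * (Z w * nu w) + Z w * exp ((l * nu w)\<^sup>2))" using 1 mean by auto
  have J: "integrable M (\<lambda>w. Z w * exp (l * nu w))"
    by (rule integrable_dominated_nonneg[OF I _ _ pw]) (use Z(2) in simp_all)
  have "(\<integral>w. Z w * exp (l * nu w) \<partial>M) \<le> (\<integral>w. l * (Z w * nu w) + Z w * exp ((l * nu w)\<^sup>2) \<partial>M)"
    by (intro integral_mono I J pw)
  also have "\<dots> = l * (\<integral>w. Z w * nu w \<partial>M) + (\<integral>w. Z w * exp ((l * nu w)\<^sup>2) \<partial>M)" using 1 mean by simp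
  also have "\<dots> \<le> l * (b * (\<integral>w. Z w \<partial>M)) + (1 + ?th) * (\<integral>w. Z w \<partial>M)"
    using 1 mean l by (intro add_mono mult_left_mono) auto
  also have "\<dots> = (1 + (l * b + ?th)) * (\<integral>w. Z w \<partial>M)" by (simp add: algebra_simps)
  also have "\<dots> \<le> exp (l * b + ?th) * (\<integral>w. Z w \<partial>M)"
    using Z(2) by (intro mult_right_mono exp_ge_add_one_self) auto
  finally show ?thesis using J by simp
qed

subsection \<open>Tail bounds along a filtration\<close>

locale filtered_prob_space = prob_space M for M :: "'m measure" +
  fixes F :: "nat \<Rightarrow> 'm measure"
  assumes sub: "\<And>t. subalgebra M (F t)" and mono: "\<And>t. subalgebra (F (Suc t)) (F t)"
begin

lemma filtration_mono: "i \<le> j \<Longrightarrow> f \<in> borel_measurable (F i) \<Longrightarrow> f \<in> borel_measurable (F j)"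
  by (induction rule: dec_induct) (auto intro: measurable_from_subalg[OF mono])

lemma filtration_measurable: "f \<in> borel_measurable (F i) \<Longrightarrow> f \<in> borel_measurable M"
  by (rule measurable_from_subalg[OF sub])

text \<open>A Chernoff bound for adapted sums: the exponential of the partial sum up to
  \<open>t\<close> is itself a legitimate test function \<open>Z\<close> for step \<open>t\<close>.
  The free parameter of the method is absorbed into \<open>Y\<close>.\<close>

lemma exponential_tail:
  fixes Y :: "nat \<Rightarrow> 'm \<Rightarrow> real"
  assumes Y: "\<And>t. t < n \<Longrightarrow> Y t \<in> borel_measurable (F (Suc t))"
    and step: "\<And>t (Z :: 'm \<Rightarrow> real). t < n \<Longrightarrow> Z \<in> borel_measurable (F t) \<Longrightarrow> (\<And>w. 0 \<le> Z w) \<Longrightarrow> integrable M Z \<Longrightarrow>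
      integrable M (\<lambda>w. Z w * exp (Y t w)) \<and> (\<integral>w. Z w * exp (Y t w) \<partial>M) \<le> exp (b t) * (\<integral>w. Z w \<partial>M)"
    and d: "0 < d"
  shows "prob {w \<in> space M. (\<Sum>t<n. Y t w) > (\<Sum>t<n. b t) + ln (1 / d)} \<le> d"
proof -
  have *: "m \<le> n \<Longrightarrow> (\<lambda>w. exp (\<Sum>t<m. Y t w)) \<in> borel_measurable (F m)
    \<and> integrable M (\<lambda>w. exp (\<Sum>t<m. Y t w)) \<and> (\<integral>w. exp (\<Sum>t<m. Y t w) \<partial>M) \<le> exp (\<Sum>t<m. b t)" for m
  proof (induction m)
    case 0
    then show ?case by (simp add: prob_space)
  next
    case (Suc m)
    then have IH: "(\<lambda>w. exp (\<Sum>t<m. Y t w)) \<in> borel_measurable (F m)"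
      "integrable M (\<lambda>w. exp (\<Sum>t<m. Y t w))" "(\<integral>w. exp (\<Sum>t<m. Y t w) \<partial>M) \<le> exp (\<Sum>t<m. b t)" by auto
    have s: "integrable M (\<lambda>w. exp (\<Sum>t<m. Y t w) * exp (Y m w))"
      "(\<integral>w. exp (\<Sum>t<m. Y t w) * exp (Y m w) \<partial>M) \<le> exp (b m) * (\<integral>w. exp (\<Sum>t<m. Y t w) \<partial>M)"
      using step[OF _ IH(1) _ IH(2)] Suc by auto
    have "exp (b m) * (\<integral>w. exp (\<Sum>t<m. Y t w) \<partial>M) \<le> exp (b m) * exp (\<Sum>t<m. b t)"
      using IH(3) by (intro mult_left_mono) auto
    moreover have "(\<lambda>w. exp (\<Sum>t<m. Y t w) * exp (Y m w)) \<in> borel_measurable (F (Suc m))"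
      using filtration_mono[OF _ IH(1), of "Suc m"] Y[of m] Suc
      by (intro borel_measurable_times borel_measurable_exp) auto
    moreover have "(\<integral>w. exp (\<Sum>t<m. Y t w) * exp (Y m w) \<partial>M) \<le> exp (b m) * exp (\<Sum>t<m. b t)"
      using s(2) calculation(1) by (rule order_trans)
    ultimately show ?case using s(1) by (simp add: exp_add mult.commute)
  qed
  define S where "S w = exp (\<Sum>t<n. Y t w)" for w
  have S: "integrable M S" "(\<integral>w. S w \<partial>M) \<le> exp (\<Sum>t<n. b t)" using *[of n] unfolding S_def by auto
  define c where "c = exp (\<Sum>t<n. b t) / d"
  have c: "c > 0" unfolding c_def using d by simp
  have [measurable]: "S \<in> borel_measurable M" using S by auto
  have "{w \<in> space M. (\<Sum>t<n. Y t w) > (\<Sum>t<n. b t) + ln (1 / d)} \<subseteq> {w \<in> space M. c \<le> S w}"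
  proof safe
    fix w assume "(\<Sum>t<n. Y t w) > (\<Sum>t<n. b t) + ln (1 / d)"
    then have "exp ((\<Sum>t<n. b t) + ln (1 / d)) \<le> S w" unfolding S_def by simp
    then show "c \<le> S w" unfolding c_def using d by (simp add: exp_add)
  qed
  then have "prob {w \<in> space M. (\<Sum>t<n. Y t w) > (\<Sum>t<n. b t) + ln (1 / d)} \<le> prob {w \<in> space M. c \<le> S w}"
    by (rule finite_measure_mono) measurable
  also have "\<dots> \<le> (\<integral>w. S w \<partial>M) / c"
    by (rule integral_Markov_inequality_measure[OF S(1), where A = "{}", simplified])
      (auto simp: S_def c)
  also have "\<dots> \<le> exp (\<Sum>t<n. b t) / c" using S c by (intro divide_right_mono) auto
  also have "\<dots> = d" unfolding c_def using d by simp
  finally show ?thesis .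
qed

lemma prob_zero_AE:
  fixes Y :: "'m \<Rightarrow> real"
  assumes [measurable]: "Y \<in> borel_measurable M" and "AE w in M. Y w = 0" "0 \<le> b"
  shows "prob {w \<in> space M. Y w > b} = 0"
  by (subst prob_eq_0) (use assms in \<open>auto elim!: eventually_mono\<close>)

text \<open>The Chernoff parameter is fixed at \<open>1 / sg\<^sup>2\<close> and the weights
  \<open>a t\<close> act as the exponents \<open>th\<close> of \<open>psi2_bounded_exp\<close>;
  hence their restriction to the unit interval.\<close>

lemma weighted_square_tail:
  fixes x :: "nat \<Rightarrow> 'm \<Rightarrow> real"
  assumes x: "\<And>t. t < n \<Longrightarrow> x t \<in> borel_measurable (F (Suc t))"
    and b: "\<And>t. t < n \<Longrightarrow> psi2_bounded M (F t) sg (x t)" and sg: "0 \<le> sg"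
    and a: "\<And>t. t < n \<Longrightarrow> 0 \<le> a t" "\<And>t. t < n \<Longrightarrow> a t \<le> 1" and d: "0 < d" "d \<le> 1"
  shows "prob {w \<in> space M. (\<Sum>t<n. a t * (x t w)\<^sup>2) > sg\<^sup>2 * ((\<Sum>t<n. a t) + ln (1 / d))} \<le> d"
proof (cases "sg = 0")
  case True
  have "AE w in M. \<forall>t\<in>{..<n}. x t w = 0"
    using b True psi2_bounded_zero[OF prob_space_axioms] by (intro AE_finite_allI) auto
  then have "AE w in M. (\<Sum>t<n. a t * (x t w)\<^sup>2) = 0" by eventually_elim auto
  then have "prob {w \<in> space M. (\<Sum>t<n. a t * (x t w)\<^sup>2) > 0} = 0"
    using x[THEN filtration_measurable] by (intro prob_zero_AE) auto
  then show ?thesis using True d by simp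
next
  case False
  then have sg: "sg > 0" using sg by simp
  let ?Y = "\<lambda>t w. a t * ((x t w)\<^sup>2 / sg\<^sup>2)"
  have "prob {w \<in> space M. (\<Sum>t<n. ?Y t w) > (\<Sum>t<n. a t) + ln (1 / d)} \<le> d"
  proof (rule exponential_tail[OF _ _ d(1)])
    fix t assume t: "t < n"
    note [measurable] = x[OF t]
    show "?Y t \<in> borel_measurable (F (Suc t))" by measurable
    fix Z :: "'m \<Rightarrow> real" assume Z: "Z \<in> borel_measurable (F t)" "\<And>w. 0 \<le> Z w" "integrable M Z"
    have [measurable]: "x t \<in> borel_measurable M" by (rule filtration_measurable) measurable
    have "integrable M (\<lambda>w. Z w * exp (?Y t w))"
      "(\<integral>w. Z w * exp (?Y t w) \<partial>M) \<le> (1 + a t) * (\<integral>w. Z w \<partial>M)"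
      by (rule psi2_bounded_exp[OF b[OF t] sub sg a[OF t] Z]; simp)+
    moreover have "(1 + a t) * (\<integral>w. Z w \<partial>M) \<le> exp (a t) * (\<integral>w. Z w \<partial>M)"
      using Z(2) by (intro mult_right_mono exp_ge_add_one_self) auto
    ultimately show "integrable M (\<lambda>w. Z w * exp (?Y t w)) \<and>
      (\<integral>w. Z w * exp (?Y t w) \<partial>M) \<le> exp (a t) * (\<integral>w. Z w \<partial>M)" by simp
  qed
  moreover have "(\<Sum>t<n. ?Y t w) > (\<Sum>t<n. a t) + ln (1 / d) \<longleftrightarrow>
      (\<Sum>t<n. a t * (x t w)\<^sup>2) > sg\<^sup>2 * ((\<Sum>t<n. a t) + ln (1 / d))" for w
  proof -
    have "(\<Sum>t<n. a t * (x t w)\<^sup>2) = sg\<^sup>2 * (\<Sum>t<n. ?Y t w)"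
      using sg by (simp add: sum_distrib_left field_simps)
    then show ?thesis using sg by (simp add: mult_less_cancel_left_pos)
  qed
  ultimately show ?thesis by simp
qed

lemma subgaussian_tail:
  fixes nu e :: "nat \<Rightarrow> 'm \<Rightarrow> real" and al :: "nat \<Rightarrow> real"
  assumes nu: "\<And>t. t < n \<Longrightarrow> nu t \<in> borel_measurable (F (Suc t))"
    and e: "\<And>t. t < n \<Longrightarrow> psi2_bounded M (F t) sg (e t)" and sg: "0 \<le> sg"
    and al: "\<And>t. t < n \<Longrightarrow> 0 \<le> al t" "\<And>t. t < n \<Longrightarrow> al t \<le> A" and A: "0 < A" and vs: "0 \<le> vs"
    and le: "\<And>t w. t < n \<Longrightarrow> \<bar>nu t w\<bar> \<le> al t * e t w"
    and mean: "\<And>t (Z :: 'm \<Rightarrow> real). t < n \<Longrightarrow> Z \<in> borel_measurable (F t) \<Longrightarrow> (\<And>w. 0 \<le> Z w) \<Longrightarrow> integrable M Z \<Longrightarrow>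
       integrable M (\<lambda>w. Z w * nu t w) \<and> (\<integral>w. Z w * nu t w \<partial>M) \<le> vs * al t * (\<integral>w. Z w \<partial>M)"
    and d: "0 < d" "d \<le> 1"
  shows "prob {w \<in> space M. (\<Sum>t<n. nu t w) > vs * (\<Sum>t<n. al t) + sg / A * (\<Sum>t<n. (al t)\<^sup>2) + sg * A * ln (1 / d)} \<le> d"
proof (cases "sg = 0")
  case True
  have "AE w in M. \<forall>t\<in>{..<n}. e t w = 0"
    using e True psi2_bounded_zero[OF prob_space_axioms] by (intro AE_finite_allI) auto
  then have "AE w in M. (\<Sum>t<n. nu t w) = 0"
  proof eventually_elim
    case (elim w)
    then show ?case using le[of _ w] by (intro sum.neutral) force
  qed
  then have "prob {w \<in> space M. (\<Sum>t<n. nu t w) > vs * (\<Sum>t<n. al t)} = 0"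
    using nu[THEN filtration_measurable] vs al by (intro prob_zero_AE) (auto intro!: mult_nonneg_nonneg sum_nonneg)
  then show ?thesis using True d by simp
next
  case False
  then have sg: "sg > 0" using sg by simp
  \<comment> \<open>The largest parameter for which \<open>al t \<le> A\<close> guarantees
    \<open>l * al t * sg \<le> 1\<close>. It is not tuned to \<open>d\<close>: in the application
    the sum of \<open>(al t)\<^sup>2\<close> is at most \<open>A\<^sup>2 * (1 + ln k)\<close>, so
    both error terms are \<open>sg * A\<close> times a logarithm.\<close>
  define l where "l = 1 / (sg * A)"
  have l: "l > 0" unfolding l_def using sg A by simp
  have "prob {w \<in> space M. (\<Sum>t<n. l * nu t w) > (\<Sum>t<n. l * (vs * al t) + (l * al t * sg)\<^sup>2) + ln (1 / d)} \<le> d"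
  proof (rule exponential_tail[OF _ _ d(1)])
    fix t assume t: "t < n"
    note [measurable] = nu[OF t]
    show "(\<lambda>w. l * nu t w) \<in> borel_measurable (F (Suc t))" by measurable
    fix Z :: "'m \<Rightarrow> real" assume Z: "Z \<in> borel_measurable (F t)" "\<And>w. 0 \<le> Z w" "integrable M Z"
    show "integrable M (\<lambda>w. Z w * exp (l * nu t w)) \<and>
      (\<integral>w. Z w * exp (l * nu t w) \<partial>M) \<le> exp (l * (vs * al t) + (l * al t * sg)\<^sup>2) * (\<integral>w. Z w \<partial>M)"
    proof (rule subgaussian_step[OF e[OF t] sub sg _ al(1)[OF t] _ Z _ le[OF t]])
      show "l * al t * sg \<le> 1" unfolding l_def using al(2)[OF t] A sg by (simp add: field_simps)
      show "nu t \<in> borel_measurable M" using nu[OF t] by (rule filtration_measurable)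
      show "integrable M (\<lambda>w. Z w * nu t w)" "(\<integral>w. Z w * nu t w \<partial>M) \<le> vs * al t * (\<integral>w. Z w \<partial>M)"
        using mean[OF t Z] by blast+
      show "0 \<le> l" using l by simp
    qed
  qed
  moreover have "(\<Sum>t<n. l * nu t w) > (\<Sum>t<n. l * (vs * al t) + (l * al t * sg)\<^sup>2) + ln (1 / d) \<longleftrightarrow>
      (\<Sum>t<n. nu t w) > vs * (\<Sum>t<n. al t) + sg / A * (\<Sum>t<n. (al t)\<^sup>2) + sg * A * ln (1 / d)" for w
  proof -
    have eq: "l * (vs * (\<Sum>t<n. al t) + sg / A * (\<Sum>t<n. (al t)\<^sup>2) + sg * A * ln (1 / d))
       = (\<Sum>t<n. l * (vs * al t) + (l * al t * sg)\<^sup>2) + ln (1 / d)"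
      using sg A by (simp add: l_def distrib_left sum.distrib sum_distrib_left power_mult_distrib power_divide power2_eq_square)
    show ?thesis unfolding sum_distrib_left[symmetric, of l "\<lambda>t. nu t w"] eq[symmetric]
      by (rule mult_less_cancel_left_pos[OF l])
  qed
  ultimately show ?thesis by simp
qed

end

subsection \<open>Stochastic policy mirror descent\<close>

lemma sum_inverse_le_ln: "(\<Sum>t<n. 1 / (real t + 2)) \<le> ln (real n + 1)"
proof (induction n)
  case (Suc n)
  \<comment> \<open>Each increment of the logarithm dominates the next summand. Starting the sum at
    1/2 avoids the additive 1 of the full harmonic sum.\<close>
  have "ln ((real n + 1) / (real n + 2)) \<le> (real n + 1) / (real n + 2) - 1" by (rule ln_le_minus_one) simp
  also have "\<dots> = - (1 / (real n + 2))" by (simp add: field_simps)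
  finally have "1 / (real n + 2) \<le> ln (real n + 2) - ln (real n + 1)" by (simp add: ln_div)
  then show ?case using Suc by (simp add: add.commute)
qed simp

lemma harmonic_le_ln:
  assumes "1 \<le> n"
  shows "(\<Sum>t<n. 1 / (real t + 1)) \<le> 1 + ln (real n)"
proof -
  obtain m where m: "n = Suc m" using assms by (cases n) auto
  have "(\<Sum>t<n. 1 / (real t + 1)) = 1 + (\<Sum>t<m. 1 / (real t + 2))"
    unfolding m sum.lessThan_Suc_shift by (simp add: add.commute)
  then show ?thesis using sum_inverse_le_ln[of m] by (simp add: m add.commute)
qed

text \<open>The telescoped inequality carries the weight \<open>k + 1\<close> on the divergence, the
  final bound only \<open>k\<close>; the surplus \<open>mu * DD\<close> is nonnegative and is
  dropped.\<close>

lemma average_bound: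
  fixes g gap mu DD R :: real
  assumes "0 < g" "1 \<le> k" "0 \<le> mu * DD" "g * gap + mu * (real k + 1) * DD \<le> R"
  shows "(1 / real k) * gap + mu / g * DD \<le> R / (g * real k)"
proof -
  have "((1 / real k) * gap + mu / g * DD) * (g * real k) = g * gap + mu * real k * DD"
    using assms(1,2) by (simp add: field_simps)
  also have "\<dots> \<le> R" using assms(3,4) by (simp add: algebra_simps)
  finally show ?thesis using assms(1,2) by (subst pos_le_divide_eq) auto
qed

text \<open>The second conclusion closes the bootstrap: noise of size
  \<open>2 * L * sg * sqrt (2 * C)\<close> must reproduce a divergence bound no larger than
  \<open>C\<close>. The first two summands of \<open>C\<close> keep the fixed terms below half of
  \<open>mu * C\<close>, the last one keeps the square root term below the other half. The third
  conclusion passes to the final form through \<open>L \<le> L powr (3/2)\<close>.\<close>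

lemma bootstrap_constant:
  fixes mu g D0 B sg L :: real
  assumes mu: "0 < mu" and g: "0 < g" "g \<le> 1" and D0: "0 < D0" and B: "0 \<le> B" and sg: "0 \<le> sg" and L: "1 \<le> L"
  defines "C \<equiv> 6 * D0 / g + 75 * B * L powr (3/2) / (g * mu\<^sup>2) + 108 * sg\<^sup>2 * L ^ 3 / (g\<^sup>2 * mu\<^sup>2)"
  shows "0 < C" "mu * D0 + (1 / mu) * B * L + 2 * L * sg * sqrt (2 * C) \<le> mu * C"
    "mu * D0 + (1 / mu) * B * L + 2 * L * sg * sqrt (2 * C)
      \<le> mu * D0 + (25 * (1 / mu) * B + 2 * sg * sqrt (3 * C)) * L powr (3/2)"
proof -
  have LP: "L \<le> L powr (3/2)" using powr_mono[of 1 "3/2" L] L by simp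
  have T1: "6 * D0 \<le> 6 * D0 / g" using D0 g by (simp add: field_simps)
  have T2: "75 * B * L / mu\<^sup>2 \<le> 75 * B * L powr (3/2) / (g * mu\<^sup>2)"
  proof (rule frac_le)
    show "75 * B * L \<le> 75 * B * L powr (3/2)" using LP B by (intro mult_left_mono) auto
  qed (use mu g B L in \<open>auto simp: mult_left_le_one_le\<close>)
  have T3: "108 * sg\<^sup>2 * L\<^sup>2 / mu\<^sup>2 \<le> 108 * sg\<^sup>2 * L ^ 3 / (g\<^sup>2 * mu\<^sup>2)"
  proof (rule frac_le)
    show "108 * sg\<^sup>2 * L\<^sup>2 \<le> 108 * sg\<^sup>2 * L ^ 3"
      using power_increasing[of 2 3 L] L by (intro mult_left_mono) auto
  qed (use mu g L in \<open>auto simp: mult_left_le_one_le power_le_one\<close>)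
  have nn: "0 \<le> 75 * B * L / mu\<^sup>2" "0 \<le> 108 * sg\<^sup>2 * L\<^sup>2 / mu\<^sup>2" using B L by auto
  have CB: "6 * D0 + 75 * B * L / mu\<^sup>2 \<le> C" "108 * sg\<^sup>2 * L\<^sup>2 / mu\<^sup>2 \<le> C"
    unfolding C_def using T1 T2 T3 nn D0 by linarith+
  then show C: "0 < C" using nn D0 by linarith
  have "mu * (6 * D0 + 75 * B * L / mu\<^sup>2) \<le> mu * C" using CB mu by (intro mult_left_mono) auto
  then have 1: "6 * (mu * D0) + 75 * ((1 / mu) * B * L) \<le> mu * C"
    using mu by (simp add: power2_eq_square algebra_simps)
  \<comment> \<open>Squared, the target is
    \<open>8 * sg\<^sup>2 * L\<^sup>2 * C \<le> (mu * C)\<^sup>2 / 4\<close>, which asks for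
    \<open>C \<ge> 32 * sg\<^sup>2 * L\<^sup>2 / mu\<^sup>2\<close>.\<close>
  have "108 * sg\<^sup>2 * L\<^sup>2 \<le> mu\<^sup>2 * C" using CB(2) mu by (simp add: pos_divide_le_eq mult.commute)
  then have "108 * sg\<^sup>2 * L\<^sup>2 * C \<le> mu\<^sup>2 * C * C" using C by (intro mult_right_mono) auto
  moreover have "(2 * L * sg * sqrt (2 * C))\<^sup>2 = 8 * (sg\<^sup>2 * L\<^sup>2 * C)"
    unfolding power_mult_distrib using C by (simp add: real_sqrt_pow2)
  moreover have "(1 / 2 * (mu * C))\<^sup>2 = 1 / 4 * (mu\<^sup>2 * C * C)"
    by (simp add: power2_eq_square)
  moreover have "0 \<le> sg\<^sup>2 * L\<^sup>2 * C" using C by simp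
  ultimately have "(2 * L * sg * sqrt (2 * C))\<^sup>2 \<le> (1 / 2 * (mu * C))\<^sup>2"
    by linarith
  then have 2: "2 * L * sg * sqrt (2 * C) \<le> 1 / 2 * (mu * C)"
    by (rule power2_le_imp_le) (use mu C in simp)
  have "0 \<le> (1 / mu) * B * L" using mu B L by simp
  then show "mu * D0 + (1 / mu) * B * L + 2 * L * sg * sqrt (2 * C) \<le> mu * C"
    using 1 2 mult_pos_pos[OF mu D0] by linarith
  have "(1 / mu) * B * L \<le> 25 * (1 / mu) * B * L powr (3/2)"
    using LP mu B L by (intro mult_mono) (auto simp: divide_right_mono)
  moreover have "(2 * sg) * sqrt (2 * C) * L \<le> (2 * sg) * sqrt (3 * C) * L powr (3/2)"
    using LP sg L C by (intro mult_mono mult_left_mono real_sqrt_le_mono) auto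
  ultimately show "mu * D0 + (1 / mu) * B * L + 2 * L * sg * sqrt (2 * C)
      \<le> mu * D0 + (25 * (1 / mu) * B + 2 * sg * sqrt (3 * C)) * L powr (3/2)"
    by (simp add: algebra_simps)
qed

text \<open>The variance of \<open>y\<close> under the probability weights \<open>k\<close> is
  nonnegative.\<close>

lemma weighted_mean_square_le:
  fixes k y :: "'b \<Rightarrow> real"
  assumes "\<And>q. q \<in> A \<Longrightarrow> 0 \<le> k q" "sum k A = 1"
  shows "(\<Sum>q\<in>A. k q * y q)\<^sup>2 \<le> (\<Sum>q\<in>A. k q * (y q)\<^sup>2)"
proof -
  let ?m = "\<Sum>q\<in>A. k q * y q"
  have "0 \<le> (\<Sum>q\<in>A. k q * (y q - ?m)\<^sup>2)" using assms by (intro sum_nonneg) auto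
  also have "\<dots> = (\<Sum>q\<in>A. k q * (y q)\<^sup>2 - 2 * ?m * (k q * y q) + ?m\<^sup>2 * k q)"
    by (intro sum.cong) (auto simp: power2_eq_square algebra_simps)
  also have "\<dots> = (\<Sum>q\<in>A. k q * (y q)\<^sup>2) - 2 * ?m * ?m + ?m\<^sup>2 * sum k A"
    by (simp only: sum.distrib sum_subtractf sum_distrib_left)
  finally show ?thesis using assms(2) by (simp add: power2_eq_square)
qed

lemma borel_measurable_cartI:
  fixes f :: "'m \<Rightarrow> real^'a::finite"
  assumes "\<And>a. (\<lambda>w. f w $ a) \<in> borel_measurable N"
  shows "f \<in> borel_measurable N"
  by (subst borel_measurable_euclidean_space) (auto simp: Basis_vec_def inner_axis assms)

lemma borel_measurable_cartD:
  fixes f :: "'m \<Rightarrow> real^'a::finite"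
  assumes "f \<in> borel_measurable N"
  shows "(\<lambda>w. f w $ a) \<in> borel_measurable N"
  using borel_measurable_inner[OF assms borel_measurable_const[of "axis a 1"]] by (simp add: inner_axis)

section \<open>The filtration generated by the samples\<close>

lemma space_hist_alg [simp]: "space (hist_alg M X xi t) = space M"
  by (simp add: hist_alg_def space_measure_of_conv)

lemma sets_hist_alg:
  "sets (hist_alg M X xi t) = sigma_sets (space M) {xi i -` A \<inter> space M | i A. i < t \<and> A \<in> sets X}"
  unfolding hist_alg_def by (rule sets_measure_of) auto

lemma subalgebra_hist_alg:
  assumes "\<forall>i. xi i \<in> measurable M X"
  shows "subalgebra M (hist_alg M X xi t)"
  unfolding subalgebra_def sets_hist_alg
proof
  show "sigma_sets (space M) {xi i -` A \<inter> space M | i A. i < t \<and> A \<in> sets X} \<subseteq> sets M"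
    using measurable_sets[OF assms[rule_format]] by (intro sets.sigma_sets_subset) blast
qed simp

lemma subalgebra_hist_alg_Suc: "subalgebra (hist_alg M X xi (Suc t)) (hist_alg M X xi t)"
  unfolding subalgebra_def sets_hist_alg
proof
  show "sigma_sets (space M) {xi i -` A \<inter> space M | i A. i < t \<and> A \<in> sets X}
      \<subseteq> sigma_sets (space M) {xi i -` A \<inter> space M | i A. i < Suc t \<and> A \<in> sets X}"
    by (intro sigma_sets_mono') (blast intro: less_SucI)
qed simp

locale spmd = mdp P c gamma h + dgf nrm omega gomega + prob_space M
  for P :: "'s::finite \<Rightarrow> 'a::finite \<Rightarrow> 's \<Rightarrow> real" and c gamma h and nrm :: "real^'a \<Rightarrow> real" and omega gomega and M :: "'m measure" +
  fixes hd :: "'s \<Rightarrow> real^'a \<Rightarrow> real^'a" and mu Mh :: real and X :: "'x measure" and xi :: "nat \<Rightarrow> 'm \<Rightarrow> 'x"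
    and Qtil pis :: "nat \<Rightarrow> 'm \<Rightarrow> 's \<Rightarrow> real^'a" and pi0 pistar :: "'s \<Rightarrow> real^'a" and Dbar0 :: real
  assumes nrm_le_1: "\<forall>p\<in>prob_simplex. nrm p \<le> 1"
    and h_convex: "\<forall>s. convex_on prob_simplex (h s)"
    and h_sc: "\<forall>s. \<forall>p\<in>prob_simplex. \<forall>p'\<in>prob_simplex.
                 h s p - h s p' - hd s p' \<bullet> (p - p') \<ge> mu * bregman omega gomega p p'"
    and mu_pos: "mu > 0"
    and h_lip: "\<forall>s. \<forall>p\<in>prob_simplex. \<forall>p'\<in>prob_simplex. h s p - h s p' \<le> Mh * nrm (p - p')"
    and xi_meas: "\<forall>i. xi i \<in> measurable M X"
    and Qtil_meas: "\<forall>t s. (\<lambda>w. Qtil t w s) \<in> borel_measurable (hist_alg M X xi (Suc t))"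
    and pi0: "is_policy pi0"
    and pis0: "pis 0 = (\<lambda>w. pi0)"
    and spmd: "\<forall>t w. spmd_step omega gomega h (1 / (mu * (real t + 1))) (Qtil t w) (pis t w) (pis (Suc t) w)"
    and Dbar0: "Dbar0 > 0" "\<forall>pol s. is_policy pol \<longrightarrow> bregman omega gomega (pol s) (pi0 s) \<le> Dbar0"
    and pistar: "is_policy pistar"
      "\<forall>pol. is_policy pol \<longrightarrow> (\<forall>s. value_fn P c h gamma pistar s \<le> value_fn P c h gamma pol s)"
begin

sublocale filtered_prob_space M "hist_alg M X xi"
  by unfold_locales (rule subalgebra_hist_alg[OF xi_meas] subalgebra_hist_alg_Suc)+

abbreviation F where "F \<equiv> hist_alg M X xi"

section \<open>Admissibility and adaptedness of the iterates\<close>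

lemma pistar_simplex: "pistar q \<in> prob_simplex"
  using pistar(1) by (simp add: is_policy_def)

lemma pis_simplex: "pis t w s \<in> prob_simplex"
  using pis0 pi0 spmd by (cases t) (auto simp: is_policy_def spmd_step_def)

lemma pis_policy: "is_policy (pis t w)"
  by (simp add: is_policy_def pis_simplex)

lemma nrm_diff_le_2:
  assumes "p \<in> prob_simplex" "p' \<in> prob_simplex"
  shows "nrm (p - p') \<le> 2"
proof -
  have "nrm p \<le> 1" "nrm p' \<le> 1" using nrm_le_1 assms by auto
  then show ?thesis using is_normD(4)[OF nrm, of p "- p'"] is_normD(5)[OF nrm, of p'] by simp
qed

lemma h_continuous: "continuous_on prob_simplex (h s)"
  unfolding continuous_on_def
proof
  fix p :: "real^'a" assume p: "p \<in> prob_simplex"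
  have "continuous_on UNIV (\<lambda>q. Mh * nrm (q - p))"
    by (intro continuous_intros continuous_on_compose2[OF is_norm_continuous[OF nrm]]) auto
  then have "((\<lambda>q. Mh * nrm (q - p)) \<longlongrightarrow> Mh * nrm (p - p)) (at p within prob_simplex)"
    by (meson UNIV_I continuous_on_def continuous_on_subset p subset_UNIV)
  then have "((\<lambda>q. Mh * nrm (q - p)) \<longlongrightarrow> 0) (at p within prob_simplex)"
    using is_normD(2)[OF nrm, of 0] by simp
  then have "((\<lambda>q. h s q - h s p) \<longlongrightarrow> 0) (at p within prob_simplex)"
  proof (rule Lim_null_comparison[rotated])
    show "eventually (\<lambda>q. norm (h s q - h s p) \<le> Mh * nrm (q - p)) (at p within prob_simplex)"
      unfolding eventually_at_filter
    proof (intro always_eventually allI impI)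
      fix q :: "real^'a" assume "q \<in> prob_simplex"
      then have "h s q - h s p \<le> Mh * nrm (q - p)" "h s p - h s q \<le> Mh * nrm (p - q)"
        using h_lip p by blast+
      then show "norm (h s q - h s p) \<le> Mh * nrm (q - p)"
        unfolding is_normD(6)[OF nrm, of p q] by simp
    qed
  qed
  then show "(h s \<longlongrightarrow> h s p) (at p within prob_simplex)" by (rule LIM_zero_cancel)
qed

lemma h_bound:
  obtains B where "\<And>s p. p \<in> prob_simplex \<Longrightarrow> \<bar>h s p\<bar> \<le> B"
proof -
  have "bounded (h s ` prob_simplex)" for s
    by (rule compact_imp_bounded[OF compact_continuous_image[OF h_continuous compact_prob_simplex]])
  then have "bounded (\<Union>s. h s ` prob_simplex)" by (intro bounded_Union) auto
  then show thesis using that unfolding bounded_iff by auto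
qed

text \<open>The update producing \<open>pis (Suc t)\<close> consumes \<open>Qtil t\<close>, which
  may depend on the sample \<open>xi t\<close>; hence the index shift between policies and
  estimates. \<open>spmd_step\<close> builds in no measurable choice, so adaptedness relies on
  uniqueness of the minimiser.\<close>

lemma pis_measurable: "(\<lambda>w. pis t w s) \<in> borel_measurable (F t)"
proof (induction t)
  case 0
  then show ?case by (simp add: pis0)
next
  case (Suc t)
  show ?case
  proof (rule mirror_step_measurable[where f = "h s" and eta = "1 / (mu * (real t + 1))"
        and p = "\<lambda>w. pis t w s" and Q = "\<lambda>w. Qtil t w s"])
    show "(\<lambda>w. pis t w s) \<in> borel_measurable (F (Suc t))" by (rule filtration_mono[OF _ Suc]) simp
    show "(\<lambda>w. Qtil t w s) \<in> borel_measurable (F (Suc t))" by (rule Qtil_meas[rule_format])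
    show "1 / (mu * (real t + 1)) * (Qtil t w s \<bullet> pis (Suc t) w s + h s (pis (Suc t) w s)) + D (pis (Suc t) w s) (pis t w s)
        \<le> 1 / (mu * (real t + 1)) * (Qtil t w s \<bullet> q + h s q) + D q (pis t w s)" if "q \<in> prob_simplex" for w q
      using spmd that unfolding spmd_step_def by blast
  qed (use h_convex h_continuous mu_pos pis_simplex in auto)
qed

lemma value_measurable: "(\<lambda>w. V (pis t w) s) \<in> borel_measurable (F t)"
  by (intro value_fn_measurable measurable_on_simplex h_continuous pis_measurable pis_simplex)

lemma Qf_measurable: "(\<lambda>w. Qf (pis t w) s) \<in> borel_measurable (F t)"
proof (rule borel_measurable_cartI)
  note [measurable] = value_measurable measurable_on_simplex[OF h_continuous[of s] pis_measurable pis_simplex]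
  show "(\<lambda>w. Qf (pis t w) s $ a) \<in> borel_measurable (F t)" for a
    unfolding q_fn_def by simp
qed

section \<open>Error quantities averaged over the visitation measure\<close>

definition qnorm where "qnorm t w = dual_normF nrm (Qtil t w)"
definition qerr where "qerr t w = dual_normF nrm (\<lambda>s. Qtil t w s - Qf (pis t w) s)"
definition mean_div where "mean_div t s w = (\<Sum>q\<in>UNIV. \<kappa> pistar s q * D (pistar q) (pis t w q))"
text \<open>The link between noise and divergence: it multiplies \<open>qerr\<close> in the bound of
  the noise, is at most 2 in all cases, which serves the expectation, and at most
  \<open>sqrt (2 * mean_div)\<close>, which serves the bootstrap.\<close>

definition mean_dist where "mean_dist t s w = (\<Sum>q\<in>UNIV. \<kappa> pistar s q * nrm (pis t w q - pistar q))"
text \<open>The order, exact minus estimate, makes the noise appear with a plus sign in the upper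
  bound of \<open>regret\<close>.\<close>

definition noise where
  "noise t s w = (\<Sum>q\<in>UNIV. \<kappa> pistar s q * ((Qf (pis t w) q - Qtil t w q) \<bullet> (pis t w q - pistar q)))"

lemma qerr_nonneg: "0 \<le> qerr t w"
  unfolding qerr_def by (rule dual_normF_nonneg[OF nrm])

lemma kappa_nonneg: "0 \<le> \<kappa> pistar s q" and kappa_sum: "(\<Sum>q\<in>UNIV. \<kappa> pistar s q) = 1"
  by (intro visitation_nonneg visitation_sum pistar)+

lemma D_nonneg: "0 \<le> D (pistar q) (pis t w q)"
  by (intro bregman_nonneg pistar_simplex pis_simplex)

lemma mean_div_nonneg: "0 \<le> mean_div t s w"
  unfolding mean_div_def by (intro sum_nonneg mult_nonneg_nonneg kappa_nonneg D_nonneg)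

lemma mean_dist_nonneg: "0 \<le> mean_dist t s w"
  unfolding mean_dist_def by (intro sum_nonneg mult_nonneg_nonneg kappa_nonneg is_normD(1)[OF nrm])

lemma mean_dist_le_2: "mean_dist t s w \<le> 2"
proof -
  have "mean_dist t s w \<le> (\<Sum>q\<in>UNIV. \<kappa> pistar s q * 2)"
    unfolding mean_dist_def by (intro sum_mono mult_left_mono kappa_nonneg nrm_diff_le_2 pis_simplex pistar_simplex)
  then show ?thesis by (simp add: kappa_sum flip: sum_distrib_right)
qed

lemma mean_dist_le_sqrt: "mean_dist t s w \<le> sqrt (2 * mean_div t s w)"
proof (rule real_le_rsqrt)
  have "(mean_dist t s w)\<^sup>2 \<le> (\<Sum>q\<in>UNIV. \<kappa> pistar s q * (nrm (pis t w q - pistar q))\<^sup>2)"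
    unfolding mean_dist_def by (intro weighted_mean_square_le kappa_nonneg kappa_sum)
  also have "\<dots> \<le> (\<Sum>q\<in>UNIV. \<kappa> pistar s q * (2 * D (pistar q) (pis t w q)))"
  proof (intro sum_mono mult_left_mono kappa_nonneg)
    show "(nrm (pis t w q - pistar q))\<^sup>2 \<le> 2 * D (pistar q) (pis t w q)" for q
      using bregman_lower[OF pistar_simplex pis_simplex, of q t w q]
      unfolding is_normD(6)[OF nrm, of "pis t w q"] by simp
  qed
  also have "\<dots> = 2 * mean_div t s w" unfolding mean_div_def by (simp add: sum_distrib_left mult_ac)
  finally show "(mean_dist t s w)\<^sup>2 \<le> 2 * mean_div t s w" .
qed

lemma noise_le: "\<bar>noise t s w\<bar> \<le> mean_dist t s w * qerr t w"
proof -
  have "\<bar>noise t s w\<bar> \<le> (\<Sum>q\<in>UNIV. \<bar>\<kappa> pistar s q * ((Qf (pis t w) q - Qtil t w q) \<bullet> (pis t w q - pistar q))\<bar>)"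
    unfolding noise_def by (rule sum_abs)
  also have "\<dots> \<le> (\<Sum>q\<in>UNIV. \<kappa> pistar s q * (qerr t w * nrm (pis t w q - pistar q)))"
  proof (rule sum_mono)
    fix q
    have "\<bar>(Qf (pis t w) q - Qtil t w q) \<bullet> (pis t w q - pistar q)\<bar>
        = \<bar>(Qtil t w q - Qf (pis t w) q) \<bullet> (pis t w q - pistar q)\<bar>"
      by (simp add: inner_diff_left abs_minus_commute)
    also have "\<dots> \<le> dual_norm nrm (Qtil t w q - Qf (pis t w) q) * nrm (pis t w q - pistar q)"
      by (rule dual_norm_abs_holder[OF nrm])
    also have "\<dots> \<le> qerr t w * nrm (pis t w q - pistar q)"
      unfolding qerr_def
      using dual_norm_le_dual_normF[where F = "\<lambda>s. Qtil t w s - Qf (pis t w) s" and s = q]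
      by (intro mult_right_mono is_normD(1)[OF nrm]) auto
    finally show "\<bar>\<kappa> pistar s q * ((Qf (pis t w) q - Qtil t w q) \<bullet> (pis t w q - pistar q))\<bar>
        \<le> \<kappa> pistar s q * (qerr t w * nrm (pis t w q - pistar q))"
      using kappa_nonneg[of s q] by (simp add: abs_mult mult_left_mono)
  qed
  also have "\<dots> = mean_dist t s w * qerr t w" unfolding mean_dist_def by (simp add: sum_distrib_left sum_distrib_right mult_ac)
  finally show ?thesis .
qed

lemma qnorm_measurable: "qnorm t \<in> borel_measurable (F (Suc t))"
  unfolding qnorm_def[abs_def] by (rule dual_normF_measurable[OF nrm Qtil_meas[rule_format]])

lemma Qf_measurable_Suc: "(\<lambda>w. Qf (pis t w) s) \<in> borel_measurable (F (Suc t))"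
  by (rule filtration_mono[OF _ Qf_measurable]) simp

lemma qerr_measurable: "qerr t \<in> borel_measurable (F (Suc t))"
  unfolding qerr_def[abs_def]
  by (rule dual_normF_measurable[OF nrm borel_measurable_diff[OF Qtil_meas[rule_format] Qf_measurable_Suc]])

lemma mean_div_measurable: "mean_div t s \<in> borel_measurable (F t)"
  unfolding mean_div_def[abs_def]
  using bregman_measurable[OF pis_measurable pis_simplex pistar_simplex] by simp

lemma mean_dist_measurable: "mean_dist t s \<in> borel_measurable (F t)"
proof -
  have [measurable]: "nrm \<in> borel_measurable borel"
    by (intro borel_measurable_continuous_onI is_norm_continuous nrm)
  note [measurable] = pis_measurable
  show ?thesis unfolding mean_dist_def[abs_def] by measurable
qed

lemma noise_measurable: "noise t s \<in> borel_measurable (F (Suc t))"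
proof -
  have [measurable]: "(\<lambda>w. Qtil t w s) \<in> borel_measurable (F (Suc t))" for s by (rule Qtil_meas[rule_format])
  have [measurable]: "(\<lambda>w. pis t w s) \<in> borel_measurable (F (Suc t))" for s
    by (rule filtration_mono[OF _ pis_measurable]) simp
  note [measurable] = Qf_measurable_Suc
  show ?thesis unfolding noise_def[abs_def] by measurable
qed

section \<open>Regret along a fixed sample path\<close>

lemma step_bound:
  "Qtil t w q \<bullet> (pis t w q - pistar q) + h q (pis t w q) - h q (pistar q)
     + mu * (real t + 2) * D (pistar q) (pis (Suc t) w q)
   \<le> mu * (real t + 1) * D (pistar q) (pis t w q) + ((qnorm t w)\<^sup>2 + Mh\<^sup>2) / (mu * (real t + 2))"
proof -
  let ?eta = "1 / (mu * (real t + 1))"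
  \<comment> \<open>The coefficient \<open>mu * (t + 2)\<close> is \<open>1 / eta\<close> at time
    \<open>t + 1\<close>, so with these step sizes the divergences telescope without
    remainder.\<close>
  have eq: "1 / ?eta = mu * (real t + 1)" "mu + mu * (real t + 1) = mu * (real t + 2)"
    by (simp_all add: algebra_simps)
  have "Qtil t w q \<bullet> (pis t w q - pistar q) + h q (pis t w q) - h q (pistar q)
     + (mu + 1 / ?eta) * D (pistar q) (pis (Suc t) w q)
   \<le> 1 / ?eta * D (pistar q) (pis t w q) + ((qnorm t w)\<^sup>2 + Mh\<^sup>2) / (mu + 1 / ?eta)"
  proof (rule mirror_step[where f = "h q" and g = "hd q"])
    show "dual_norm nrm (Qtil t w q) \<le> qnorm t w" unfolding qnorm_def by (rule dual_norm_le_dual_normF)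
    show "0 < ?eta" using mu_pos by simp
  qed (use h_sc h_lip spmd mu_pos pistar_simplex pis_simplex in \<open>auto simp only: spmd_step_def\<close>)
  then show ?thesis by (simp only: eq)
qed

lemma regret_state:
  "(\<Sum>t<n. Qtil t w q \<bullet> (pis t w q - pistar q) + h q (pis t w q) - h q (pistar q))
     + mu * (real n + 1) * D (pistar q) (pis n w q)
   \<le> mu * Dbar0 + (\<Sum>t<n. ((qnorm t w)\<^sup>2 + Mh\<^sup>2) / (mu * (real t + 2)))"
proof (induction n)
  case 0
  then show ?case using Dbar0 pistar mu_pos by (simp add: pis0 mult_left_mono)
next
  case (Suc n)
  then show ?case using step_bound[of n w q] by (simp add: algebra_simps)
qed

text \<open>The update sees only \<open>Qtil\<close>; exchanging it for \<open>Qf\<close>, as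
  \<open>performance_difference\<close> requires, costs exactly \<open>noise\<close>. The weights
  belong to \<open>pistar\<close> and so are the same for all \<open>t\<close>, which preserves the
  telescoping.\<close>

lemma regret:
  "(\<Sum>t<n. (1 - gamma) * (V (pis t w) s - V pistar s)) + mu * (real n + 1) * mean_div n s w
   \<le> mu * Dbar0 + (\<Sum>t<n. ((qnorm t w)\<^sup>2 + Mh\<^sup>2) / (mu * (real t + 2))) + (\<Sum>t<n. noise t s w)"
proof -
  let ?G = "\<lambda>t q. Qtil t w q \<bullet> (pis t w q - pistar q) + h q (pis t w q) - h q (pistar q)"
  let ?R = "mu * Dbar0 + (\<Sum>t<n. ((qnorm t w)\<^sup>2 + Mh\<^sup>2) / (mu * (real t + 2)))"
  have 1: "(\<Sum>q\<in>UNIV. \<kappa> pistar s q * ?G t q) = (1 - gamma) * (V (pis t w) s - V pistar s) - noise t s w" for t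
    unfolding performance_difference[OF pis_policy pistar(1)] noise_def
    by (simp add: inner_diff_left right_diff_distrib distrib_left sum_subtractf sum.distrib)
  have "(\<Sum>q\<in>UNIV. \<kappa> pistar s q * ((\<Sum>t<n. ?G t q) + mu * (real n + 1) * D (pistar q) (pis n w q)))
      \<le> (\<Sum>q\<in>UNIV. \<kappa> pistar s q * ?R)"
    by (intro sum_mono mult_left_mono kappa_nonneg regret_state)
  also have "\<dots> = ?R" by (simp only: kappa_sum flip: sum_distrib_right) simp
  also have "(\<Sum>q\<in>UNIV. \<kappa> pistar s q * ((\<Sum>t<n. ?G t q) + mu * (real n + 1) * D (pistar q) (pis n w q)))
     = (\<Sum>q\<in>UNIV. \<Sum>t<n. \<kappa> pistar s q * ?G t q) + mu * (real n + 1) * mean_div n s w"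
    unfolding mean_div_def by (simp only: distrib_left sum.distrib sum_distrib_left) (simp only: mult_ac)
  also have "(\<Sum>q\<in>UNIV. \<Sum>t<n. \<kappa> pistar s q * ?G t q) = (\<Sum>t<n. (1 - gamma) * (V (pis t w) s - V pistar s) - noise t s w)"
    by (subst sum.swap) (simp only: 1)
  finally show ?thesis by (simp only: sum_subtractf)
qed

lemma gap_nonneg: "0 \<le> (1 - gamma) * (V (pis t w) s - V pistar s)"
  using pistar(2) pis_policy gamma by (intro mult_nonneg_nonneg) auto

section \<open>Conditional moments of the estimates under Assumption B\<close>

context
  fixes vsig sig Qbar :: real
  assumes B: "assumption_B M X xi nrm Qf pis Qtil vsig sig Qbar"
begin

lemma vsig_nonneg: "0 \<le> vsig" and sig_nonneg: "0 \<le> sig" and Qbar_nonneg: "0 \<le> Qbar"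
  using B by (auto simp: assumption_B_def)

lemma psi2_qerr: "psi2_bounded M (F t) sig (qerr t)"
  by (rule psi2_boundedI[OF prob_space_axioms sub filtration_measurable[OF qerr_measurable]])
    (use B in \<open>simp add: assumption_B_def qerr_def\<close>)

lemma psi2_qnorm: "psi2_bounded M (F t) Qbar (qnorm t)"
  by (rule psi2_boundedI[OF prob_space_axioms sub filtration_measurable[OF qnorm_measurable]])
    (use B in \<open>simp add: assumption_B_def qnorm_def\<close>)

text \<open>The factor 2 bounds the coordinate weights used in \<open>mean_noise\<close>, and
  \<open>2 * x \<le> 1 + x^2\<close> reduces integrability to the second moment.\<close>

lemma integrable_mult_Qtil:
  assumes Z: "Z \<in> borel_measurable (F t)" "\<And>w. 0 \<le> Z w" "integrable M Z"
    and f: "f \<in> borel_measurable M" "\<And>w. \<bar>f w\<bar> \<le> 2 * qnorm t w"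
  shows "integrable M (\<lambda>w. Z w * f w)"
proof (rule Bochner_Integration.integrable_bound)
  have [measurable]: "Z \<in> borel_measurable M" by (rule filtration_measurable[OF Z(1)])
  show "integrable M (\<lambda>w. Z w + Z w * (qnorm t w)\<^sup>2)"
    using psi2_bounded_square(1)[OF prob_space_axioms psi2_qnorm sub Z] Z by simp
  show "(\<lambda>w. Z w * f w) \<in> borel_measurable M" using f(1) by measurable
  show "AE w in M. norm (Z w * f w) \<le> norm (Z w + Z w * (qnorm t w)\<^sup>2)"
  proof (rule AE_I2)
    fix w
    have "2 * qnorm t w \<le> 1 + (qnorm t w)\<^sup>2"
      using zero_le_power2[of "qnorm t w - 1"] by (simp add: power2_eq_square algebra_simps)
    then have "Z w * \<bar>f w\<bar> \<le> Z w * (1 + (qnorm t w)\<^sup>2)"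
      using f(2)[of w] Z(2)[of w] by (intro mult_left_mono) auto
    then show "norm (Z w * f w) \<le> norm (Z w + Z w * (qnorm t w)\<^sup>2)"
      using Z(2)[of w] by (simp add: abs_mult algebra_simps)
  qed
qed

lemma integrable_mult_noise:
  assumes Z: "Z \<in> borel_measurable (F t)" "\<And>w. 0 \<le> Z w" "integrable M Z"
  shows "integrable M (\<lambda>w. Z w * noise t s w)"
proof (rule Bochner_Integration.integrable_bound)
  have [measurable]: "Z \<in> borel_measurable M" by (rule filtration_measurable[OF Z(1)])
  have [measurable]: "noise t s \<in> borel_measurable M" by (rule filtration_measurable[OF noise_measurable])
  show "integrable M (\<lambda>w. Z w + Z w * (qerr t w)\<^sup>2)"
    using psi2_bounded_square(1)[OF prob_space_axioms psi2_qerr sub Z] Z by simp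
  show "(\<lambda>w. Z w * noise t s w) \<in> borel_measurable M" by measurable
  show "AE w in M. norm (Z w * noise t s w) \<le> norm (Z w + Z w * (qerr t w)\<^sup>2)"
  proof (rule AE_I2)
    fix w
    have "\<bar>noise t s w\<bar> \<le> 2 * qerr t w"
      using noise_le[of t s w] mult_right_mono[OF mean_dist_le_2 qerr_nonneg, of t s w t w] by linarith
    also have "\<dots> \<le> 1 + (qerr t w)\<^sup>2"
      using zero_le_power2[of "qerr t w - 1"] by (simp add: power2_eq_square algebra_simps)
    finally have "Z w * \<bar>noise t s w\<bar> \<le> Z w * (1 + (qerr t w)\<^sup>2)"
      using Z(2)[of w] by (intro mult_left_mono)
    then show "norm (Z w * noise t s w) \<le> norm (Z w + Z w * (qerr t w)\<^sup>2)"
      using Z(2)[of w] by (simp add: abs_mult algebra_simps)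
  qed
qed

text \<open>The weights of the coordinates of \<open>Qtil\<close> are \<open>F t\<close>-measurable,
  so each coordinate may be replaced by its conditional expectation. What remains is the bias,
  paired with \<open>pis t - pistar\<close> by duality.\<close>

lemma mean_noise:
  assumes Z: "Z \<in> borel_measurable (F t)" "\<And>w. 0 \<le> Z w" "integrable M Z"
  shows "(\<integral>w. Z w * noise t s w \<partial>M) \<le> vsig * (\<integral>w. Z w * mean_dist t s w \<partial>M)"
proof -
  interpret sf: finite_measure_subalgebra M "F t" by standard (rule sub)
  define E where "E q a = real_cond_exp M (F t) (\<lambda>w. Qtil t w q $ a)" for q a
  define u where "u q a w = \<kappa> pistar s q * (pis t w q - pistar q) $ a" for q a w
  let ?Ev = "\<lambda>w q. (\<chi> a. E q a w)"
  have [measurable]: "Z \<in> borel_measurable (F t)" "Z \<in> borel_measurable M"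
    using Z(1) by (auto intro: filtration_measurable)
  have um [measurable]: "u q a \<in> borel_measurable (F t)" for q a
    unfolding u_def[abs_def] by (intro borel_measurable_times borel_measurable_const borel_measurable_cartD
      borel_measurable_diff pis_measurable)
  have Qm [measurable]: "(\<lambda>w. Qtil t w q $ a) \<in> borel_measurable M" for q a
    by (rule filtration_measurable[OF borel_measurable_cartD[OF Qtil_meas[rule_format]]])
  have ub: "\<bar>u q a w\<bar> \<le> 2" for q a w
  proof -
    have "\<bar>(pis t w q - pistar q) $ a\<bar> \<le> 2"
    proof -
      have "p $ a \<le> 1 \<and> 0 \<le> p $ a" if "p \<in> prob_simplex" for p :: "real^'a"
        using member_le_sum[of a UNIV "\<lambda>a. p $ a"] prob_simplex_sum[OF that] prob_simplex_nonneg[OF that] by auto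
      from this[OF pis_simplex[of t w q]] this[OF pistar_simplex[of q]]
      show ?thesis by (simp add: abs_le_iff)
    qed
    moreover have "\<kappa> pistar s q \<le> 1"
      using member_le_sum[of q UNIV "\<lambda>q. \<kappa> pistar s q"] kappa_sum kappa_nonneg by auto
    ultimately have "\<kappa> pistar s q * \<bar>(pis t w q - pistar q) $ a\<bar> \<le> 1 * 2"
      by (intro mult_mono) auto
    then show ?thesis unfolding u_def using kappa_nonneg[of s q] by (simp add: abs_mult)
  qed
  have I: "integrable M (\<lambda>w. Z w * u q a w * (Qtil t w q $ a))" for q a
  proof -
    have [measurable]: "u q a \<in> borel_measurable M" by (rule filtration_measurable[OF um])
    have "integrable M (\<lambda>w. Z w * (u q a w * (Qtil t w q $ a)))"
    proof (rule integrable_mult_Qtil[OF Z])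
      fix w
      have "\<bar>Qtil t w q $ a\<bar> \<le> qnorm t w"
        using dual_norm_component[OF nrm nrm_le_1, of "Qtil t w q" a] dual_norm_le_dual_normF[of nrm "Qtil t w" q]
        unfolding qnorm_def by linarith
      then show "\<bar>u q a w * (Qtil t w q $ a)\<bar> \<le> 2 * qnorm t w"
        unfolding abs_mult using ub by (intro mult_mono) auto
    qed measurable
    then show ?thesis by (simp only: mult.assoc)
  qed
  have CE: "integrable M (\<lambda>w. Z w * u q a w * E q a w)"
    "(\<integral>w. Z w * u q a w * E q a w \<partial>M) = (\<integral>w. Z w * u q a w * (Qtil t w q $ a) \<partial>M)" for q a
    unfolding E_def by (rule sf.real_cond_exp_intg[OF I]; measurable)+
  \<comment> \<open>This is the part with the exact \<open>Qf\<close> (see \<open>RZ\<close>),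
    written as a sum of terms already known to be integrable so that it inherits their
    integrability.\<close>
  define R where "R w = Z w * noise t s w + (\<Sum>q\<in>UNIV. \<Sum>a\<in>UNIV. Z w * u q a w * (Qtil t w q $ a))" for w
  have RZ: "R w = Z w * (\<Sum>q\<in>UNIV. \<kappa> pistar s q * (Qf (pis t w) q \<bullet> (pis t w q - pistar q)))" for w
  proof -
    have "(\<Sum>q\<in>UNIV. \<Sum>a\<in>UNIV. Z w * u q a w * (Qtil t w q $ a))
       = Z w * (\<Sum>q\<in>UNIV. \<kappa> pistar s q * (Qtil t w q \<bullet> (pis t w q - pistar q)))"
      unfolding u_def inner_vec_def sum_distrib_left by (intro sum.cong refl) (simp add: mult_ac)
    then show ?thesis unfolding R_def noise_def
      by (simp add: inner_diff_left right_diff_distrib sum_subtractf)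
  qed
  have RE: "R w - (\<Sum>q\<in>UNIV. \<Sum>a\<in>UNIV. Z w * u q a w * E q a w)
      = Z w * (\<Sum>q\<in>UNIV. \<kappa> pistar s q * ((Qf (pis t w) q - ?Ev w q) \<bullet> (pis t w q - pistar q)))" for w
  proof -
    have "(\<Sum>q\<in>UNIV. \<Sum>a\<in>UNIV. Z w * u q a w * E q a w)
       = Z w * (\<Sum>q\<in>UNIV. \<kappa> pistar s q * (?Ev w q \<bullet> (pis t w q - pistar q)))"
      unfolding u_def inner_vec_def sum_distrib_left by (intro sum.cong refl) (simp add: mult_ac)
    then show ?thesis unfolding RZ
      by (simp add: inner_diff_left right_diff_distrib sum_subtractf)
  qed
  have IR: "integrable M R"
    unfolding R_def[abs_def] using integrable_mult_noise[OF Z] I by (intro Bochner_Integration.integrable_add Bochner_Integration.integrable_sum)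
  have IE: "integrable M (\<lambda>w. \<Sum>q\<in>UNIV. \<Sum>a\<in>UNIV. Z w * u q a w * E q a w)"
    by (intro Bochner_Integration.integrable_sum CE)
  have "(\<integral>w. Z w * noise t s w \<partial>M) = (\<integral>w. R w - (\<Sum>q\<in>UNIV. \<Sum>a\<in>UNIV. Z w * u q a w * (Qtil t w q $ a)) \<partial>M)"
    unfolding R_def by simp
  also have "\<dots> = (\<integral>w. R w \<partial>M) - (\<Sum>q\<in>UNIV. \<Sum>a\<in>UNIV. (\<integral>w. Z w * u q a w * (Qtil t w q $ a) \<partial>M))"
    using IR I by (subst Bochner_Integration.integral_diff)
      (auto intro!: Bochner_Integration.integrable_sum simp: Bochner_Integration.integral_sum)
  also have "\<dots> = (\<integral>w. R w \<partial>M) - (\<integral>w. (\<Sum>q\<in>UNIV. \<Sum>a\<in>UNIV. Z w * u q a w * E q a w) \<partial>M)"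
    using CE by (simp add: Bochner_Integration.integral_sum)
  also have "\<dots> = (\<integral>w. R w - (\<Sum>q\<in>UNIV. \<Sum>a\<in>UNIV. Z w * u q a w * E q a w) \<partial>M)"
    by (rule Bochner_Integration.integral_diff[symmetric, OF IR IE])
  also have "\<dots> \<le> (\<integral>w. vsig * (Z w * mean_dist t s w) \<partial>M)"
  proof (rule integral_mono_AE)
    show "integrable M (\<lambda>w. R w - (\<Sum>q\<in>UNIV. \<Sum>a\<in>UNIV. Z w * u q a w * E q a w))"
      by (intro Bochner_Integration.integrable_diff IR IE)
    have "integrable M (\<lambda>w. Z w * mean_dist t s w)"
    proof (rule integrable_dominated_nonneg[where g = "\<lambda>w. 2 * Z w"])
      show "(\<lambda>w. Z w * mean_dist t s w) \<in> borel_measurable M"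
        using filtration_measurable[OF mean_dist_measurable] by measurable
      show "0 \<le> Z w * mean_dist t s w" "Z w * mean_dist t s w \<le> 2 * Z w" for w
        using Z(2)[of w] mean_dist_nonneg[of t s w] mult_left_mono[OF mean_dist_le_2[of t s w] Z(2)[of w]] by simp_all
      show "integrable M (\<lambda>w. 2 * Z w)" using Z(3) by simp
    qed
    then show "integrable M (\<lambda>w. vsig * (Z w * mean_dist t s w))" by simp
    have "AE w in M. dual_normF nrm (\<lambda>q. ?Ev w q - Qf (pis t w) q) \<le> vsig"
      using B unfolding assumption_B_def E_def by blast
    then show "AE w in M. R w - (\<Sum>q\<in>UNIV. \<Sum>a\<in>UNIV. Z w * u q a w * E q a w) \<le> vsig * (Z w * mean_dist t s w)"
    proof eventually_elim
      case (elim w)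
      have "(\<Sum>q\<in>UNIV. \<kappa> pistar s q * ((Qf (pis t w) q - ?Ev w q) \<bullet> (pis t w q - pistar q)))
          \<le> (\<Sum>q\<in>UNIV. \<kappa> pistar s q * (vsig * nrm (pis t w q - pistar q)))"
      proof (intro sum_mono mult_left_mono kappa_nonneg)
        fix q
        have "(Qf (pis t w) q - ?Ev w q) \<bullet> (pis t w q - pistar q)
            \<le> \<bar>(?Ev w q - Qf (pis t w) q) \<bullet> (pis t w q - pistar q)\<bar>"
          by (simp add: inner_diff_left)
        also have "\<dots> \<le> dual_norm nrm (?Ev w q - Qf (pis t w) q) * nrm (pis t w q - pistar q)"
          by (rule dual_norm_abs_holder[OF nrm])
        also have "\<dots> \<le> vsig * nrm (pis t w q - pistar q)"
          using dual_norm_le_dual_normF[where F = "\<lambda>q. ?Ev w q - Qf (pis t w) q" and s = q and nrm = nrm] elim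
          by (intro mult_right_mono is_normD(1)[OF nrm]) linarith
        finally show "(Qf (pis t w) q - ?Ev w q) \<bullet> (pis t w q - pistar q) \<le> vsig * nrm (pis t w q - pistar q)" .
      qed
      also have "\<dots> = vsig * mean_dist t s w" unfolding mean_dist_def by (simp add: sum_distrib_left mult_ac)
      finally have "Z w * (\<Sum>q\<in>UNIV. \<kappa> pistar s q * ((Qf (pis t w) q - ?Ev w q) \<bullet> (pis t w q - pistar q)))
          \<le> Z w * (vsig * mean_dist t s w)" by (intro mult_left_mono Z)
      then show ?case unfolding RE by (simp add: mult_ac)
    qed
  qed
  finally show ?thesis by simp
qed

section \<open>The bound in expectation\<close>

lemma integrable_gap: "integrable M (\<lambda>w. V (pis t w) s - V pistar s)"
proof -
  obtain Bh where "\<And>s p. p \<in> prob_simplex \<Longrightarrow> \<bar>h s p\<bar> \<le> Bh" using h_bound by blast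
  then obtain K where K: "\<And>pol s. is_policy pol \<Longrightarrow> \<bar>V pol s\<bar> \<le> K" using value_fn_bound by blast
  have "integrable M (\<lambda>w. V (pis t w) s)"
    using K[OF pis_policy] filtration_measurable[OF value_measurable]
    by (intro integrable_const_bound[of _ K]) auto
  then show ?thesis by simp
qed

lemma one_test_function:
  "(\<lambda>_. 1 :: real) \<in> borel_measurable (F t)" "\<And>w :: 'm. 0 \<le> (1 :: real)" "integrable M (\<lambda>_. 1 :: real)"
  by simp_all

lemma integrable_qnorm: "integrable M (\<lambda>w. (qnorm t w)\<^sup>2)"
  using psi2_bounded_square(1)[OF prob_space_axioms psi2_qnorm[of t] sub one_test_function] by simp

lemma integral_qnorm: "(\<integral>w. (qnorm t w)\<^sup>2 \<partial>M) \<le> Qbar\<^sup>2"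
  using psi2_bounded_square(2)[OF prob_space_axioms psi2_qnorm[of t] sub one_test_function]
  by (simp add: prob_space)

lemma integrable_noise: "integrable M (noise t s)"
  using integrable_mult_noise[OF one_test_function, of t s] by simp

text \<open>The factor 2 bounds \<open>mean_dist\<close> and is the origin of the bias term
  \<open>2 * vsig * real k\<close>.\<close>

lemma integral_noise: "(\<integral>w. noise t s w \<partial>M) \<le> 2 * vsig"
proof -
  have "(\<integral>w. noise t s w \<partial>M) \<le> vsig * (\<integral>w. mean_dist t s w \<partial>M)"
    using mean_noise[OF one_test_function, of t s] by simp
  also have "\<dots> \<le> vsig * 2"
  proof (intro mult_left_mono integral_le_const vsig_nonneg)
    show "integrable M (mean_dist t s)"
    proof (rule integrable_const_bound[of _ 2])
      show "AE w in M. norm (mean_dist t s w) \<le> 2"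
        using mean_dist_nonneg[of t s] mean_dist_le_2[of t s] by (intro AE_I2) simp
    qed (rule filtration_measurable[OF mean_dist_measurable])
    show "AE w in M. mean_dist t s w \<le> 2" by (intro AE_I2 mean_dist_le_2)
  qed
  finally show ?thesis by simp
qed

text \<open>The hypotheses bound the divergence only from \<open>pi0\<close>. For later iterates
  integrability comes from the inequality \<open>regret\<close> itself, whose right-hand side is
  integrable, after dropping the nonnegative gaps.\<close>

lemma integrable_mean_div: "integrable M (mean_div n s)"
proof -
  let ?g = "\<lambda>w. (mu * Dbar0 + (\<Sum>t<n. ((qnorm t w)\<^sup>2 + Mh\<^sup>2) / (mu * (real t + 2))) + (\<Sum>t<n. noise t s w)) / (mu * (real n + 1))"
  show ?thesis
  proof (rule integrable_dominated_nonneg)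
    show "integrable M ?g"
      using integrable_qnorm integrable_noise by auto
    show "mean_div n s w \<le> ?g w" for w
    proof -
      have "mu * (real n + 1) * mean_div n s w \<le> mu * Dbar0 + (\<Sum>t<n. ((qnorm t w)\<^sup>2 + Mh\<^sup>2) / (mu * (real t + 2))) + (\<Sum>t<n. noise t s w)"
        using regret[where w = w and s = s and n = n]
          sum_nonneg[of "{..<n}" "\<lambda>t. (1 - gamma) * (V (pis t w) s - V pistar s)", OF gap_nonneg]
        by linarith
      then show ?thesis using mu_pos by (simp add: pos_le_divide_eq mult.commute)
    qed
    show "0 \<le> mean_div n s w" for w by (rule mean_div_nonneg)
    show "mean_div n s \<in> borel_measurable M" by (rule filtration_measurable[OF mean_div_measurable])
  qed
qed

text \<open>Only the weighted divergences are dominated by \<open>mean_div\<close>. Where the weight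
  is 0 this says nothing about the divergence, but the corresponding terms are 0 on both
  sides.\<close>

lemma integral_mean_div: "(\<Sum>q\<in>UNIV. \<kappa> pistar s q * (\<integral>w. D (pistar q) (pis n w q) \<partial>M)) = (\<integral>w. mean_div n s w \<partial>M)"
proof -
  have "integrable M (\<lambda>w. \<kappa> pistar s q * D (pistar q) (pis n w q))" for q
  proof (rule integrable_dominated_nonneg[OF integrable_mean_div])
    show "(\<lambda>w. \<kappa> pistar s q * D (pistar q) (pis n w q)) \<in> borel_measurable M"
      by (intro borel_measurable_times borel_measurable_const
          filtration_measurable[OF bregman_measurable[OF pis_measurable pis_simplex pistar_simplex]])
    show "\<kappa> pistar s q * D (pistar q) (pis n w q) \<le> mean_div n s w" for w
      unfolding mean_div_def
      by (rule member_le_sum[of q UNIV "\<lambda>q. \<kappa> pistar s q * D (pistar q) (pis n w q)"])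
        (simp_all add: kappa_nonneg D_nonneg)
    show "0 \<le> \<kappa> pistar s q * D (pistar q) (pis n w q)" for w
      by (intro mult_nonneg_nonneg kappa_nonneg D_nonneg)
  qed
  then show ?thesis unfolding mean_div_def by (simp add: Bochner_Integration.integral_sum)
qed

lemma expected_regret:
  assumes k: "1 \<le> k"
  shows "(1 / real k) * (\<Sum>t<k. (\<integral>w. V (pis t w) s - V pistar s \<partial>M))
     + mu / (1 - gamma) * (\<Sum>q\<in>UNIV. \<kappa> pistar s q * (\<integral>w. D (pistar q) (pis k w q) \<partial>M))
   \<le> (mu * Dbar0 + (1 / mu) * (Qbar\<^sup>2 + Mh\<^sup>2) * ln (2 * real k) + 2 * vsig * real k) / ((1 - gamma) * real k)"
proof -
  let ?gap = "\<Sum>t<k. (\<integral>w. V (pis t w) s - V pistar s \<partial>M)" and ?D = "\<integral>w. mean_div k s w \<partial>M"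
  have "(\<integral>w. (\<Sum>t<k. (1 - gamma) * (V (pis t w) s - V pistar s)) + mu * (real k + 1) * mean_div k s w \<partial>M)
      \<le> (\<integral>w. mu * Dbar0 + (\<Sum>t<k. ((qnorm t w)\<^sup>2 + Mh\<^sup>2) / (mu * (real t + 2))) + (\<Sum>t<k. noise t s w) \<partial>M)"
    using integrable_gap integrable_qnorm integrable_noise integrable_mean_div
    by (intro integral_mono regret Bochner_Integration.integrable_add Bochner_Integration.integrable_sum
        Bochner_Integration.integrable_divide_zero Bochner_Integration.integrable_mult_right) auto
  also have "(\<integral>w. (\<Sum>t<k. (1 - gamma) * (V (pis t w) s - V pistar s)) + mu * (real k + 1) * mean_div k s w \<partial>M)
      = (1 - gamma) * ?gap + mu * (real k + 1) * ?D"
    using integrable_gap integrable_mean_div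
    by (simp add: Bochner_Integration.integral_sum sum_distrib_left del: Bochner_Integration.integral_diff)
  also have "(\<integral>w. mu * Dbar0 + (\<Sum>t<k. ((qnorm t w)\<^sup>2 + Mh\<^sup>2) / (mu * (real t + 2))) + (\<Sum>t<k. noise t s w) \<partial>M)
      = mu * Dbar0 + (\<Sum>t<k. ((\<integral>w. (qnorm t w)\<^sup>2 \<partial>M) + Mh\<^sup>2) / (mu * (real t + 2))) + (\<Sum>t<k. (\<integral>w. noise t s w \<partial>M))"
    using integrable_qnorm integrable_noise by (simp add: Bochner_Integration.integral_sum prob_space)
  also have "\<dots> \<le> mu * Dbar0 + (\<Sum>t<k. (Qbar\<^sup>2 + Mh\<^sup>2) / (mu * (real t + 2))) + (\<Sum>t<k. 2 * vsig)"
    using integral_qnorm integral_noise mu_pos by (intro add_mono sum_mono divide_right_mono order_refl) auto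
  also have "(\<Sum>t<k. (Qbar\<^sup>2 + Mh\<^sup>2) / (mu * (real t + 2))) = (1 / mu) * (Qbar\<^sup>2 + Mh\<^sup>2) * (\<Sum>t<k. 1 / (real t + 2))"
    unfolding sum_distrib_left by (intro sum.cong) (auto simp: field_simps)
  also have "\<dots> \<le> (1 / mu) * (Qbar\<^sup>2 + Mh\<^sup>2) * ln (2 * real k)"
  proof (intro mult_left_mono)
    have "ln (real k + 1) \<le> ln (2 * real k)" using k by simp
    then show "(\<Sum>t<k. 1 / (real t + 2)) \<le> ln (2 * real k)" using sum_inverse_le_ln[of k] by linarith
  qed (use mu_pos in auto)
  also have "(\<Sum>t<k. 2 * vsig) = 2 * vsig * real k" by simp
  finally have main: "(1 - gamma) * ?gap + mu * (real k + 1) * ?D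
      \<le> mu * Dbar0 + (1 / mu) * (Qbar\<^sup>2 + Mh\<^sup>2) * ln (2 * real k) + 2 * vsig * real k" by simp
  have "0 \<le> mu * ?D" using mu_pos mean_div_nonneg by (intro mult_nonneg_nonneg Bochner_Integration.integral_nonneg less_imp_le[OF mu_pos])
  moreover have "0 < 1 - gamma" using gamma by simp
  ultimately show ?thesis unfolding integral_mean_div using main k by (intro average_bound)
qed

lemma high_probability_regret:
  assumes k: "1 \<le> k" and vs: "vsig \<le> sig / real k" and delta: "0 < delta" "delta \<le> 1"
  defines "L \<equiv> ln (4 * real k * real CARD('s) / delta)"
  defines "C \<equiv> 6 * Dbar0 / (1 - gamma) + 75 * (Qbar\<^sup>2 + Mh\<^sup>2) * L powr (3/2) / ((1 - gamma) * mu\<^sup>2)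
                 + 108 * sig\<^sup>2 * L ^ 3 / ((1 - gamma)\<^sup>2 * mu\<^sup>2)"
  shows "prob {w \<in> space M. \<exists>s.
      (1 / real k) * (\<Sum>t<k. V (pis t w) s - V pistar s)
        + mu / (1 - gamma) * (\<Sum>q\<in>UNIV. \<kappa> pistar s q * D (pistar q) (pis k w q))
      > (mu * Dbar0 + (25 * (1 / mu) * (Qbar\<^sup>2 + Mh\<^sup>2) + 2 * sig * sqrt (3 * C)) * L powr (3/2)) / ((1 - gamma) * real k)}
    \<le> (real k + 1) * delta"
proof -
  \<comment> \<open>\<open>al t\<close> is the bound on \<open>mean_dist\<close> that holds while
    the divergence is at most \<open>C / (t + 1)\<close>; \<open>A\<close> is its maximum, attained
    at \<open>t = 0\<close>.\<close>
  define A where "A = sqrt (2 * C)"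
  define al where "al t = sqrt (2 * C / (real t + 1))" for t :: nat
  \<comment> \<open>There is one noise event per state and horizon; together they cost a single
    \<open>delta\<close>.\<close>
  define d where "d = delta / (real k * real CARD('s))"
  have S1: "1 \<le> real CARD('s)" using zero_less_card_finite[where 'a = 's] by linarith
  have kS: "1 \<le> real k * real CARD('s)" using k S1 mult_mono[of 1 "real k" 1 "real CARD('s)"] by simp
  have d: "0 < d" "d \<le> 1" unfolding d_def using delta kS by (auto simp: field_simps)
  have ln4: "1 \<le> ln (4 :: real)"
    using exp_le ln_mono[of "exp 1" "4::real"] by simp
  have Lsplit: "L = ln 4 + ln (real k) + ln (real CARD('s)) + ln (1 / delta)"
    unfolding L_def using k S1 delta by (simp add: ln_mult ln_div)
  have Ld: "ln (1 / d) = L - ln 4"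
    unfolding Lsplit d_def using k S1 delta by (simp add: ln_mult ln_div)
  have lns: "0 \<le> ln (real k)" "0 \<le> ln (real CARD('s))" "0 \<le> ln (1 / delta)"
    using k S1 delta by (auto simp: ln_div)
  have L1: "1 \<le> L" using Lsplit ln4 lns by linarith
  have bounds: "0 < C" "mu * Dbar0 + (1 / mu) * (Qbar\<^sup>2 + Mh\<^sup>2) * L + 2 * L * sig * sqrt (2 * C) \<le> mu * C"
    "mu * Dbar0 + (1 / mu) * (Qbar\<^sup>2 + Mh\<^sup>2) * L + 2 * L * sig * sqrt (2 * C)
      \<le> mu * Dbar0 + (25 * (1 / mu) * (Qbar\<^sup>2 + Mh\<^sup>2) + 2 * sig * sqrt (3 * C)) * L powr (3/2)"
    unfolding C_def
    using bootstrap_constant[of mu "1 - gamma" Dbar0 "Qbar\<^sup>2 + Mh\<^sup>2" sig L] mu_pos gamma Dbar0 sig_nonneg L1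
    by (auto simp: add_nonneg_nonneg)
  have A: "0 < A" "A\<^sup>2 = 2 * C" unfolding A_def using bounds(1) by auto
  have al: "0 \<le> al t" "al t \<le> A" "(al t)\<^sup>2 = A\<^sup>2 * (1 / (real t + 1))" for t
  proof -
    show "0 \<le> al t" unfolding al_def using bounds(1) by simp
    have "2 * C / (real t + 1) \<le> 2 * C / 1" using bounds(1) by (intro divide_left_mono) auto
    then show "al t \<le> A" unfolding al_def A_def by (intro real_sqrt_le_mono) simp
    show "(al t)\<^sup>2 = A\<^sup>2 * (1 / (real t + 1))" unfolding A(2) al_def using bounds(1) by simp
  qed
  define ok where "ok t s w \<longleftrightarrow> mean_div t s w \<le> C / (real t + 1)" for t s w
  \<comment> \<open>Whether \<open>ok t s\<close> holds is decided by \<open>F t\<close>. Each term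
    is cut on its own, without a stopping time.\<close>
  define truncated where "truncated s t w = (if ok t s w then noise t s w else 0)" for s t w
  define bd where "bd n = vsig * (\<Sum>t<n. al t) + sig / A * (\<Sum>t<n. (al t)\<^sup>2) + sig * A * ln (1 / d)" for n :: nat
  define Ex where "Ex = {w \<in> space M. (\<Sum>t<k. 1 / (real t + 2) * (qnorm t w)\<^sup>2) > Qbar\<^sup>2 * ((\<Sum>t<k. 1 / (real t + 2)) + ln (1 / delta))}"
  \<comment> \<open>Every horizon \<open>n\<close> gets its own event, because the induction below
    uses the partial sums at all times up to \<open>k\<close>.\<close>
  define En where "En s n = {w \<in> space M. (\<Sum>t<n. truncated s t w) > bd n}" for s n

  have mean_dist_al: "mean_dist t s w \<le> al t" if "ok t s w" for t s w
  proof -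
    have "2 * mean_div t s w \<le> 2 * C / (real t + 1)" using that unfolding ok_def by simp
    then show ?thesis unfolding al_def using mean_dist_le_sqrt[of t s w] real_sqrt_le_mono by (meson order_trans)
  qed
  have ok_meas: "{w \<in> space M. ok t s w} \<in> sets (F t)" for t s
    unfolding ok_def using mean_div_measurable[of t s]
    by (subst space_hist_alg[of M X xi t, symmetric], intro borel_measurable_le) auto
  have truncated_eq: "truncated s t w = indicator {w \<in> space M. ok t s w} w * noise t s w" if "w \<in> space M" for s t w
    using that by (simp add: truncated_def)
  have truncated_meas: "truncated s t \<in> borel_measurable (F (Suc t))" for s t
  proof -
    have "(\<lambda>w. indicator {w \<in> space M. ok t s w} w * noise t s w) \<in> borel_measurable (F (Suc t))"
      by (intro borel_measurable_times noise_measurable filtration_mono[of t "Suc t"] borel_measurable_indicator ok_meas) simp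
    then show ?thesis by (subst measurable_cong[OF truncated_eq]) auto
  qed

  have prob_Ex: "prob Ex \<le> delta"
    unfolding Ex_def
    by (rule weighted_square_tail) (use qnorm_measurable psi2_qnorm Qbar_nonneg delta in \<open>auto simp: divide_simps\<close>)
  have prob_En: "prob (En s n) \<le> d" for s n
    unfolding En_def bd_def
  proof (rule subgaussian_tail[where e = qerr])
    fix t assume "t < n"
    show "truncated s t \<in> borel_measurable (F (Suc t))" by (rule truncated_meas)
    show "psi2_bounded M (F t) sig (qerr t)" by (rule psi2_qerr)
    show "0 \<le> al t" "al t \<le> A" by (rule al)+
    show "\<bar>truncated s t w\<bar> \<le> al t * qerr t w" for w
    proof (cases "ok t s w")
      case True
      have "\<bar>noise t s w\<bar> \<le> mean_dist t s w * qerr t w" by (rule noise_le)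
      also have "\<dots> \<le> al t * qerr t w" by (intro mult_right_mono mean_dist_al True qerr_nonneg)
      finally show ?thesis using True by (simp add: truncated_def)
    next
      case False
      then show ?thesis using al(1)[of t] qerr_nonneg[of t w] by (simp add: truncated_def)
    qed
    fix Z :: "'m \<Rightarrow> real" assume Z: "Z \<in> borel_measurable (F t)" "\<And>w. 0 \<le> Z w" "integrable M Z"
    \<comment> \<open>The truncation is moved from the noise into the test function, so that
      \<open>mean_noise\<close> applies to it.\<close>
    define Z' where "Z' w = Z w * indicator {w \<in> space M. ok t s w} w" for w
    have Z': "Z' \<in> borel_measurable (F t)" "\<And>w. 0 \<le> Z' w" "integrable M Z'"
    proof -
      show 1: "Z' \<in> borel_measurable (F t)"
        unfolding Z'_def by (intro borel_measurable_times Z borel_measurable_indicator ok_meas)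
      show 2: "0 \<le> Z' w" for w unfolding Z'_def using Z(2) by simp
      show "integrable M Z'"
        by (rule integrable_dominated_nonneg[OF Z(3) filtration_measurable[OF 1] 2])
          (use Z(2) in \<open>simp add: Z'_def indicator_def\<close>)
    qed
    have eq: "Z w * truncated s t w = Z' w * noise t s w" if "w \<in> space M" for w
      using truncated_eq[OF that, of s t] by (simp add: Z'_def)
    have I: "integrable M (\<lambda>w. Z' w * noise t s w)" by (rule integrable_mult_noise[OF Z'])
    have "(\<integral>w. Z' w * noise t s w \<partial>M) \<le> vsig * (\<integral>w. Z' w * mean_dist t s w \<partial>M)" by (rule mean_noise[OF Z'])
    also have "\<dots> \<le> vsig * (\<integral>w. al t * Z w \<partial>M)"
    proof (intro mult_left_mono vsig_nonneg integral_mono)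
      show le: "Z' w * mean_dist t s w \<le> al t * Z w" for w
        using Z(2)[of w] al(1)[of t] mean_dist_al[of t s w] mult_left_mono[of "mean_dist t s w" "al t" "Z w"]
        by (auto simp: Z'_def indicator_def mult.commute)
      show I': "integrable M (\<lambda>w. al t * Z w)" using Z(3) by simp
      show "integrable M (\<lambda>w. Z' w * mean_dist t s w)"
        by (rule integrable_dominated_nonneg[OF I' _ _ le])
          (auto intro!: mult_nonneg_nonneg Z' mean_dist_nonneg borel_measurable_times filtration_measurable[OF Z'(1)]
             filtration_measurable[OF mean_dist_measurable])
    qed
    finally have le: "(\<integral>w. Z' w * noise t s w \<partial>M) \<le> vsig * al t * (\<integral>w. Z w \<partial>M)" by simp
    have "integrable M (\<lambda>w. Z w * truncated s t w)"
      by (subst Bochner_Integration.integrable_cong[OF refl eq]) (auto intro: I)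
    moreover have "(\<integral>w. Z w * truncated s t w \<partial>M) = (\<integral>w. Z' w * noise t s w \<partial>M)"
      by (rule Bochner_Integration.integral_cong[OF refl eq])
    ultimately show "integrable M (\<lambda>w. Z w * truncated s t w) \<and> (\<integral>w. Z w * truncated s t w \<partial>M) \<le> vsig * al t * (\<integral>w. Z w \<partial>M)"
      using le by simp
  next
    show "0 \<le> sig" "0 < A" "0 \<le> vsig" "0 < d" "d \<le> 1" by (rule sig_nonneg A vsig_nonneg d)+
  qed

  have bd_le: "bd n \<le> 2 * L * sig * A" if n: "n \<le> k" "1 \<le> n" for n
  proof -
    \<comment> \<open>Because \<open>vsig \<le> sig / k\<close>, the bias accumulated over all steps
      costs at most one unit \<open>sig * A\<close>.\<close>
    have "vsig * (\<Sum>t<n. al t) \<le> sig / real k * (real k * A)"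
    proof (intro mult_mono vs)
      have "(\<Sum>t<n. al t) \<le> (\<Sum>t<n. A)" by (intro sum_mono al)
      also have "\<dots> \<le> real k * A" using n A by (simp add: mult_right_mono)
      finally show "(\<Sum>t<n. al t) \<le> real k * A" .
    qed (use sig_nonneg al in \<open>auto intro!: sum_nonneg\<close>)
    then have 1: "vsig * (\<Sum>t<n. al t) \<le> sig * A" using k by simp
    have "ln (real n) \<le> ln (real k)" using n by simp
    then have "(\<Sum>t<n. 1 / (real t + 1)) \<le> 1 + ln (real k)" using harmonic_le_ln[OF n(2)] by linarith
    then have "sig * A * (\<Sum>t<n. 1 / (real t + 1)) \<le> sig * A * (1 + ln (real k))"
      using sig_nonneg A by (intro mult_left_mono) auto
    moreover have "sig / A * (\<Sum>t<n. (al t)\<^sup>2) = sig * A * (\<Sum>t<n. 1 / (real t + 1))"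
      unfolding al(3) sum_distrib_left[symmetric] using A(1) by (simp add: power2_eq_square)
    ultimately have "bd n \<le> sig * A * (1 + (1 + ln (real k)) + ln (1 / d))"
      unfolding bd_def using 1 by (simp add: algebra_simps)
    also have "\<dots> \<le> sig * A * (2 * L)"
    proof (rule mult_left_mono)
      \<comment> \<open>The 4 inside the logarithm pays for the two units, bias and first harmonic
        term: \<open>ln 4 \<ge> 1\<close> is available once in \<open>L\<close> and once in
        \<open>ln (1 / d) = L - ln 4\<close>.\<close>
      show "1 + (1 + ln (real k)) + ln (1 / d) \<le> 2 * L" using Ld Lsplit lns ln4 by linarith
    qed (use sig_nonneg A in simp)
    finally show ?thesis by (simp add: mult_ac)
  qed

  have good: "(1 - gamma) * (\<Sum>t<k. V (pis t w) s - V pistar s) + mu * (real k + 1) * mean_div k s w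
      \<le> mu * Dbar0 + (1 / mu) * (Qbar\<^sup>2 + Mh\<^sup>2) * L + 2 * L * sig * sqrt (2 * C)"
    if w: "w \<in> space M" "w \<notin> Ex" "\<And>n. n \<in> {1..k} \<Longrightarrow> w \<notin> En s n" for w s
  proof -
    let ?R = "mu * Dbar0 + (1 / mu) * (Qbar\<^sup>2 + Mh\<^sup>2) * L"
    \<comment> \<open>The single event \<open>Ex\<close> serves all horizons because the summands
      are nonnegative.\<close>
    have xs: "(\<Sum>t<n. ((qnorm t w)\<^sup>2 + Mh\<^sup>2) / (mu * (real t + 2))) \<le> (1 / mu) * (Qbar\<^sup>2 + Mh\<^sup>2) * L" if "n \<le> k" for n
    proof -
      have "(\<Sum>t<n. ((qnorm t w)\<^sup>2 + Mh\<^sup>2) / (mu * (real t + 2))) \<le> (\<Sum>t<k. ((qnorm t w)\<^sup>2 + Mh\<^sup>2) / (mu * (real t + 2)))"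
        using that mu_pos by (intro sum_mono2) auto
      also have "\<dots> = (1 / mu) * ((\<Sum>t<k. 1 / (real t + 2) * (qnorm t w)\<^sup>2) + Mh\<^sup>2 * (\<Sum>t<k. 1 / (real t + 2)))"
        unfolding sum_distrib_left sum.distrib[symmetric] by (intro sum.cong) (simp_all add: add_divide_distrib mult.commute)
      also have "\<dots> \<le> (1 / mu) * (Qbar\<^sup>2 * L + Mh\<^sup>2 * L)"
      proof (intro mult_left_mono add_mono)
        have "ln (real k + 1) \<le> ln (2 * real k)" using k by simp
        also have "\<dots> \<le> ln 4 + ln (real k)" using k by (simp add: ln_mult)
        finally have H: "(\<Sum>t<k. 1 / (real t + 2)) \<le> ln 4 + ln (real k)" using sum_inverse_le_ln[of k] by linarith
        show "(\<Sum>t<k. 1 / (real t + 2)) \<le> L" using H Lsplit lns by linarith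
        have "(\<Sum>t<k. 1 / (real t + 2) * (qnorm t w)\<^sup>2) \<le> Qbar\<^sup>2 * ((\<Sum>t<k. 1 / (real t + 2)) + ln (1 / delta))"
          using w unfolding Ex_def by auto
        also have "\<dots> \<le> Qbar\<^sup>2 * L"
          by (intro mult_left_mono zero_le_power2) (use H Lsplit lns in linarith)
        finally show "(\<Sum>t<k. 1 / (real t + 2) * (qnorm t w)\<^sup>2) \<le> Qbar\<^sup>2 * L" .
      qed (use mu_pos in auto)
      finally show ?thesis by (simp add: algebra_simps)
    qed
    have noise_le: "(\<Sum>t<n. noise t s w) \<le> 2 * L * sig * A" if n: "n \<le> k" and ok: "\<And>t. t < n \<Longrightarrow> ok t s w" for n
    proof (cases "n = 0")
      \<comment> \<open>The empty sum has no event \<open>En\<close>; here the bound is just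
        nonnegativity of its right-hand side.\<close>
      case True
      then show ?thesis using L1 sig_nonneg A by simp
    next
      case False
      have "(\<Sum>t<n. noise t s w) = (\<Sum>t<n. truncated s t w)" using ok by (simp add: truncated_def)
      also have "\<dots> \<le> bd n" using w(1) w(3)[of n] n False unfolding En_def by auto
      also have "\<dots> \<le> 2 * L * sig * A" using n False by (intro bd_le) auto
      finally show ?thesis .
    qed
    have step: "(\<Sum>t<n. (1 - gamma) * (V (pis t w) s - V pistar s)) + mu * (real n + 1) * mean_div n s w \<le> ?R + 2 * L * sig * A"
      if n: "n \<le> k" and ok: "\<And>t. t < n \<Longrightarrow> ok t s w" for n
      using regret[where w = w and s = s and n = n] xs[OF n] noise_le[OF n ok] by linarith
    \<comment> \<open>Strong induction covers \<open>n = 0\<close> without a base case: the sums are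
      then empty and \<open>bounds(2)\<close> gives the initial divergence bound.\<close>
    have okn: "n \<le> k \<Longrightarrow> ok n s w" for n
    proof (induction n rule: less_induct)
      case (less n)
      have "(\<Sum>t<n. (1 - gamma) * (V (pis t w) s - V pistar s)) + mu * (real n + 1) * mean_div n s w \<le> ?R + 2 * L * sig * A"
        using less by (intro step) auto
      moreover have "0 \<le> (\<Sum>t<n. (1 - gamma) * (V (pis t w) s - V pistar s))" by (intro sum_nonneg gap_nonneg)
      ultimately have "mu * ((real n + 1) * mean_div n s w) \<le> mu * C"
        using bounds(2) unfolding A_def by (simp only: mult.assoc)
      then have "(real n + 1) * mean_div n s w \<le> C" using mu_pos by simp
      then show ?case unfolding ok_def by (simp add: pos_le_divide_eq mult.commute)
    qed
    show ?thesis using step[of k] okn unfolding A_def sum_distrib_left by simp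
  qed

  let ?Bad = "{w \<in> space M. \<exists>s.
      (1 / real k) * (\<Sum>t<k. V (pis t w) s - V pistar s)
        + mu / (1 - gamma) * (\<Sum>q\<in>UNIV. \<kappa> pistar s q * D (pistar q) (pis k w q))
      > (mu * Dbar0 + (25 * (1 / mu) * (Qbar\<^sup>2 + Mh\<^sup>2) + 2 * sig * sqrt (3 * C)) * L powr (3/2)) / ((1 - gamma) * real k)}"
  let ?U = "\<Union>p\<in>UNIV \<times> {1..k}. En (fst p) (snd p)"
  have "?Bad \<subseteq> Ex \<union> ?U"
  proof
    fix w assume "w \<in> ?Bad"
    then obtain s where w: "w \<in> space M" and s: "(1 / real k) * (\<Sum>t<k. V (pis t w) s - V pistar s)
        + mu / (1 - gamma) * mean_div k s w
      > (mu * Dbar0 + (25 * (1 / mu) * (Qbar\<^sup>2 + Mh\<^sup>2) + 2 * sig * sqrt (3 * C)) * L powr (3/2)) / ((1 - gamma) * real k)"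
      unfolding mean_div_def by blast
    show "w \<in> Ex \<union> ?U"
    proof (rule ccontr)
      assume "w \<notin> Ex \<union> ?U"
      then have "w \<notin> Ex" "\<And>n. n \<in> {1..k} \<Longrightarrow> w \<notin> En s n" by auto
      from good[OF w this] bounds(3)
      have "(1 - gamma) * (\<Sum>t<k. V (pis t w) s - V pistar s) + mu * (real k + 1) * mean_div k s w
        \<le> mu * Dbar0 + (25 * (1 / mu) * (Qbar\<^sup>2 + Mh\<^sup>2) + 2 * sig * sqrt (3 * C)) * L powr (3/2)" by linarith
      moreover have "0 < 1 - gamma" "0 \<le> mu * mean_div k s w" using gamma mu_pos mean_div_nonneg[of k s w] by simp_all
      ultimately have "(1 / real k) * (\<Sum>t<k. V (pis t w) s - V pistar s) + mu / (1 - gamma) * mean_div k s w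
        \<le> (mu * Dbar0 + (25 * (1 / mu) * (Qbar\<^sup>2 + Mh\<^sup>2) + 2 * sig * sqrt (3 * C)) * L powr (3/2)) / ((1 - gamma) * real k)"
        using k by (intro average_bound)
      with s show False by linarith
    qed
  qed
  moreover have Ex_sets: "Ex \<in> sets M"
    unfolding Ex_def using filtration_measurable[OF qnorm_measurable] by measurable
  moreover have En_sets: "En s n \<in> sets M" for s n
    unfolding En_def using filtration_measurable[OF truncated_meas] by measurable
  ultimately have "prob ?Bad \<le> prob (Ex \<union> ?U)" by (intro finite_measure_mono) auto
  also have "\<dots> \<le> prob Ex + prob ?U"
    using Ex_sets En_sets by (intro measure_Un_le) auto
  also have "prob ?U \<le> (\<Sum>p\<in>UNIV \<times> {1..k}. prob (En (fst p) (snd p)))"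
    using En_sets by (intro measure_UNION_le) auto
  also have "\<dots> \<le> (\<Sum>p\<in>(UNIV :: 's set) \<times> {1..k}. d)" by (intro sum_mono prob_En)
  also have "\<dots> = delta" unfolding d_def using k S1 by (simp add: card_cartesian_product)
  \<comment> \<open>Two contributions of \<open>delta\<close> fit into
    \<open>(k + 1) * delta\<close> since \<open>k \<ge> 1\<close>.\<close>
  also have "prob Ex + delta \<le> (real k + 1) * delta"
  proof -
    have "delta * 1 \<le> delta * real k" using k delta by (intro mult_left_mono) auto
    then show ?thesis using prob_Ex by (simp add: algebra_simps)
  qed
  finally show ?thesis by simp
qed

end

end

theorem theorem4p4:
  fixes P :: "'s::finite \<Rightarrow> 'a::finite \<Rightarrow> 's \<Rightarrow> real"
    and c :: "'s \<Rightarrow> 'a \<Rightarrow> real"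
    and gamma :: real
    and nrm :: "real^'a \<Rightarrow> real"
    and omega :: "real^'a \<Rightarrow> real"
    and gomega :: "real^'a \<Rightarrow> real^'a"
    and h :: "'s \<Rightarrow> real^'a \<Rightarrow> real"
    and hd :: "'s \<Rightarrow> real^'a \<Rightarrow> real^'a"
    and mu Mh :: real
    and M :: "'m measure"
    and X :: "'x measure"
    and xi :: "nat \<Rightarrow> 'm \<Rightarrow> 'x"
    and Qtil :: "nat \<Rightarrow> 'm \<Rightarrow> 's \<Rightarrow> real^'a"
    and pis :: "nat \<Rightarrow> 'm \<Rightarrow> 's \<Rightarrow> real^'a"
    and pi0 pistar :: "'s \<Rightarrow> real^'a"
    and Dbar0 vsig sig Qbar :: real
    and k :: nat
  assumes P_nonneg: "\<forall>s a s'. 0 \<le> P s a s'"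
    and P_sum: "\<forall>s a. (\<Sum>s'\<in>UNIV. P s a s') = 1"
    and gamma: "0 \<le> gamma" "gamma < 1"
    and nrm: "is_norm nrm" "\<forall>p\<in>prob_simplex. nrm p \<le> 1"
    and omega_diff: "\<forall>p\<in>prob_simplex. (omega has_derivative (\<lambda>v. gomega p \<bullet> v)) (at p within prob_simplex)"
    and omega_sc: "strongly_convex_wrt nrm 1 omega prob_simplex"
    and h_convex: "\<forall>s. convex_on prob_simplex (h s)"
    and h_closed: "\<forall>s. closed {z :: (real^'a) \<times> real. fst z \<in> prob_simplex \<and> h s (fst z) \<le> snd z}"
    and h_sc: "\<forall>s. \<forall>p\<in>prob_simplex. \<forall>p'\<in>prob_simplex.
                 h s p - h s p' - hd s p' \<bullet> (p - p') \<ge> mu * bregman omega gomega p p'"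
    and mu_pos: "mu > 0"
    and h_lip: "\<forall>s. \<forall>p\<in>prob_simplex. \<forall>p'\<in>prob_simplex. h s p - h s p' \<le> Mh * nrm (p - p')"
    and M: "prob_space M"
    and xi_meas: "\<forall>i. xi i \<in> measurable M X"
    and Qtil_meas: "\<forall>t s. (\<lambda>w. Qtil t w s) \<in> borel_measurable (hist_alg M X xi (Suc t))"
    and pi0: "is_policy pi0"
    and pis0: "pis 0 = (\<lambda>w. pi0)"
    and spmd: "\<forall>t w. spmd_step omega gomega h (1 / (mu * (real t + 1))) (Qtil t w) (pis t w) (pis (Suc t) w)"
    and Dbar0: "Dbar0 > 0" "\<forall>pol s. is_policy pol \<longrightarrow> bregman omega gomega (pol s) (pi0 s) \<le> Dbar0"
    and pistar: "is_policy pistar"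
      "\<forall>pol. is_policy pol \<longrightarrow> (\<forall>s. value_fn P c h gamma pistar s \<le> value_fn P c h gamma pol s)"
    and k: "k \<ge> 1"
  shows
   "(assumption_B M X xi nrm (q_fn P c h gamma) pis Qtil vsig sig Qbar \<longrightarrow>
      (\<forall>s. (1 / real k) * (\<Sum>t<k. (\<integral>w. value_fn P c h gamma (pis t w) s - value_fn P c h gamma pistar s \<partial>M))
           + mu / (1 - gamma) * (\<Sum>q\<in>UNIV. visitation P gamma pistar s q *
                 (\<integral>w. bregman omega gomega (pistar q) (pis k w q) \<partial>M))
         \<le> (mu * Dbar0 + (1 / mu) * (Qbar\<^sup>2 + Mh\<^sup>2) * ln (2 * real k) + 2 * vsig * real k)
           / ((1 - gamma) * real k)))
    \<and>
    (assumption_B M X xi nrm (q_fn P c h gamma) pis Qtil vsig sig Qbar \<and> vsig \<le> sig / real k \<longrightarrow>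
      (\<forall>delta. 0 < delta \<and> delta \<le> 1 \<longrightarrow>
        (let L = ln (4 * real k * real CARD('s) / delta);
             C = 6 * Dbar0 / (1 - gamma) + 75 * (Qbar\<^sup>2 + Mh\<^sup>2) * L powr (3/2) / ((1 - gamma) * mu\<^sup>2)
                 + 108 * sig\<^sup>2 * L ^ 3 / ((1 - gamma)\<^sup>2 * mu\<^sup>2)
         in measure M {w \<in> space M. \<exists>s.
              (1 / real k) * (\<Sum>t<k. value_fn P c h gamma (pis t w) s - value_fn P c h gamma pistar s)
              + mu / (1 - gamma) * (\<Sum>q\<in>UNIV. visitation P gamma pistar s q *
                    bregman omega gomega (pistar q) (pis k w q))
              > (mu * Dbar0 + (25 * (1 / mu) * (Qbar\<^sup>2 + Mh\<^sup>2) + 2 * sig * sqrt (3 * C)) * L powr (3/2))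
                / ((1 - gamma) * real k)}
            \<le> (real k + 1) * delta)))"
proof -
  interpret spmd P c gamma h nrm omega gomega M hd mu Mh X xi Qtil pis pi0 pistar Dbar0
    using assms by (intro spmd.intro mdp.intro dgf.intro spmd_axioms.intro) auto
  show ?thesis
    unfolding Let_def using expected_regret[OF _ k] high_probability_regret[OF _ k] by blast
qed

end
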